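(* Let $\kappa\in\mathbb{N}^n$, let $\lambda:=\{\lambda(\alpha)\}_{\alpha\le\kappa}$ be a sequence of real numbers, and let $T:\mathbb{R}_\kappa[z_1,\ldots,z_n]\to\mathbb{R}_\kappa[z_1,\ldots,z_n]$ be the corresponding linear operator, $T(z^\alpha)=\lambda(\alpha)z^\alpha$ for $\alpha\le\kappa$. The following are equivalent: (a) $\lambda$ is a $\kappa$-multiplier sequence; (b) $\pm\lambda$ is the product of one-dimensional $\kappa_i$-multiplier sequences that are either all alternating in sign or all non-negative, i.e., $$\pm\lambda(\alpha)=\lambda_1(\alpha_1)\cdots\lambda_n(\alpha_n),\qquad \alpha\le\kappa,$$ where $\lambda_i$ is a $\kappa_i$-multiplier sequence for $i\in\{1,\ldots,n\}$, and either all $\lambda_i$'s are non-negative or all are alternating in sign; (c) either $T[(z+w)^\kappa]\in\mathcal{H}_{2n}(\mathbb{R})$ or $T[(z-w)^\kappa]\in\mathcal{H}_{2n}(\mathbb{R})$; (d) $T[(1+zw)^\kappa]$ or $T[(1-zw)^\kappa]$ can be written as $$f_1(z_1w_1)\cdots f_n(z_nw_n),$$ where $f_1(t),\ldots,f_n(t)$ are univariate polynomials with real zeros only, and all these zeros have the same sign (collectively).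
   Context: $\mathbb{N}$ contains $0$; $\alpha\le\kappa$ means $\alpha_i\le\kappa_i$ for all $i$; $z^\alpha=z_1^{\alpha_1}\cdots z_n^{\alpha_n}$. $\mathbb{R}_\kappa[z_1,\ldots,z_n]$ is the space of real polynomials $f$ with $\deg_{z_i}(f)\le\kappa_i$ for all $i$. A polynomial is stable if it is nonzero whenever all its variables have positive imaginary part, and real stable if moreover all its coefficients are real; $\mathcal{H}_m(\mathbb{R})$ is the set of real stable polynomials in $m$ variables. A sequence $\{\lambda(\alpha)\}_{\alpha\le\kappa}$ of real numbers is a $\kappa$-multiplier sequence if the linear operator $T$ on $\mathbb{R}_\kappa[z_1,\ldots,z_n]$ with $T(z^\alpha)=\lambda(\alpha)z^\alpha$ preserves real stability, i.e., maps each real stable polynomial in $\mathbb{R}_\kappa[z_1,\ldots,z_n]$ to a real stable polynomial or to $0$; the case of one variable defines one-dimensional $\kappa_i$-multiplier sequences $\{\lambda_i(k)\}_{0\le k\le\kappa_i}$. Here $(z\pm w)^\kappa=\prod_{i=1}^n(z_i\pm w_i)^{\kappa_i}$ and $(1\pm zw)^\kappa=\prod_{i=1}^n(1\pm z_iw_i)^{\kappa_i}$, and $T$ acts on the $z$-variables only, e.g. $T[(z+w)^\kappa]=\sum_{\alpha\le\kappa}\binom{\kappa}{\alpha}T(z^\alpha)w^{\kappa-\alpha}$ with $\binom{\kappa}{\alpha}=\prod_i\binom{\kappa_i}{\alpha_i}$.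
   Formalization: For λ identically zero on α ≤ κ, (a) and (b) hold but (c) and (d) fail, since the zero polynomial is not stable; so (a)⇔(b) and (c)⇔(d) are stated for all λ, and the equivalence of (a) with (c) only for λ not identically zero. *)

theory Defs
  imports Complex_Main "HOL-Library.Poly_Mapping" "HOL-Computational_Algebra.Polynomial"
begin

text \<open>Polynomials whose variables are indexed by the type \<open>'v\<close>: finitely supported
  functions from monomials (themselves finitely supported exponent functions) to coefficients.
  For a finite type \<open>'n\<close> they model polynomials in \<open>z\<^sub>1,\<dots>,z\<^sub>n\<close>; in the
  type \<open>'n + 'n\<close> the variables \<open>Inl i\<close> stand for \<open>z\<^sub>i\<close> and \<open>Inr i\<close> for
  \<open>w\<^sub>i\<close>. Since types are nonempty, the number of variables is at least one.\<close>

type_synonym ('v, 'a) mvpoly = "('v \<Rightarrow>\<^sub>0 nat) \<Rightarrow>\<^sub>0 'a"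

definition Var :: "'v \<Rightarrow> ('v, 'a::comm_semiring_1) mvpoly"
  where "Var i = Poly_Mapping.single (Poly_Mapping.single i 1) 1"

definition Const :: "'a::comm_semiring_1 \<Rightarrow> ('v, 'a) mvpoly"
  where "Const c = Poly_Mapping.single 0 c"

definition mv_eval :: "('v::finite, 'a::comm_semiring_1) mvpoly \<Rightarrow> ('v \<Rightarrow> 'a) \<Rightarrow> 'a"
  where "mv_eval f x =
    (\<Sum>m\<in>Poly_Mapping.keys f. Poly_Mapping.lookup f m * (\<Prod>i\<in>UNIV. x i ^ Poly_Mapping.lookup m i))"

definition stable :: "('v::finite, complex) mvpoly \<Rightarrow> bool"
  where "stable f \<longleftrightarrow> (\<forall>x. (\<forall>i. Im (x i) > 0) \<longrightarrow> mv_eval f x \<noteq> 0)"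

text \<open>The zero polynomial is not (real) stable.\<close>

definition real_stable :: "('v::finite, real) mvpoly \<Rightarrow> bool"
  where "real_stable f \<longleftrightarrow> stable (Poly_Mapping.map complex_of_real f)"

definition polys_le :: "('v \<Rightarrow> nat) \<Rightarrow> ('v, 'a::comm_semiring_1) mvpoly set"
  where "polys_le \<kappa> = {f. \<forall>m\<in>Poly_Mapping.keys f. \<forall>i. Poly_Mapping.lookup m i \<le> \<kappa> i}"

text \<open>The diagonal operator scaling the monomial \<open>m\<close> by \<open>\<mu> m\<close>. It is defined on all
  polynomials; on \<open>polys_le \<kappa>\<close> only the values \<open>\<mu> m\<close> with exponents bounded by
  \<open>\<kappa>\<close> are relevant.\<close>

definition diag_op :: "(('v \<Rightarrow>\<^sub>0 nat) \<Rightarrow> 'a) \<Rightarrow> ('v, 'a::comm_semiring_1) mvpoly \<Rightarrow> ('v, 'a) mvpoly"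
  where "diag_op \<mu> f = Poly_Mapping.mapp (\<lambda>m c. \<mu> m * c) f"

definition mult_op :: "(('v \<Rightarrow> nat) \<Rightarrow> real) \<Rightarrow> ('v, real) mvpoly \<Rightarrow> ('v, real) mvpoly"
  where "mult_op l = diag_op (\<lambda>m. l (Poly_Mapping.lookup m))"

text \<open>The same operator acting on the \<open>z\<close>-variables only, i.e.
  \<open>z\<^sup>\<alpha> w\<^sup>\<beta> \<mapsto> l(\<alpha>) z\<^sup>\<alpha> w\<^sup>\<beta>\<close>.\<close>

definition mult_op_z :: "(('n \<Rightarrow> nat) \<Rightarrow> real) \<Rightarrow> ('n + 'n, real) mvpoly \<Rightarrow> ('n + 'n, real) mvpoly"
  where "mult_op_z l = diag_op (\<lambda>m. l (\<lambda>i. Poly_Mapping.lookup m (Inl i)))"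

lemma lookup_diag_op: "Poly_Mapping.lookup (diag_op \<mu> f) m = \<mu> m * Poly_Mapping.lookup f m"
  by (cases "m \<in> Poly_Mapping.keys f")
    (auto simp: diag_op_def mapp.rep_eq in_keys_iff when_def)

lemma mult_op_monomial:
  "mult_op l (Poly_Mapping.single \<alpha> 1) = Const (l (Poly_Mapping.lookup \<alpha>)) * Poly_Mapping.single \<alpha> 1"
  by (rule poly_mapping_eqI)
    (simp add: mult_op_def lookup_diag_op Const_def mult_single lookup_single when_def)

definition multiplier_seq :: "('v::finite \<Rightarrow> nat) \<Rightarrow> (('v \<Rightarrow> nat) \<Rightarrow> real) \<Rightarrow> bool"
  where "multiplier_seq \<kappa> l \<longleftrightarrow>
    (\<forall>f\<in>polys_le \<kappa>. real_stable f \<longrightarrow> real_stable (mult_op l f) \<or> mult_op l f = 0)"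

text \<open>The case of a single variable, indexed by the type \<open>unit\<close>.\<close>

definition multiplier_seq1 :: "nat \<Rightarrow> (nat \<Rightarrow> real) \<Rightarrow> bool"
  where "multiplier_seq1 k l \<longleftrightarrow> multiplier_seq (\<lambda>_::unit. k) (\<lambda>\<alpha>. l (\<alpha> ()))"

text \<open>Vanishing terms are permitted, and the first term may have either sign.\<close>

definition alternating_upto :: "nat \<Rightarrow> (nat \<Rightarrow> real) \<Rightarrow> bool"
  where "alternating_upto k l \<longleftrightarrow>
    (\<forall>j\<le>k. (-1) ^ j * l j \<ge> 0) \<or> (\<forall>j\<le>k. (-1) ^ j * l j \<le> 0)"

text \<open>\<open>z\<^sub>i\<close> and \<open>w\<^sub>i\<close> as polynomials in the \<open>2n\<close> variables.\<close>

definition zvar :: "'n \<Rightarrow> ('n + 'n, real) mvpoly" where "zvar i = Var (Inl i)"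

definition wvar :: "'n \<Rightarrow> ('n + 'n, real) mvpoly" where "wvar i = Var (Inr i)"

definition subst_poly :: "real poly \<Rightarrow> ('v, real) mvpoly \<Rightarrow> ('v, real) mvpoly"
  where "subst_poly f p = poly (map_poly Const f) p"

text \<open>All complex zeros are real; nonzero constants qualify, the zero polynomial does not.\<close>

definition real_zeros_only :: "real poly \<Rightarrow> bool"
  where "real_zeros_only f \<longleftrightarrow> (\<forall>x. poly (map_poly complex_of_real f) x = 0 \<longrightarrow> x \<in> \<real>)"

text \<open>A zero at the origin is compatible with either sign.\<close>

definition zeros_same_sign :: "('i \<Rightarrow> real poly) \<Rightarrow> bool"
  where "zeros_same_sign f \<longleftrightarrow>
    (\<forall>i x. poly (f i) x = 0 \<longrightarrow> x \<le> 0) \<or> (\<forall>i x. poly (f i) x = 0 \<longrightarrow> x \<ge> 0)"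

definition splits_real_same_sign :: "('n::finite + 'n, real) mvpoly \<Rightarrow> bool"
  where "splits_real_same_sign p \<longleftrightarrow>
    (\<exists>f. (\<forall>i. real_zeros_only (f i)) \<and> zeros_same_sign f \<and>
      p = (\<Prod>i\<in>UNIV. subst_poly (f i) (zvar i * wvar i)))"

end

theory Submission imports Defs "HOL-Complex_Analysis.Complex_Analysis"
  "HOL-Computational_Algebra.Fundamental_Theorem_Algebra"
begin

text \<open>
Let \<open>P(x) = \<Sum> binomial(\<kappa>,\<alpha>) l(\<alpha>) x\<^sup>\<alpha>\<close>, the sum over \<open>\<alpha> \<le> \<kappa>\<close>. All four conditions are
conditions on the zeros of this single polynomial. Evaluating the symbols gives
\<open>T[(1 + zw)\<^sup>\<kappa>] = P(zw)\<close> and \<open>T[(z + w)\<^sup>\<kappa>] = w\<^sup>\<kappa> P(z/w)\<close>, and the quotients \<open>z/w\<close> of two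
points of the upper half-plane are exactly the points off the ray of nonpositive reals. So (c) says
that \<open>P\<close> has no zero when all variables avoid the nonpositive reals, or none when they all avoid the
nonnegative reals, and (d) says that \<open>P\<close> is a product of univariate polynomials with real zeros of
one sign.

The heart of the matter is that a polynomial with real coefficients and without zeros in
\<open>(\<complex> - \<real>)\<^sup>n\<close> is a product of univariate polynomials (\<open>coeffs_factor\<close>). Fix all variables but one
at points of the upper half-plane: the resulting univariate polynomial has only real zeros, so the
ratio of any two of its coefficients is real. These ratios are holomorphic in the fixed
variables, and a real-valued holomorphic function is constant. Hence the coefficients obey an
exchange law, and exchanging one coordinate after another yields the product. This gives (c) to (d);
the converse is immediate from the description of the quotients.

A multiplier sequence that is not identically zero satisfies the hypothesis of that result: applying
\<open>T\<close> to \<open>\<Prod>(1 \<plusminus> x\<^sub>i)\<^bsup>\<kappa>\<^sub>i\<^esup>\<close> for all choices of signs shows that \<open>P\<close> has no zero with all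
coordinates nonreal. So \<open>l\<close> is a product of one-dimensional sequences. Their signs are controlled by
two further families of tests: \<open>x\<^sup>\<alpha>(1 - x\<^sub>i x\<^sub>j)\<close> shows that \<open>l\<close> does not change sign
between \<open>\<alpha>\<close> and \<open>\<alpha> + e\<^sub>i + e\<^sub>j\<close>, and \<open>x\<^sup>p(1 + x)\<^bsup>N-1\<^esup>(1 \<plusminus> x)\<close> shows that a
one-dimensional multiplier sequence has no internal zeros (\<open>multiplier_seq1_no_gaps\<close>). Together
these leave only the two sign patterns in (b).

From (b) to (d) one applies each one-dimensional operator to \<open>(1 + x)\<^bsup>\<kappa>\<^sub>i\<^esup>\<close>. From (d) to (a) the
operator is applied one variable at a time. In a single variable it multiplies coefficients by
those of a polynomial with negative zeros, divided by binomial coefficients, and Szego's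
composition theorem (\<open>szego_composition\<close>) says that this keeps the upper half-plane free of zeros.
It is proved from Laguerre's theorem on polar derivatives. Zeros at the origin and degrees
below \<open>\<kappa>\<^sub>i\<close> are reached as limits, by Hurwitz's theorem along complex lines (\<open>hurwitz_peval\<close>);
nonnegative zeros are reduced to nonpositive ones by the substitution \<open>x \<mapsto> -x\<close>.

The sequence that vanishes for all \<open>\<alpha> \<le> \<kappa>\<close> satisfies (a) and (b) but neither (c) nor (d), because the zero
polynomial is neither stable nor a product of nonzero polynomials; it is the only exception to the
equivalence of (a) and (c).
\<close>

section \<open>The composition theorem of Szego for the upper half-plane\<close>

text \<open>The map \<open>r \<mapsto> 1 / (z - r)\<close> sends the closed lower half-plane into a closed disc with the origin on its
boundary, and the rest of the plane outside this disc. Convexity of this disc is what makes sums over zeros tractable below.\<close>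

lemma half_plane_inversion_disc:
  fixes z r :: complex
  assumes "Im z > 0" "z \<noteq> r"
  shows "norm (1 / (z - r) + \<i> / of_real (2 * Im z)) \<le> 1 / (2 * Im z) \<longleftrightarrow> Im r \<le> 0"
proof -
  define y where "y = Im z"
  have y: "y > 0" using assms by (simp add: y_def)
  have nz: "norm (z - r) > 0" using assms by simp
  have "1 / (z - r) + \<i> / of_real (2 * y) = (of_real (2*y) + \<i> * (z - r)) / ((z - r) * of_real (2 * y))"
    using assms y by (simp add: field_simps)
  then have eq: "norm (1 / (z - r) + \<i> / of_real (2 * y)) =
      norm (of_real (2*y) + \<i> * (z - r)) / (norm (z - r) * (2 * y))"
    using y by (simp only: norm_divide norm_mult norm_of_real)
  have "norm (1 / (z - r) + \<i> / of_real (2 * y)) \<le> 1 / (2 * y) \<longleftrightarrow>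
      norm (of_real (2*y) + \<i> * (z - r)) \<le> norm (z - r)"
    unfolding eq using y nz by (simp add: divide_le_eq)
  also have "\<dots> \<longleftrightarrow> (norm (of_real (2*y) + \<i> * (z - r)))\<^sup>2 \<le> (norm (z - r))\<^sup>2"
    by (simp add: power_mono_iff)
  also have "\<dots> \<longleftrightarrow> 4 * y * Im r \<le> 0"
    unfolding cmod_power2 by (simp add: y_def power2_eq_square algebra_simps)
  also have "\<dots> \<longleftrightarrow> Im r \<le> 0"
    using y by (simp add: mult_le_0_iff)
  finally show ?thesis by (simp add: y_def)
qed

text \<open>The logarithmic derivative is a sum of at most \<open>m\<close> points of the disc of the previous lemma, so it
lies in the \<open>m\<close>-fold dilate; a missing summand may be replaced by the origin, which is in the disc.\<close>

lemma log_deriv_in_disc: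
  fixes p :: "complex poly"
  assumes z: "Im z > 0" and p: "\<And>w. Im w > 0 \<Longrightarrow> poly p w \<noteq> 0" and m: "degree p \<le> m"
  shows "norm (poly (pderiv p) z / poly p z + of_nat m * (\<i> / of_real (2 * Im z))) \<le> m / (2 * Im z)"
  using p m
proof (induction m arbitrary: p)
  case 0
  then have "pderiv p = 0" by (simp add: pderiv_eq_0_iff)
  then show ?case by simp
next
  case (Suc m)
  define c where "c = \<i> / of_real (2 * Im z)"
  define R where "R = 1 / (2 * Im z)"
  have cR: "norm c = R" using z by (simp add: c_def R_def norm_divide norm_mult)
  show ?case
  proof (cases "degree p \<le> m")
    case True
    have "norm (poly (pderiv p) z / poly p z + of_nat m * c) \<le> m * R"
      using Suc.IH[of p] Suc.prems True by (simp add: c_def R_def)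
    then have "norm ((poly (pderiv p) z / poly p z + of_nat m * c) + c) \<le> m * R + R"
      using cR norm_triangle_mono by (metis order_refl)
    then show ?thesis
      unfolding c_def[symmetric] by (simp add: algebra_simps R_def add_divide_distrib)
  next
    case False
    then have "degree p \<noteq> 0" by auto
    then obtain r where "poly p r = 0"
      using alg_closed_imp_poly_has_root[of p] by auto
    then obtain q where q: "p = [:-r, 1:] * q"
      by (metis dvdE poly_eq_0_iff_dvd)
    have q0: "q \<noteq> 0" using Suc.prems(1)[of z] z q by auto
    have dq: "degree q \<le> m"
      using Suc.prems(2) q0 unfolding q by (subst (asm) degree_mult_eq) auto
    have qn: "poly q w \<noteq> 0" if "Im w > 0" for w
      using Suc.prems(1)[OF that] q by auto
    have zr: "z \<noteq> r" using Suc.prems(1)[OF z] q by auto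
    have r: "Im r \<le> 0" using Suc.prems(1)[of r] \<open>poly p r = 0\<close> by fastforce
    have "pderiv p = q + [:-r, 1:] * pderiv q"
      unfolding q by (simp add: pderiv_mult pderiv_pCons pderiv_diff pderiv_smult)
    then have dp: "poly (pderiv p) z = poly q z + (z - r) * poly (pderiv q) z"
      by (simp only:) (simp add: algebra_simps)
    have "poly p z = (z - r) * poly q z"
      by (simp add: q algebra_simps)
    then have "poly (pderiv p) z / poly p z = 1 / (z - r) + poly (pderiv q) z / poly q z"
      unfolding dp using zr qn[OF z] by (simp add: add_divide_distrib)
    then have "poly (pderiv p) z / poly p z + of_nat (Suc m) * c =
       (poly (pderiv q) z / poly q z + of_nat m * c) + (1 / (z - r) + c)"
      by (simp add: algebra_simps)
    moreover have "norm (poly (pderiv q) z / poly q z + of_nat m * c) \<le> m * R"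
      using Suc.IH[of q] qn dq by (simp add: c_def R_def)
    moreover have "norm (1 / (z - r) + c) \<le> R"
      using half_plane_inversion_disc[OF z zr] r by (simp add: c_def R_def)
    ultimately have "norm (poly (pderiv p) z / poly p z + of_nat (Suc m) * c) \<le> m * R + R"
      using norm_triangle_mono by metis
    then show ?thesis
      unfolding c_def[symmetric] by (simp add: algebra_simps R_def add_divide_distrib)
  qed
qed

text \<open>The polar derivative of Laguerre: \<open>m p + (u - X) p'\<close>, for \<open>p\<close> regarded as a polynomial of degree \<open>m\<close>.\<close>

definition polar_deriv :: "nat \<Rightarrow> complex \<Rightarrow> complex poly \<Rightarrow> complex poly"
  where "polar_deriv m u p = smult (of_nat m) p + [:u, -1:] * pderiv p"

lemma coeff_polar_deriv:
  "coeff (polar_deriv m u p) k =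
    (of_nat m - of_nat k) * coeff p k + of_nat (Suc k) * u * coeff p (Suc k)"
  by (cases k) (auto simp: polar_deriv_def coeff_pCons coeff_pderiv algebra_simps)

lemma degree_polar_deriv:
  assumes "degree p \<le> Suc m"
  shows "degree (polar_deriv (Suc m) u p) \<le> m"
proof (rule degree_le, intro allI impI)
  fix k assume "m < k"
  then show "coeff (polar_deriv (Suc m) u p) k = 0"
    using assms by (cases "k = Suc m") (auto simp: coeff_polar_deriv coeff_eq_0)
qed

text \<open>A zero \<open>z\<close> of the polar derivative means \<open>p'(z)/p(z) = m / (z - u)\<close>. The left side is \<open>m\<close> times a
point of the disc that corresponds to the lower half-plane, which forces \<open>u\<close> into the lower
half-plane.\<close>

lemma laguerre:
  fixes p :: "complex poly"
  assumes p: "\<And>w. Im w > 0 \<Longrightarrow> poly p w \<noteq> 0" and m: "degree p \<le> m" "m > 0"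
    and u: "Im u > 0" and z: "Im z > 0"
  shows "poly (polar_deriv m u p) z \<noteq> 0"
proof
  assume "poly (polar_deriv m u p) z = 0"
  then have eq: "of_nat m * poly p z = (z - u) * poly (pderiv p) z"
    by (simp add: polar_deriv_def algebra_simps)
  have zu: "z \<noteq> u" using eq p[OF z] m by auto
  have "poly (pderiv p) z / poly p z = of_nat m * (1 / (z - u))"
    using eq zu p[OF z] by (simp add: field_simps)
  then have "norm (of_nat m * (1 / (z - u) + \<i> / of_real (2 * Im z))) \<le> m / (2 * Im z)"
    using log_deriv_in_disc[OF z p m(1)] by (simp add: algebra_simps)
  then have "norm (1 / (z - u) + \<i> / of_real (2 * Im z)) \<le> 1 / (2 * Im z)"
    unfolding norm_mult using m z by (simp add: field_simps)
  then show False using half_plane_inversion_disc[OF z zu] u by simp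
qed

text \<open>Induction on the linear factors \<open>b + x\<close>. By the identity \<open>term_eq\<close> below, removing one factor from
the product amounts to replacing \<open>p\<close> by its polar derivative with pole \<open>z / b\<close>. That pole lies in
the upper half-plane because \<open>b > 0\<close>, so Laguerre's theorem applies.\<close>

lemma szego_composition:
  fixes p :: "complex poly" and B :: "real multiset"
  assumes p: "\<And>w. Im w > 0 \<Longrightarrow> poly p w \<noteq> 0" and deg: "degree p \<le> size B"
    and B: "\<And>b. b \<in># B \<Longrightarrow> b > 0" and z: "Im z > 0"
  shows "(\<Sum>k\<le>size B. coeff p k * of_real (coeff (\<Prod>b\<in>#B. [:b, 1:]) k) * z ^ k
            / of_nat (size B choose k)) \<noteq> 0"
  using p deg B
proof (induction B arbitrary: p)
  case empty
  then have "poly p z \<noteq> 0" "degree p = 0" using z by auto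
  then have "coeff p 0 \<noteq> 0" by (auto elim!: degree_eq_zeroE)
  then show ?case by simp
next
  case (add b B)
  define m where "m = size B"
  define G where "G = (\<Prod>b\<in>#B. [:b, 1:])"
  have b: "b > 0" using add.prems by simp
  define p1 where "p1 = polar_deriv (Suc m) (z / of_real b) p"
  have u: "Im (z / of_real b) > 0" using b z by simp
  have ih: "(\<Sum>k\<le>m. coeff p1 k * of_real (coeff G k) * z ^ k / of_nat (m choose k)) \<noteq> 0"
    unfolding m_def G_def
  proof (rule add.IH)
    show "poly p1 w \<noteq> 0" if "Im w > 0" for w
      unfolding p1_def using add.prems that u
      by (intro laguerre) (auto simp: m_def)
    show "degree p1 \<le> size B"
      unfolding p1_def using add.prems(2) unfolding m_def by (intro degree_polar_deriv) simp
    show "\<And>b. b \<in># B \<Longrightarrow> b > 0" using add.prems by auto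
  qed
  have G0: "coeff G (Suc m) = 0"
  proof -
    have "degree G \<le> m"
      unfolding G_def m_def
    proof (induction B)
      case (add x B)
      then show ?case
        using degree_mult_le[of "[:x,1:]" "\<Prod>b\<in>#B. [:b, 1:]"] by (simp del: mult_pCons_left)
    qed auto
    then show ?thesis by (simp add: coeff_eq_0)
  qed
  have ch1: "of_nat (Suc m - k) / of_nat (m choose k) = (of_nat (Suc m) / of_nat (Suc m choose k) :: complex)"
    if "k \<le> m" for k
  proof -
    have "(Suc m - k) * (Suc m choose k) = Suc m * (m choose k)"
      using binomial_absorb_comp[of "Suc m" k] by simp
    then have "(of_nat (Suc m - k) * of_nat (Suc m choose k) :: complex) = of_nat (Suc m) * of_nat (m choose k)"
      by (metis of_nat_mult)
    then show ?thesis using that by (simp add: field_simps del: of_nat_Suc)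
  qed
  have ch2: "of_nat (Suc k) / of_nat (m choose k) = (of_nat (Suc m) / of_nat (Suc m choose Suc k) :: complex)"
    if "k \<le> m" for k
  proof -
    have "Suc k * (Suc m choose Suc k) = Suc m * (m choose k)"
      by (simp only: Suc_times_binomial)
    then have "(of_nat (Suc k) * of_nat (Suc m choose Suc k) :: complex) = of_nat (Suc m) * of_nat (m choose k)"
      by (metis of_nat_mult)
    then show ?thesis using that by (simp add: field_simps del: of_nat_Suc binomial_Suc_Suc)
  qed
  have term_eq: "of_real b * (coeff p1 k * of_real (coeff G k) * z ^ k / of_nat (m choose k)) =
     of_nat (Suc m) * (coeff p k * of_real (b * coeff G k) * z ^ k / of_nat (Suc m choose k) +
      coeff p (Suc k) * of_real (coeff G k) * z ^ Suc k / of_nat (Suc m choose Suc k))"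
    if "k \<le> m" for k
  proof -
    have "of_real b * (coeff p1 k * of_real (coeff G k) * z ^ k / of_nat (m choose k)) =
      of_real b * of_real (coeff G k) * z ^ k *
       ((of_nat (Suc m - k) / of_nat (m choose k)) * coeff p k
        + (of_nat (Suc k) / of_nat (m choose k)) * (z / of_real b) * coeff p (Suc k))"
      using that by (simp add: p1_def coeff_polar_deriv of_nat_diff divide_inverse distrib_left distrib_right left_diff_distrib right_diff_distrib mult_ac)
    also have "\<dots> = of_real b * of_real (coeff G k) * z ^ k *
       ((of_nat (Suc m) / of_nat (Suc m choose k)) * coeff p k
        + (of_nat (Suc m) / of_nat (Suc m choose Suc k)) * (z / of_real b) * coeff p (Suc k))"
      by (simp only: ch1[OF that] ch2[OF that])
    also have "\<dots> = of_nat (Suc m) * (coeff p k * of_real (b * coeff G k) * z ^ k / of_nat (Suc m choose k) +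
      coeff p (Suc k) * of_real (coeff G k) * z ^ Suc k / of_nat (Suc m choose Suc k))"
      using b that by (simp add: distrib_left divide_inverse mult_ac del: of_nat_Suc binomial_Suc_Suc)
    finally show ?thesis .
  qed
  let ?F = "\<lambda>k c. coeff p k * of_real c * z ^ k / of_nat (Suc m choose k)"
  have cG: "coeff (\<Prod>b\<in>#add_mset b B. [:b, 1:]) k = b * coeff G k + (case k of 0 \<Rightarrow> 0 | Suc j \<Rightarrow> coeff G j)" for k
    by (simp add: G_def coeff_pCons split: nat.splits)
  have "(\<Sum>k\<le>Suc m. ?F k (coeff (\<Prod>b\<in>#add_mset b B. [:b, 1:]) k)) =
     (\<Sum>k\<le>Suc m. ?F k (b * coeff G k)) + (\<Sum>k\<le>Suc m. ?F k (case k of 0 \<Rightarrow> 0 | Suc j \<Rightarrow> coeff G j))"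
    unfolding cG by (simp add: sum.distrib[symmetric] add_divide_distrib distrib_left distrib_right del: sum.atMost_Suc binomial_Suc_Suc)
  also have "(\<Sum>k\<le>Suc m. ?F k (b * coeff G k)) = (\<Sum>k\<le>m. ?F k (b * coeff G k))"
    by (simp add: G0)
  also have "(\<Sum>k\<le>Suc m. ?F k (case k of 0 \<Rightarrow> 0 | Suc j \<Rightarrow> coeff G j)) = (\<Sum>k\<le>m. ?F (Suc k) (coeff G k))"
    by (subst sum.atMost_Suc_shift) simp
  finally have "of_nat (Suc m) * (\<Sum>k\<le>Suc m. ?F k (coeff (\<Prod>b\<in>#add_mset b B. [:b, 1:]) k)) =
     (\<Sum>k\<le>m. of_nat (Suc m) * (?F k (b * coeff G k) + ?F (Suc k) (coeff G k)))"
    by (simp add: sum.distrib[symmetric] sum_distrib_left del: sum.atMost_Suc of_nat_Suc binomial_Suc_Suc)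
  also have "\<dots> = of_real b * (\<Sum>k\<le>m. coeff p1 k * of_real (coeff G k) * z ^ k / of_nat (m choose k))"
    unfolding sum_distrib_left by (intro sum.cong refl term_eq[symmetric]) auto
  finally have "of_nat (Suc m) * (\<Sum>k\<le>Suc m. ?F k (coeff (\<Prod>b\<in>#add_mset b B. [:b, 1:]) k)) \<noteq> 0"
    using ih b by auto
  then show ?case by (auto simp only: size_add_mset m_def mult_eq_0_iff)
qed

section \<open>Polynomials given by coefficients on a box of exponents\<close>

definition exps :: "('n \<Rightarrow> nat) \<Rightarrow> ('n \<Rightarrow> nat) set"
  where "exps \<kappa> = {\<alpha>. \<alpha> \<le> \<kappa>}"

lemma exps_eq_PiE: "exps \<kappa> = (\<Pi>\<^sub>E i\<in>UNIV. {..\<kappa> i})"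
  by (auto simp: exps_def le_fun_def PiE_iff)

lemma finite_exps [simp]: "finite (exps (\<kappa> :: 'n::finite \<Rightarrow> nat))"
  unfolding exps_eq_PiE by (intro finite_PiE) auto

lemma exps_iff: "\<alpha> \<in> exps \<kappa> \<longleftrightarrow> (\<forall>i. \<alpha> i \<le> \<kappa> i)"
  by (simp add: exps_def le_fun_def)

definition mon :: "('n::finite \<Rightarrow> 'a::comm_semiring_1) \<Rightarrow> ('n \<Rightarrow> nat) \<Rightarrow> 'a"
  where "mon x \<alpha> = (\<Prod>i\<in>UNIV. x i ^ \<alpha> i)"

definition peval :: "('n::finite \<Rightarrow> nat) \<Rightarrow> (('n \<Rightarrow> nat) \<Rightarrow> complex) \<Rightarrow> ('n \<Rightarrow> complex) \<Rightarrow> complex"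
  where "peval \<kappa> c x = (\<Sum>\<alpha>\<in>exps \<kappa>. c \<alpha> * mon x \<alpha>)"

definition zero_free :: "complex set \<Rightarrow> ('n::finite \<Rightarrow> nat) \<Rightarrow> (('n \<Rightarrow> nat) \<Rightarrow> complex) \<Rightarrow> bool"
  where "zero_free A \<kappa> c \<longleftrightarrow> (\<forall>x. (\<forall>i. x i \<in> A) \<longrightarrow> peval \<kappa> c x \<noteq> 0)"

abbreviation upper :: "complex set"
  where "upper \<equiv> {z. Im z > 0}"

lemma mon_mult: "mon (\<lambda>i. x i * y i) \<alpha> = mon x \<alpha> * mon y \<alpha>"
  by (simp add: mon_def power_mult_distrib prod.distrib)

lemma mon_upd: "mon x (\<alpha>(i := k)) = mon x (\<alpha>(i := 0)) * x i ^ k"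
proof -
  have "mon x (\<alpha>(i := j)) = x i ^ j * (\<Prod>m\<in>UNIV - {i}. x m ^ \<alpha> m)" for j
    unfolding mon_def by (subst prod.remove[of _ i]) (auto intro!: prod.cong)
  from this[of k] this[of 0] show ?thesis by (simp add: mult.commute)
qed

lemma mon_cong_var:
  assumes "\<alpha> i = 0" shows "mon (x(i := t)) \<alpha> = mon x \<alpha>"
  using assms unfolding mon_def by (intro prod.cong) auto

lemma prod_sum_exps:
  fixes f :: "'n::finite \<Rightarrow> nat \<Rightarrow> 'a::comm_semiring_1"
  shows "(\<Prod>i\<in>UNIV. \<Sum>k\<le>\<kappa> i. f i k) = (\<Sum>\<alpha>\<in>exps \<kappa>. \<Prod>i\<in>UNIV. f i (\<alpha> i))"
  unfolding exps_eq_PiE by (intro prod_sum_PiE) auto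

lemma peval_prod:
  "peval \<kappa> (\<lambda>\<alpha>. \<Prod>i\<in>UNIV. c i (\<alpha> i)) x = (\<Prod>i\<in>UNIV. \<Sum>k\<le>\<kappa> i. c i k * x i ^ k)"
  unfolding prod_sum_exps by (simp add: peval_def mon_def prod.distrib)

lemma peval_cong:
  assumes "\<And>\<alpha>. \<alpha> \<in> exps \<kappa> \<Longrightarrow> c \<alpha> = d \<alpha>"
  shows "peval \<kappa> c x = peval \<kappa> d x"
  unfolding peval_def using assms by (intro sum.cong) auto

lemma zero_free_cong:
  assumes "\<And>\<alpha>. \<alpha> \<in> exps \<kappa> \<Longrightarrow> c \<alpha> = d \<alpha>"
  shows "zero_free A \<kappa> c \<longleftrightarrow> zero_free A \<kappa> d"
  unfolding zero_free_def using peval_cong[of \<kappa> c d, OF assms] by simp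

text \<open>The coefficient of \<open>x\<^sub>i\<^bsup>k\<^esup>\<close> as a polynomial in the other variables. It is kept in the same box
of exponents and supported where the exponent of \<open>x\<^sub>i\<close> vanishes, so that slicing can be iterated
without changing the index type.\<close>

definition slice :: "'n \<Rightarrow> nat \<Rightarrow> (('n \<Rightarrow> nat) \<Rightarrow> complex) \<Rightarrow> ('n \<Rightarrow> nat) \<Rightarrow> complex"
  where "slice i k c \<alpha> = (if \<alpha> i = 0 then c (\<alpha>(i := k)) else 0)"

lemma peval_slice:
  "peval \<kappa> c x = (\<Sum>k\<le>\<kappa> i. peval \<kappa> (slice i k c) x * x i ^ k)"
proof -
  have "peval \<kappa> c x = (\<Sum>k\<le>\<kappa> i. \<Sum>\<alpha>\<in>{\<alpha>\<in>exps \<kappa>. \<alpha> i = k}. c \<alpha> * mon x \<alpha>)"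
    unfolding peval_def by (rule sum.group[symmetric]) (auto simp: exps_iff)
  also have "\<dots> = (\<Sum>k\<le>\<kappa> i. peval \<kappa> (slice i k c) x * x i ^ k)"
  proof (rule sum.cong)
    fix k assume k: "k \<in> {..\<kappa> i}"
    have "(\<Sum>\<alpha>\<in>{\<alpha>\<in>exps \<kappa>. \<alpha> i = k}. c \<alpha> * mon x \<alpha>) =
          (\<Sum>\<alpha>\<in>{\<alpha>\<in>exps \<kappa>. \<alpha> i = 0}. c (\<alpha>(i := k)) * mon x (\<alpha>(i := k)))"
      using k by (intro sum.reindex_bij_witness[of _ "\<lambda>\<alpha>. \<alpha>(i := k)" "\<lambda>\<alpha>. \<alpha>(i := 0)"])
         (auto simp: exps_iff)
    also have "\<dots> = (\<Sum>\<alpha>\<in>{\<alpha>\<in>exps \<kappa>. \<alpha> i = 0}. slice i k c \<alpha> * mon x \<alpha> * x i ^ k)"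
    proof (intro sum.cong refl)
      fix \<alpha> assume "\<alpha> \<in> {\<alpha>\<in>exps \<kappa>. \<alpha> i = 0}"
      then have "\<alpha>(i := 0) = \<alpha>" "\<alpha> i = 0" by auto
      then show "c (\<alpha>(i := k)) * mon x (\<alpha>(i := k)) = slice i k c \<alpha> * mon x \<alpha> * x i ^ k"
        using mon_upd[of x \<alpha> i k] by (simp add: slice_def)
    qed
    also have "\<dots> = (\<Sum>\<alpha>\<in>exps \<kappa>. slice i k c \<alpha> * mon x \<alpha> * x i ^ k)"
      by (rule sum.mono_neutral_left) (auto simp: slice_def)
    finally show "(\<Sum>\<alpha>\<in>{\<alpha>\<in>exps \<kappa>. \<alpha> i = k}. c \<alpha> * mon x \<alpha>) = peval \<kappa> (slice i k c) x * x i ^ k"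
      by (simp add: peval_def sum_distrib_right)
  qed simp
  finally show ?thesis .
qed

lemma peval_slice_upd: "peval \<kappa> (slice i k c) (x(i := t)) = peval \<kappa> (slice i k c) x"
  unfolding peval_def by (intro sum.cong refl) (auto simp: slice_def mon_cong_var)

text \<open>The univariate polynomial that arises when all variables other than \<open>x\<^sub>i\<close> are held at the values
given by \<open>x\<close>.\<close>

definition line_poly :: "('n::finite \<Rightarrow> nat) \<Rightarrow> 'n \<Rightarrow> (('n \<Rightarrow> nat) \<Rightarrow> complex) \<Rightarrow> ('n \<Rightarrow> complex) \<Rightarrow> complex poly"
  where "line_poly \<kappa> i c x = (\<Sum>k\<le>\<kappa> i. monom (peval \<kappa> (slice i k c) x) k)"

lemma coeff_line_poly:
  "coeff (line_poly \<kappa> i c x) k = (if k \<le> \<kappa> i then peval \<kappa> (slice i k c) x else 0)"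
  by (simp add: line_poly_def coeff_sum)

lemma degree_line_poly: "degree (line_poly \<kappa> i c x) \<le> \<kappa> i"
  by (rule degree_le) (simp add: coeff_line_poly)

lemma poly_line_poly: "poly (line_poly \<kappa> i c x) t = peval \<kappa> c (x(i := t))"
  unfolding peval_slice[of \<kappa> c _ i] peval_slice_upd
  by (simp add: line_poly_def poly_sum poly_monom)

lemma infinite_upper: "infinite upper"
proof -
  have "inj_on (\<lambda>n::nat. Complex 0 (Suc n)) UNIV" by (auto simp: inj_on_def)
  then have "infinite (range (\<lambda>n::nat. Complex 0 (Suc n)))" by (simp add: finite_image_iff)
  moreover have "range (\<lambda>n::nat. Complex 0 (Suc n)) \<subseteq> upper" by auto
  ultimately show ?thesis using finite_subset by blast
qed

text \<open>Induction on the set \<open>I\<close> of variables on which the coefficients may depend: a univariate polynomial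
that vanishes on the upper half-plane has vanishing coefficients, and these are slices that no
longer involve the variable.\<close>

lemma peval_eq_0_imp_coeffs_0:
  fixes \<kappa> :: "'n::finite \<Rightarrow> nat"
  assumes "\<And>x. (\<forall>i. Im (x i) > 0) \<Longrightarrow> peval \<kappa> c x = 0" and "\<alpha> \<in> exps \<kappa>"
  shows "c \<alpha> = 0"
proof -
  have gen: "\<forall>c. (\<forall>x. (\<forall>i. Im (x i) > 0) \<longrightarrow> peval \<kappa> c x = 0) \<longrightarrow>
        (\<forall>\<alpha>. (\<exists>i\<in>-I. \<alpha> i \<noteq> 0) \<longrightarrow> c \<alpha> = 0) \<longrightarrow> (\<forall>\<alpha>\<in>exps \<kappa>. c \<alpha> = 0)"
    if "finite I" for I :: "'n set"
    using that
  proof induction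
    case empty
    have "c \<alpha> = 0" if c: "\<forall>x. (\<forall>i. Im (x i) > 0) \<longrightarrow> peval \<kappa> c x = 0"
      and supp: "\<forall>\<alpha>. (\<exists>i\<in>-{}. \<alpha> i \<noteq> 0) \<longrightarrow> c \<alpha> = 0" for c \<alpha>
    proof (cases "\<alpha> = (\<lambda>_. 0)")
      case True
      have "0 = peval \<kappa> c (\<lambda>_. \<i>)" using c by simp
      also have "\<dots> = (\<Sum>\<alpha>\<in>{\<lambda>_. 0}. c \<alpha> * mon (\<lambda>_. \<i>) \<alpha>)"
        unfolding peval_def by (rule sum.mono_neutral_right) (use supp in \<open>auto simp: exps_iff fun_eq_iff\<close>)
      finally show ?thesis using True by (simp add: mon_def)
    next
      case False
      then obtain i where "\<alpha> i \<noteq> 0" by (auto simp: fun_eq_iff)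
      then show ?thesis using supp by blast
    qed
    then show ?case by blast
  next
    case (insert j I)
    show ?case
    proof (intro allI impI ballI)
      fix c \<alpha>
      assume c: "\<forall>x. (\<forall>i. Im (x i) > 0) \<longrightarrow> peval \<kappa> c x = 0"
        and supp: "\<forall>\<alpha>. (\<exists>i\<in>-insert j I. \<alpha> i \<noteq> 0) \<longrightarrow> c \<alpha> = 0" and \<alpha>: "\<alpha> \<in> exps \<kappa>"
      have "peval \<kappa> (slice j k c) x = 0" if x: "\<forall>i. Im (x i) > 0" and k: "k \<le> \<kappa> j" for k x
      proof -
        have "poly (line_poly \<kappa> j c x) t = 0" if "t \<in> upper" for t
          unfolding poly_line_poly using c x that by auto
        then have "upper \<subseteq> {t. poly (line_poly \<kappa> j c x) t = 0}" by blast
        then have "line_poly \<kappa> j c x = 0"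
          using infinite_upper poly_roots_finite finite_subset by blast
        then show ?thesis using coeff_line_poly[of \<kappa> j c x k] k by simp
      qed
      moreover have "\<forall>\<beta>. (\<exists>i\<in>-I. \<beta> i \<noteq> 0) \<longrightarrow> slice j k c \<beta> = 0" for k
      proof (intro allI impI)
        fix \<beta> :: "'n \<Rightarrow> nat" assume "\<exists>i\<in>-I. \<beta> i \<noteq> 0"
        then obtain i where i: "i \<notin> I" "\<beta> i \<noteq> 0" by auto
        show "slice j k c \<beta> = 0"
        proof (cases "\<beta> j = 0")
          case True
          with i have "i \<in> - insert j I" "(\<beta>(j := k)) i \<noteq> 0" by auto
          then have "c (\<beta>(j := k)) = 0" using supp by blast
          then show ?thesis by (simp add: slice_def)
        qed (simp add: slice_def)
      qed
      ultimately have "\<forall>\<beta>\<in>exps \<kappa>. slice j (\<alpha> j) c \<beta> = 0"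
        using insert.IH \<alpha> by (auto simp: exps_iff)
      moreover have "\<alpha>(j := 0) \<in> exps \<kappa>" using \<alpha> by (auto simp: exps_iff)
      ultimately have "slice j (\<alpha> j) c (\<alpha>(j := 0)) = 0" by blast
      then show "c \<alpha> = 0" by (simp add: slice_def)
    qed
  qed
  show ?thesis using gen[OF finite_class.finite_UNIV] assms by auto
qed

lemma mon_holomorphic [holomorphic_intros]:
  assumes "\<And>i. (\<lambda>t. v t i) holomorphic_on S"
  shows "(\<lambda>t. mon (v t) \<alpha>) holomorphic_on S"
  unfolding mon_def by (intro holomorphic_intros assms)

lemma peval_holomorphic [holomorphic_intros]:
  assumes "\<And>i. (\<lambda>t. v t i) holomorphic_on S"
  shows "(\<lambda>t. peval \<kappa> c (v t)) holomorphic_on S"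
  unfolding peval_def by (intro holomorphic_intros assms)

text \<open>The complex line through \<open>x\<close> and \<open>y\<close>. Restricting to the parameters whose points have all
coordinates in the upper half-plane reduces statements in several variables to holomorphic
functions on a convex open subset of the plane.\<close>

definition cline :: "('n \<Rightarrow> complex) \<Rightarrow> ('n \<Rightarrow> complex) \<Rightarrow> complex \<Rightarrow> 'n \<Rightarrow> complex"
  where "cline x y t i = x i + t * (y i - x i)"

lemma cline_holomorphic [holomorphic_intros]: "(\<lambda>t. cline x y t i) holomorphic_on S"
  unfolding cline_def by (intro holomorphic_intros)

lemma cline_ends [simp]: "cline x y 0 = x" "cline x y 1 = y"
  by (auto simp: cline_def)

definition cline_dom :: "('n \<Rightarrow> complex) \<Rightarrow> ('n \<Rightarrow> complex) \<Rightarrow> complex set"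
  where "cline_dom x y = {t. \<forall>i. Im (cline x y t i) > 0}"

lemma cline_dom:
  fixes x y :: "'n::finite \<Rightarrow> complex"
  shows "open (cline_dom x y)" "connected (cline_dom x y)"
proof -
  have eq: "cline_dom x y = (\<Inter>i. (\<lambda>t. cline x y t i) -` upper)"
    by (auto simp: cline_dom_def)
  have op: "open upper" by (rule open_halfspace_Im_gt)
  show "open (cline_dom x y)"
    unfolding eq cline_def by (intro open_INT ballI open_vimage op continuous_intros) auto
  have "convex (cline_dom x y)"
  proof (rule convexI)
    fix s t u v assume a: "s \<in> cline_dom x y" "t \<in> cline_dom x y" and uv: "0 \<le> u" "0 \<le> v" "u + v = (1::real)"
    have "Im (cline x y (u *\<^sub>R s + v *\<^sub>R t) i) > 0" for i
    proof -
      have "of_real u + of_real v = (1::complex)" using uv by (metis of_real_1 of_real_add)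
      then have "x i = of_real u * x i + of_real v * x i" by (metis distrib_right mult_1)
      then have "cline x y (u *\<^sub>R s + v *\<^sub>R t) i = u *\<^sub>R cline x y s i + v *\<^sub>R cline x y t i"
        by (simp add: cline_def scaleR_conv_of_real algebra_simps)
      moreover have "Im (cline x y s i) > 0" "Im (cline x y t i) > 0"
        using a by (auto simp: cline_dom_def)
      ultimately show ?thesis using uv
        by (cases "u = 0") (auto intro: add_pos_nonneg)
    qed
    then show "u *\<^sub>R s + v *\<^sub>R t \<in> cline_dom x y" by (simp add: cline_dom_def)
  qed
  then show "connected (cline_dom x y)" by (rule convex_connected)
qed

section \<open>Limits of zero-free polynomials\<close>

lemma uniform_limit_sum:
  fixes f :: "'i \<Rightarrow> 'a \<Rightarrow> 'b \<Rightarrow> 'c::real_normed_vector"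
  assumes "\<And>i. i \<in> I \<Longrightarrow> uniform_limit K (f i) (g i) F"
  shows "uniform_limit K (\<lambda>n t. \<Sum>i\<in>I. f i n t) (\<lambda>t. \<Sum>i\<in>I. g i t) F"
  using assms by (induction I rule: infinite_finite_induct) (auto intro!: uniform_limit_add uniform_limit_const)

text \<open>A zero of the limit and a point where the limit does not vanish are joined by a complex line, on
which Hurwitz's theorem in one variable gives a contradiction.\<close>

lemma hurwitz_peval:
  fixes \<kappa> :: "'n::finite \<Rightarrow> nat"
  assumes lim: "\<And>\<alpha>. \<alpha> \<in> exps \<kappa> \<Longrightarrow> (\<lambda>n. c n \<alpha>) \<longlonglongrightarrow> d \<alpha>"
    and zf: "\<And>n. zero_free upper \<kappa> (c n)"
    and nz: "\<exists>\<alpha>\<in>exps \<kappa>. d \<alpha> \<noteq> 0"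
  shows "zero_free upper \<kappa> d"
  unfolding zero_free_def
proof (intro allI impI notI)
  fix x assume x: "\<forall>i. x i \<in> upper" and x0: "peval \<kappa> d x = 0"
  obtain y where y: "\<forall>i. Im (y i) > 0" and y0: "peval \<kappa> d y \<noteq> 0"
    using peval_eq_0_imp_coeffs_0[of \<kappa> d] nz by blast
  \<comment> \<open>Parameter 1 is the point where the limit does not vanish, parameter 0 the supposed zero.\<close>
  let ?S = "cline_dom x y" and ?v = "cline x y"
  have "peval \<kappa> d (?v 0) \<noteq> 0"
  proof (rule Hurwitz_no_zeros[of ?S "\<lambda>n t. peval \<kappa> (c n) (?v t)" "\<lambda>t. peval \<kappa> d (?v t)"])
    show "open ?S" "connected ?S" by (rule cline_dom)+
    show "(\<lambda>t. peval \<kappa> (c n) (?v t)) holomorphic_on ?S" for n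
      by (intro holomorphic_intros)
    show "(\<lambda>t. peval \<kappa> d (?v t)) holomorphic_on ?S"
      by (intro holomorphic_intros)
    show "0 \<in> ?S" using x by (simp add: cline_dom_def)
    have "1 \<in> ?S" using y by (simp add: cline_dom_def)
    with \<open>0 \<in> ?S\<close> show "\<not> (\<lambda>t. peval \<kappa> d (?v t)) constant_on ?S"
      using x0 y0 unfolding constant_on_def by (metis cline_ends)
    show "peval \<kappa> (c n) (?v t) \<noteq> 0" if "t \<in> ?S" for n t
      using zf[of n] that by (simp add: zero_free_def cline_dom_def)
    show "uniform_limit K (\<lambda>n t. peval \<kappa> (c n) (?v t)) (\<lambda>t. peval \<kappa> d (?v t)) sequentially"
      if K: "compact K" "K \<subseteq> ?S" for K
      unfolding peval_def
    proof (rule uniform_limit_sum)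
      fix \<alpha> assume \<alpha>: "\<alpha> \<in> exps \<kappa>"
      have "continuous_on K (\<lambda>t. mon (?v t) \<alpha>)"
        by (intro holomorphic_on_imp_continuous_on holomorphic_intros)
      then have "bounded ((\<lambda>t. mon (?v t) \<alpha>) ` K)"
        using K compact_continuous_image compact_imp_bounded by blast
      moreover have "uniform_limit K (\<lambda>n t. c n \<alpha>) (\<lambda>t. d \<alpha>) sequentially"
        using lim[OF \<alpha>] by (auto simp: uniform_limit_iff tendsto_iff)
      moreover have "bounded ((\<lambda>t. d \<alpha>) ` K)"
        by (rule finite_imp_bounded) (simp add: finite_subset[of _ "{d \<alpha>}"] image_subset_iff)
      ultimately show "uniform_limit K (\<lambda>n t. c n \<alpha> * mon (?v t) \<alpha>) (\<lambda>t. d \<alpha> * mon (?v t) \<alpha>) sequentially"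
        by (intro uniform_lim_mult uniform_limit_const)
    qed
  qed
  then show False using x0 by simp
qed

section \<open>Polynomials without zeros off the real axis are products\<close>

text \<open>Such a polynomial is a complex constant times a polynomial with real coefficients.\<close>

lemma coeff_ratio_real_if_real_roots:
  fixes p :: "complex poly"
  assumes roots: "\<And>z. poly p z = 0 \<Longrightarrow> z \<in> \<real>"
  shows "coeff p k * cnj (coeff p m) \<in> \<real>"
proof (cases "p = 0")
  case False
  then obtain c A where A: "p = smult c (\<Prod>r\<in>#A. [:- r, 1:])"
    using alg_closed_imp_factorization by blast
  have "r \<in> \<real>" if "r \<in># A" for r
  proof (rule roots)
    have "poly (\<Prod>r\<in>#A. [:- r, 1:]) r = 0"
      using that by (auto dest!: multi_member_split simp del: mult_pCons_left)
    then show "poly p r = 0" by (subst A) simp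
  qed
  then have real: "coeff (\<Prod>r\<in>#A. [:- r, 1:]) j \<in> \<real>" for j
  proof (induction A arbitrary: j)
    case (add r A)
    then have "coeff (\<Prod>r\<in>#A. [:- r, 1:]) j \<in> \<real>" "r \<in> \<real>" for j by auto
    then show ?case
      by (auto simp: coeff_pCons split: nat.splits)
  qed (auto simp: coeff_1)
  have "coeff p k * cnj (coeff p m) =
     (c * cnj c) * (coeff (\<Prod>r\<in>#A. [:- r, 1:]) k * cnj (coeff (\<Prod>r\<in>#A. [:- r, 1:]) m))"
    by (simp add: A)
  also have "\<dots> \<in> \<real>"
  proof (rule Reals_mult)
    show "c * cnj c \<in> \<real>" by (simp add: complex_is_Real_iff)
    show "coeff (\<Prod>r\<in>#A. [:- r, 1:]) k * cnj (coeff (\<Prod>r\<in>#A. [:- r, 1:]) m) \<in> \<real>"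
      using real[of k] real[of m] by (simp add: Reals_cnj_iff)
  qed
  finally show ?thesis .
qed simp

text \<open>The open mapping theorem: no nonempty open set is contained in the real line.\<close>

lemma holomorphic_real_imp_constant:
  assumes "f holomorphic_on S" "open S" "connected S" "\<And>z. z \<in> S \<Longrightarrow> f z \<in> \<real>"
  shows "f constant_on S"
proof (rule ccontr)
  assume nc: "\<not> f constant_on S"
  then have "S \<noteq> {}" by (auto simp: constant_on_def)
  then obtain z where z: "z \<in> S" by blast
  have "open (f ` S)" using open_mapping_thm[OF assms(1,2,3,2) order_refl nc] .
  then obtain e where e: "e > 0" "ball (f z) e \<subseteq> f ` S"
    using z open_contains_ball by blast
  have "f z + \<i> * of_real (e / 2) \<in> ball (f z) e" using e by (simp add: dist_norm norm_mult)
  then have "f z + \<i> * of_real (e / 2) \<in> \<real>" using e assms(4) by auto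
  moreover have "f z \<in> \<real>" using assms(4) z by blast
  ultimately show False using e by (simp add: complex_is_Real_iff)
qed

text \<open>The hypothesis says that \<open>f/g\<close> is real, in a form that makes sense at zeros of \<open>g\<close>. Near a point
where \<open>g\<close> does not vanish the quotient is therefore constant, and \<open>f = c g\<close> propagates to all
of \<open>S\<close> by analytic continuation.\<close>

lemma holomorphic_real_ratio_exchange:
  assumes f: "f holomorphic_on S" and g: "g holomorphic_on S" and S: "open S" "connected S"
    and real: "\<And>z. z \<in> S \<Longrightarrow> f z * cnj (g z) \<in> \<real>" and a: "a \<in> S" and b: "b \<in> S"
  shows "f a * g b = g a * f b"
proof (cases "\<exists>w\<in>S. g w \<noteq> 0")
  case True
  then obtain w where w: "w \<in> S" "g w \<noteq> 0" by blast
  have "open (S \<inter> g -` (- {0}))"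
    using continuous_open_preimage[OF holomorphic_on_imp_continuous_on[OF g] S(1)] by auto
  moreover have "w \<in> S \<inter> g -` (- {0})" using w by simp
  ultimately obtain e where e0: "e > 0" "ball w e \<subseteq> S \<inter> g -` (- {0})"
    using open_contains_ball by metis
  then have e: "e > 0" "ball w e \<subseteq> S" "\<And>z. z \<in> ball w e \<Longrightarrow> g z \<noteq> 0" by auto
  have "(\<lambda>z. f z / g z) constant_on ball w e"
  proof (rule holomorphic_real_imp_constant)
    show "(\<lambda>z. f z / g z) holomorphic_on ball w e"
      using e by (intro holomorphic_intros holomorphic_on_subset[OF f] holomorphic_on_subset[OF g]) auto
    show "f z / g z \<in> \<real>" if "z \<in> ball w e" for z
    proof -
      have "f z / g z = (f z * cnj (g z)) / (g z * cnj (g z))" using e(3)[OF that] by simp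
      also have "\<dots> \<in> \<real>"
        using that e(2) real by (intro Reals_divide) (auto simp: complex_is_Real_iff)
      finally show ?thesis .
    qed
  qed auto
  then obtain c where c: "\<And>z. z \<in> ball w e \<Longrightarrow> f z = c * g z"
    using e(3) by (force simp: constant_on_def field_simps)
  have "f z = c * g z" if "z \<in> S" for z
  proof (rule analytic_continuation_open[of "ball w e" S f "\<lambda>z. c * g z"])
    show "(\<lambda>z. c * g z) holomorphic_on S" by (intro holomorphic_intros g)
    show "open (ball w e)" "ball w e \<noteq> {}" using e(1) by auto
  qed (use e(2) c S f that in \<open>simp_all\<close>)
  then show ?thesis using a b by simp
qed (use a b in auto)

lemma peval_lincomb:
  "peval \<kappa> (\<lambda>\<alpha>. c \<alpha> * u - d \<alpha> * v) x = peval \<kappa> c x * u - peval \<kappa> d x * v"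
  unfolding peval_def sum_distrib_right sum_subtractf[symmetric] by (intro sum.cong refl) (simp add: algebra_simps)

text \<open>For fixed values of the other variables in the upper half-plane the polynomial in \<open>x\<^sub>i\<close> has only
real zeros, so the ratio of two of its coefficients is real. Along a complex line these
coefficients are holomorphic, so their ratio is the same at \<open>x\<close> and at \<open>y\<close>.\<close>

lemma slices_exchange:
  fixes \<kappa> :: "'n::finite \<Rightarrow> nat"
  assumes zf: "zero_free (- \<real>) \<kappa> c" and x: "\<And>i. Im (x i) > 0" and y: "\<And>i. Im (y i) > 0"
    and km: "k \<le> \<kappa> i" "m \<le> \<kappa> i"
  shows "peval \<kappa> (slice i k c) x * peval \<kappa> (slice i m c) y =
         peval \<kappa> (slice i m c) x * peval \<kappa> (slice i k c) y"
proof -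
  let ?f = "\<lambda>k t. peval \<kappa> (slice i k c) (cline x y t)"
  have "?f k 0 * ?f m 1 = ?f m 0 * ?f k 1"
  proof (rule holomorphic_real_ratio_exchange[of "?f k" "cline_dom x y" "?f m" 0 1])
    fix t assume t: "t \<in> cline_dom x y"
    have "coeff (line_poly \<kappa> i c (cline x y t)) k * cnj (coeff (line_poly \<kappa> i c (cline x y t)) m) \<in> \<real>"
    proof (rule coeff_ratio_real_if_real_roots)
      fix s assume s: "poly (line_poly \<kappa> i c (cline x y t)) s = 0"
      show "s \<in> \<real>"
      proof (rule ccontr)
        assume "s \<notin> \<real>"
        then have "((cline x y t)(i := s)) j \<in> - \<real>" for j
          using t by (auto simp: cline_dom_def complex_is_Real_iff dest: spec[of _ j])
        then show False using zf s by (auto simp: zero_free_def poly_line_poly)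
      qed
    qed
    then show "?f k t * cnj (?f m t) \<in> \<real>" using km by (simp add: coeff_line_poly)
  next
    show "0 \<in> cline_dom x y" "1 \<in> cline_dom x y" using x y by (auto simp: cline_dom_def)
  qed (intro holomorphic_intros cline_dom)+
  then show ?thesis by simp
qed

text \<open>Comparing coefficients in the previous identity, first as a polynomial in \<open>x\<close>, then in \<open>y\<close>.\<close>

lemma coeffs_exchange:
  fixes \<kappa> :: "'n::finite \<Rightarrow> nat"
  assumes zf: "zero_free (- \<real>) \<kappa> c" and \<alpha>: "\<alpha> \<in> exps \<kappa>" and \<beta>: "\<beta> \<in> exps \<kappa>"
  shows "c \<alpha> * c \<beta> = c (\<alpha>(i := \<beta> i)) * c (\<beta>(i := \<alpha> i))"
proof -
  let ?k = "\<alpha> i" and ?m = "\<beta> i"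
  have km: "?k \<le> \<kappa> i" "?m \<le> \<kappa> i" using \<alpha> \<beta> by (auto simp: exps_iff)
  have \<alpha>0: "\<alpha>(i := 0) \<in> exps \<kappa>" and \<beta>0: "\<beta>(i := 0) \<in> exps \<kappa>" using \<alpha> \<beta> by (auto simp: exps_iff)
  have 1: "c \<alpha> * peval \<kappa> (slice i ?m c) y = c (\<alpha>(i := ?m)) * peval \<kappa> (slice i ?k c) y"
    if y: "\<forall>i. Im (y i) > 0" for y
  proof -
    let ?d = "\<lambda>\<gamma>. slice i ?k c \<gamma> * peval \<kappa> (slice i ?m c) y - slice i ?m c \<gamma> * peval \<kappa> (slice i ?k c) y"
    have "?d (\<alpha>(i := 0)) = 0"
    proof (rule peval_eq_0_imp_coeffs_0[OF _ \<alpha>0])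
      show "peval \<kappa> ?d x = 0" if "\<forall>i. Im (x i) > 0" for x
        unfolding peval_lincomb using slices_exchange[OF zf _ _ km] that y by simp
    qed
    then show ?thesis by (simp add: slice_def)
  qed
  let ?d = "\<lambda>\<gamma>. slice i ?m c \<gamma> * c \<alpha> - slice i ?k c \<gamma> * c (\<alpha>(i := ?m))"
  have "?d (\<beta>(i := 0)) = 0"
  proof (rule peval_eq_0_imp_coeffs_0[OF _ \<beta>0])
    show "peval \<kappa> ?d y = 0" if "\<forall>i. Im (y i) > 0" for y
      unfolding peval_lincomb using 1[OF that] by (simp add: mult.commute)
  qed
  then show ?thesis by (simp add: slice_def mult.commute)
qed

text \<open>Starting from \<open>\<alpha>0\<close>, the coordinates are changed to those of \<open>\<alpha>\<close> one at a time; each change costs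
one ratio by the exchange law.\<close>

lemma coeffs_factor:
  fixes \<kappa> :: "'n::finite \<Rightarrow> nat"
  assumes zf: "zero_free (- \<real>) \<kappa> c" and \<alpha>0: "\<alpha>0 \<in> exps \<kappa>" "c \<alpha>0 \<noteq> 0" and \<alpha>: "\<alpha> \<in> exps \<kappa>"
  shows "c \<alpha> = c \<alpha>0 * (\<Prod>i\<in>UNIV. c (\<alpha>0(i := \<alpha> i)) / c \<alpha>0)"
proof -
  define mix where "mix I = (\<lambda>i. if i \<in> I then \<alpha> i else \<alpha>0 i)" for I
  have "c (mix I) = c \<alpha>0 * (\<Prod>i\<in>I. c (\<alpha>0(i := \<alpha> i)) / c \<alpha>0)" if "finite I" for I
    using that
  proof induction
    case empty
    then show ?case by (simp add: mix_def)
  next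
    case (insert j I)
    have "mix (insert j I) \<in> exps \<kappa>" using \<alpha> \<alpha>0 by (auto simp: exps_iff mix_def)
    from coeffs_exchange[OF zf this \<alpha>0(1), of j]
    have "c (mix (insert j I)) * c \<alpha>0 = c ((mix (insert j I))(j := \<alpha>0 j)) * c (\<alpha>0(j := \<alpha> j))"
      by (simp add: mix_def)
    moreover have "(mix (insert j I))(j := \<alpha>0 j) = mix I" using insert by (auto simp: mix_def)
    ultimately have "c (mix (insert j I)) = c (mix I) * (c (\<alpha>0(j := \<alpha> j)) / c \<alpha>0)"
      using \<alpha>0 by (simp add: field_simps)
    also have "\<dots> = c \<alpha>0 * (\<Prod>i\<in>insert j I. c (\<alpha>0(i := \<alpha> i)) / c \<alpha>0)"
      unfolding insert.IH prod.insert[OF insert.hyps] by (rule mult.assoc[THEN trans]) (simp only: mult.commute)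
    finally show ?case .
  qed
  from this[of UNIV] show ?thesis by (simp add: mix_def)
qed

section \<open>Stability and multiplier sequences in terms of coefficients\<close>

abbreviation rpeval :: "('n::finite \<Rightarrow> nat) \<Rightarrow> (('n \<Rightarrow> nat) \<Rightarrow> real) \<Rightarrow> ('n \<Rightarrow> complex) \<Rightarrow> complex"
  where "rpeval \<kappa> a \<equiv> peval \<kappa> (\<lambda>\<alpha>. of_real (a \<alpha>))"

abbreviation rzero_free :: "complex set \<Rightarrow> ('n::finite \<Rightarrow> nat) \<Rightarrow> (('n \<Rightarrow> nat) \<Rightarrow> real) \<Rightarrow> bool"
  where "rzero_free A \<kappa> a \<equiv> zero_free A \<kappa> (\<lambda>\<alpha>. of_real (a \<alpha>))"

lemma mv_eval_map_of_real:
  assumes "finite K" "Poly_Mapping.keys f \<subseteq> K"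
  shows "mv_eval (Poly_Mapping.map complex_of_real f) x =
    (\<Sum>m\<in>K. of_real (Poly_Mapping.lookup f m) * mon x (Poly_Mapping.lookup m))"
proof -
  have lk: "Poly_Mapping.lookup (Poly_Mapping.map complex_of_real f) m = of_real (Poly_Mapping.lookup f m)" for m
    by (simp add: map.rep_eq when_def)
  then have "Poly_Mapping.keys (Poly_Mapping.map complex_of_real f) = Poly_Mapping.keys f"
    by (auto simp: in_keys_iff)
  then have "mv_eval (Poly_Mapping.map complex_of_real f) x =
      (\<Sum>m\<in>Poly_Mapping.keys f. of_real (Poly_Mapping.lookup f m) * mon x (Poly_Mapping.lookup m))"
    by (simp add: mv_eval_def lk mon_def)
  also have "\<dots> = (\<Sum>m\<in>K. of_real (Poly_Mapping.lookup f m) * mon x (Poly_Mapping.lookup m))"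
    using assms by (intro sum.mono_neutral_left) (auto simp: in_keys_iff)
  finally show ?thesis .
qed

lemma mv_eval_sum_single:
  assumes "finite A"
  shows "mv_eval (Poly_Mapping.map complex_of_real (\<Sum>\<alpha>\<in>A. Poly_Mapping.single (\<mu> \<alpha>) (c \<alpha>))) x =
    (\<Sum>\<alpha>\<in>A. of_real (c \<alpha>) * mon x (Poly_Mapping.lookup (\<mu> \<alpha>)))"
proof -
  let ?f = "\<Sum>\<alpha>\<in>A. Poly_Mapping.single (\<mu> \<alpha>) (c \<alpha>)"
  have lk: "Poly_Mapping.lookup ?f m = (\<Sum>\<alpha>\<in>A. if \<mu> \<alpha> = m then c \<alpha> else 0)" for m
    by (simp add: lookup_sum lookup_single when_def)
  have "Poly_Mapping.keys ?f \<subseteq> \<mu> ` A"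
  proof
    fix m assume m: "m \<in> Poly_Mapping.keys ?f"
    show "m \<in> \<mu> ` A"
    proof (rule ccontr)
      assume "m \<notin> \<mu> ` A"
      then have "Poly_Mapping.lookup ?f m = 0" unfolding lk by (intro sum.neutral) auto
      with m show False by (simp add: in_keys_iff)
    qed
  qed
  then have "mv_eval (Poly_Mapping.map complex_of_real ?f) x =
     (\<Sum>m\<in>\<mu> ` A. \<Sum>\<alpha>\<in>A. if \<mu> \<alpha> = m then of_real (c \<alpha>) * mon x (Poly_Mapping.lookup m) else 0)"
    using assms by (subst mv_eval_map_of_real[of "\<mu> ` A"])
      (auto simp: lk of_real_sum sum_distrib_right intro!: sum.cong)
  also have "\<dots> = (\<Sum>\<alpha>\<in>A. \<Sum>m\<in>\<mu> ` A. if \<mu> \<alpha> = m then of_real (c \<alpha>) * mon x (Poly_Mapping.lookup m) else 0)"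
    by (rule sum.swap)
  also have "\<dots> = (\<Sum>\<alpha>\<in>A. of_real (c \<alpha>) * mon x (Poly_Mapping.lookup (\<mu> \<alpha>)))"
    using assms by (intro sum.cong refl) (simp add: sum.delta')
  finally show ?thesis .
qed

definition mcoeff :: "('n::finite, 'a::zero) mvpoly \<Rightarrow> ('n \<Rightarrow> nat) \<Rightarrow> 'a"
  where "mcoeff f \<alpha> = Poly_Mapping.lookup f (Abs_poly_mapping \<alpha>)"

lemma lookup_Abs [simp]: "Poly_Mapping.lookup (Abs_poly_mapping \<alpha>) = (\<alpha> :: 'n::finite \<Rightarrow> nat)"
  by simp

lemma Abs_eq_iff: "Abs_poly_mapping \<alpha> = m \<longleftrightarrow> \<alpha> = Poly_Mapping.lookup (m :: 'n::finite \<Rightarrow>\<^sub>0 nat)"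
  by (metis lookup_Abs Poly_Mapping.lookup_inverse)

lemma mcoeff_mult_op: "mcoeff (mult_op l f) \<alpha> = l \<alpha> * mcoeff f \<alpha>"
  by (simp add: mcoeff_def mult_op_def lookup_diag_op)

lemma mult_op_polys_le: "f \<in> polys_le \<kappa> \<Longrightarrow> mult_op l f \<in> polys_le \<kappa>"
  by (auto simp: polys_le_def mult_op_def lookup_diag_op in_keys_iff)

lemma real_stable_iff_zero_free:
  fixes f :: "('n::finite, real) mvpoly"
  assumes "f \<in> polys_le \<kappa>"
  shows "real_stable f \<longleftrightarrow> rzero_free upper \<kappa> (mcoeff f)"
proof -
  have "Poly_Mapping.keys f \<subseteq> Abs_poly_mapping ` exps \<kappa>"
  proof
    fix m assume "m \<in> Poly_Mapping.keys f"
    then have "Poly_Mapping.lookup m \<in> exps \<kappa>" using assms by (auto simp: polys_le_def exps_iff)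
    then show "m \<in> Abs_poly_mapping ` exps \<kappa>" by (metis Poly_Mapping.lookup_inverse imageI)
  qed
  then have "mv_eval (Poly_Mapping.map complex_of_real f) x = rpeval \<kappa> (mcoeff f) x" for x
    by (subst mv_eval_map_of_real[of "Abs_poly_mapping ` exps \<kappa>"])
       (auto simp: peval_def mcoeff_def Abs_eq_iff inj_on_def sum.reindex)
  then show ?thesis by (simp add: real_stable_def stable_def zero_free_def)
qed

lemma ex_mcoeff:
  obtains f :: "('n::finite, real) mvpoly" where "f \<in> polys_le \<kappa>" "\<And>\<alpha>. \<alpha> \<in> exps \<kappa> \<Longrightarrow> mcoeff f \<alpha> = a \<alpha>"
proof
  let ?f = "\<Sum>\<alpha>\<in>exps \<kappa>. Poly_Mapping.single (Abs_poly_mapping \<alpha>) (a \<alpha>)"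
  have lk: "Poly_Mapping.lookup ?f m = (if Poly_Mapping.lookup m \<in> exps \<kappa> then a (Poly_Mapping.lookup m) else 0)" for m
    by (simp add: lookup_sum lookup_single when_def Abs_eq_iff)
  show "?f \<in> polys_le \<kappa>"
    by (auto simp: polys_le_def in_keys_iff lk exps_iff split: if_splits)
  show "mcoeff ?f \<alpha> = a \<alpha>" if "\<alpha> \<in> exps \<kappa>" for \<alpha>
    using that by (simp add: mcoeff_def lk)
qed

lemma eq_0_iff_mcoeff:
  assumes "f \<in> polys_le \<kappa>"
  shows "f = 0 \<longleftrightarrow> (\<forall>\<alpha>\<in>exps \<kappa>. mcoeff f \<alpha> = 0)"
proof
  assume *: "\<forall>\<alpha>\<in>exps \<kappa>. mcoeff f \<alpha> = 0"
  show "f = 0"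
  proof (rule poly_mapping_eqI, rule ccontr)
    fix m assume nz: "Poly_Mapping.lookup f m \<noteq> Poly_Mapping.lookup 0 m"
    then have "Poly_Mapping.lookup m \<in> exps \<kappa>" using assms by (auto simp: polys_le_def exps_iff in_keys_iff)
    with * have "mcoeff f (Poly_Mapping.lookup m) = 0" by blast
    with nz show False by (simp add: mcoeff_def)
  qed
qed (simp add: mcoeff_def)

lemma multiplier_seq_iff:
  "multiplier_seq \<kappa> l \<longleftrightarrow>
    (\<forall>a. rzero_free upper \<kappa> a \<longrightarrow>
       rzero_free upper \<kappa> (\<lambda>\<alpha>. l \<alpha> * a \<alpha>) \<or> (\<forall>\<alpha>\<in>exps \<kappa>. l \<alpha> * a \<alpha> = 0))"
  (is "_ \<longleftrightarrow> (\<forall>a. ?P a)")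
proof -
  have f: "?P (mcoeff f) \<longleftrightarrow> (real_stable f \<longrightarrow> real_stable (mult_op l f) \<or> mult_op l f = 0)"
    if "f \<in> polys_le \<kappa>" for f
  proof -
    have "mcoeff (mult_op l f) = (\<lambda>\<alpha>. l \<alpha> * mcoeff f \<alpha>)" by (rule ext) (rule mcoeff_mult_op)
    then show ?thesis
      using real_stable_iff_zero_free[OF that] real_stable_iff_zero_free[OF mult_op_polys_le[OF that]]
        eq_0_iff_mcoeff[OF mult_op_polys_le[OF that], of l] by simp
  qed
  show ?thesis
  proof
    assume ms: "multiplier_seq \<kappa> l"
    show "\<forall>a. ?P a"
    proof
      fix a :: "('a \<Rightarrow> nat) \<Rightarrow> real"
      obtain p :: "('a, real) mvpoly" where p: "p \<in> polys_le \<kappa>" "\<And>\<alpha>. \<alpha> \<in> exps \<kappa> \<Longrightarrow> mcoeff p \<alpha> = a \<alpha>"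
        using ex_mcoeff[of \<kappa> a] by blast
      have "?P (mcoeff p)" using f[OF p(1)] ms p(1) by (simp add: multiplier_seq_def)
      moreover have "rzero_free upper \<kappa> (mcoeff p) \<longleftrightarrow> rzero_free upper \<kappa> a"
        "rzero_free upper \<kappa> (\<lambda>\<alpha>. l \<alpha> * mcoeff p \<alpha>) \<longleftrightarrow> rzero_free upper \<kappa> (\<lambda>\<alpha>. l \<alpha> * a \<alpha>)"
        by (rule zero_free_cong; simp add: p(2))+
      ultimately show "?P a" using p(2) by simp
    qed
  next
    assume "\<forall>a. ?P a"
    then show "multiplier_seq \<kappa> l" using f by (simp add: multiplier_seq_def)
  qed
qed

text \<open>Univariate polynomials are given by their coefficient functions here, since a multiplier sequence
acts on these by pointwise multiplication.\<close>

definition ueval :: "nat \<Rightarrow> (nat \<Rightarrow> real) \<Rightarrow> complex \<Rightarrow> complex"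
  where "ueval k a w = (\<Sum>j\<le>k. of_real (a j) * w ^ j)"

lemma ueval_coeff:
  assumes "degree p \<le> k"
  shows "ueval k (coeff p) w = poly (map_poly of_real p) w"
proof -
  have d: "degree (map_poly complex_of_real p) = degree p" by (simp add: degree_map_poly)
  have "poly (map_poly complex_of_real p) w = (\<Sum>j\<le>degree p. of_real (coeff p j) * w ^ j)"
    by (simp add: poly_altdef d coeff_map_poly)
  also have "\<dots> = ueval k (coeff p) w"
    unfolding ueval_def using assms by (intro sum.mono_neutral_left) (auto simp: coeff_eq_0)
  finally show ?thesis ..
qed

lemma rpeval_prod:
  "rpeval \<kappa> (\<lambda>\<alpha>. \<Prod>i\<in>UNIV. a i (\<alpha> i)) x = (\<Prod>i\<in>UNIV. ueval (\<kappa> i) (a i) (x i))"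
  using peval_prod[of \<kappa> "\<lambda>i k. of_real (a i k)" x] by (simp add: ueval_def)

lemma multiplier_seq1_iff:
  "multiplier_seq1 k L \<longleftrightarrow>
    (\<forall>a. (\<forall>w. Im w > 0 \<longrightarrow> ueval k a w \<noteq> 0) \<longrightarrow>
       (\<forall>w. Im w > 0 \<longrightarrow> ueval k (\<lambda>j. L j * a j) w \<noteq> 0) \<or> (\<forall>j\<le>k. L j * a j = 0))"
proof -
  have ev: "rpeval (\<lambda>_::unit. k) b x = ueval k (\<lambda>j. b (\<lambda>_. j)) (x ())" for b :: "(unit \<Rightarrow> nat) \<Rightarrow> real" and x
  proof -
    have "b \<alpha> = (\<Prod>i\<in>UNIV. b (\<lambda>_. \<alpha> i))" for \<alpha>
      by (simp add: UNIV_unit)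
    then have "rpeval (\<lambda>_::unit. k) b x = rpeval (\<lambda>_::unit. k) (\<lambda>\<alpha>. \<Prod>i\<in>UNIV. b (\<lambda>_. \<alpha> i)) x"
      by simp
    also have "\<dots> = ueval k (\<lambda>j. b (\<lambda>_. j)) (x ())"
      by (subst rpeval_prod[where a="\<lambda>i k. b (\<lambda>_. k)"]) (simp add: UNIV_unit)
    finally show ?thesis .
  qed
  have zf: "rzero_free upper (\<lambda>_::unit. k) b \<longleftrightarrow> (\<forall>w. Im w > 0 \<longrightarrow> ueval k (\<lambda>j. b (\<lambda>_. j)) w \<noteq> 0)"
    for b :: "(unit \<Rightarrow> nat) \<Rightarrow> real"
  proof
    assume *: "rzero_free upper (\<lambda>_::unit. k) b"
    show "\<forall>w. Im w > 0 \<longrightarrow> ueval k (\<lambda>j. b (\<lambda>_. j)) w \<noteq> 0"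
    proof (intro allI impI)
      fix w assume "Im w > 0"
      then show "ueval k (\<lambda>j. b (\<lambda>_. j)) w \<noteq> 0"
        using *[unfolded zero_free_def, rule_format, of "\<lambda>_. w"] unfolding ev by simp
    qed
  qed (simp add: zero_free_def ev)
  have ex: "(\<forall>\<alpha>\<in>exps (\<lambda>_::unit. k). P \<alpha>) \<longleftrightarrow> (\<forall>j\<le>k. P (\<lambda>_. j))" for P
  proof safe
    fix \<alpha> assume "\<forall>j\<le>k. P (\<lambda>_. j)" "\<alpha> \<in> exps (\<lambda>_::unit. k)"
    moreover have "\<alpha> = (\<lambda>_. \<alpha> ())" by (rule ext) simp
    ultimately show "P \<alpha>" by (metis exps_iff)
  qed (auto simp: exps_iff)
  have "multiplier_seq1 k L \<longleftrightarrow> (\<forall>b :: (unit \<Rightarrow> nat) \<Rightarrow> real.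
     (\<forall>w. Im w > 0 \<longrightarrow> ueval k (\<lambda>j. b (\<lambda>_. j)) w \<noteq> 0) \<longrightarrow>
       (\<forall>w. Im w > 0 \<longrightarrow> ueval k (\<lambda>j. L j * b (\<lambda>_. j)) w \<noteq> 0) \<or> (\<forall>j\<le>k. L j * b (\<lambda>_. j) = 0))"
    unfolding multiplier_seq1_def multiplier_seq_iff zf ex ..
  also have "\<dots> \<longleftrightarrow> (\<forall>a. (\<forall>w. Im w > 0 \<longrightarrow> ueval k a w \<noteq> 0) \<longrightarrow>
       (\<forall>w. Im w > 0 \<longrightarrow> ueval k (\<lambda>j. L j * a j) w \<noteq> 0) \<or> (\<forall>j\<le>k. L j * a j = 0))"
  proof (intro iffI allI)
    fix a :: "nat \<Rightarrow> real"
    assume *: "\<forall>b :: (unit \<Rightarrow> nat) \<Rightarrow> real.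
     (\<forall>w. Im w > 0 \<longrightarrow> ueval k (\<lambda>j. b (\<lambda>_. j)) w \<noteq> 0) \<longrightarrow>
       (\<forall>w. Im w > 0 \<longrightarrow> ueval k (\<lambda>j. L j * b (\<lambda>_. j)) w \<noteq> 0) \<or> (\<forall>j\<le>k. L j * b (\<lambda>_. j) = 0)"
    show "(\<forall>w. Im w > 0 \<longrightarrow> ueval k a w \<noteq> 0) \<longrightarrow>
       (\<forall>w. Im w > 0 \<longrightarrow> ueval k (\<lambda>j. L j * a j) w \<noteq> 0) \<or> (\<forall>j\<le>k. L j * a j = 0)"
      using *[rule_format, of "\<lambda>\<alpha>. a (\<alpha> ())"] by blast
  next
    fix b :: "(unit \<Rightarrow> nat) \<Rightarrow> real"
    assume "\<forall>a. (\<forall>w. Im w > 0 \<longrightarrow> ueval k a w \<noteq> 0) \<longrightarrow>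
       (\<forall>w. Im w > 0 \<longrightarrow> ueval k (\<lambda>j. L j * a j) w \<noteq> 0) \<or> (\<forall>j\<le>k. L j * a j = 0)"
    then show "(\<forall>w. Im w > 0 \<longrightarrow> ueval k (\<lambda>j. b (\<lambda>_. j)) w \<noteq> 0) \<longrightarrow>
       (\<forall>w. Im w > 0 \<longrightarrow> ueval k (\<lambda>j. L j * b (\<lambda>_. j)) w \<noteq> 0) \<or> (\<forall>j\<le>k. L j * b (\<lambda>_. j) = 0)"
      by blast
  qed
  finally show ?thesis .
qed


section \<open>The symbols of the operator\<close>

lemma prod_single_mono:
  "(\<Prod>i\<in>I. Poly_Mapping.single (\<mu> i) (c i)) = Poly_Mapping.single (\<Sum>i\<in>I. \<mu> i) (\<Prod>i\<in>I. c i :: 'a::comm_semiring_1)"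
  by (induction I rule: infinite_finite_induct) (auto simp: mult_single)

lemma prod_sum_single:
  "(\<Prod>i\<in>UNIV. \<Sum>k\<le>\<kappa> i. Poly_Mapping.single (\<mu> i k) (c i k)) =
   (\<Sum>\<alpha>\<in>exps (\<kappa> :: 'n::finite \<Rightarrow> nat). Poly_Mapping.single (\<Sum>i\<in>UNIV. \<mu> i (\<alpha> i)) (\<Prod>i\<in>UNIV. c i (\<alpha> i) :: 'a::comm_semiring_1))"
  unfolding prod_sum_exps prod_single_mono ..

lemma mult_op_z_sum_single:
  fixes \<kappa> :: "'n::finite \<Rightarrow> nat"
  assumes "\<And>\<alpha> i. \<alpha> \<in> exps \<kappa> \<Longrightarrow> Poly_Mapping.lookup (\<mu> \<alpha>) (Inl i) = \<alpha> i"
  shows "mult_op_z l (\<Sum>\<alpha>\<in>exps \<kappa>. Poly_Mapping.single (\<mu> \<alpha>) (c \<alpha>)) =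
         (\<Sum>\<alpha>\<in>exps \<kappa>. Poly_Mapping.single (\<mu> \<alpha>) (l \<alpha> * c \<alpha>))"
proof (rule poly_mapping_eqI)
  fix m
  show "Poly_Mapping.lookup (mult_op_z l (\<Sum>\<alpha>\<in>exps \<kappa>. Poly_Mapping.single (\<mu> \<alpha>) (c \<alpha>))) m =
      Poly_Mapping.lookup (\<Sum>\<alpha>\<in>exps \<kappa>. Poly_Mapping.single (\<mu> \<alpha>) (l \<alpha> * c \<alpha>)) m"
    unfolding mult_op_z_def lookup_diag_op lookup_sum lookup_single sum_distrib_left
    using assms by (intro sum.cong refl) (auto simp: when_def)
qed

text \<open>The coefficients of the polynomial \<open>P\<close> of the introduction, that is of \<open>T[(1 + x)\<^sup>\<kappa>]\<close>.\<close>

definition symb :: "('n::finite \<Rightarrow> nat) \<Rightarrow> (('n \<Rightarrow> nat) \<Rightarrow> real) \<Rightarrow> ('n \<Rightarrow> nat) \<Rightarrow> real"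
  where "symb \<kappa> l \<alpha> = (\<Prod>i\<in>UNIV. of_nat (\<kappa> i choose \<alpha> i)) * l \<alpha>"

definition zw :: "'n \<Rightarrow> nat \<Rightarrow> ('n + 'n) \<Rightarrow>\<^sub>0 nat"
  where "zw i k = Poly_Mapping.single (Inl i) k + Poly_Mapping.single (Inr i) k"

lemma Var_power: "Var v ^ k = Poly_Mapping.single (Poly_Mapping.single v k) 1"
  by (induction k) (simp_all add: Var_def mult_single single_add[symmetric])

lemma zw_power: "(zvar i * wvar i) ^ k = Poly_Mapping.single (zw i k) 1"
  by (simp add: power_mult_distrib zvar_def wvar_def Var_power mult_single zw_def)

lemma Const_times_single: "Const c * Poly_Mapping.single m d = Poly_Mapping.single m (c * d)"
  by (simp add: Const_def mult_single)

lemma Const_power: "Const s ^ k = Const (s ^ k)"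
  by (induction k) (simp_all add: Const_def mult_single)

lemma binomial_zw:
  "(1 + Const s * (zvar i * wvar i)) ^ n =
     (\<Sum>k\<le>n. Poly_Mapping.single (zw i k) (of_nat (n choose k) * s ^ k))"
proof -
  have "(1 + Const s * (zvar i * wvar i)) ^ n = (Const s * (zvar i * wvar i) + 1) ^ n"
    by (simp add: add.commute)
  also have "\<dots> = (\<Sum>k\<le>n. of_nat (n choose k) * (Const s * (zvar i * wvar i)) ^ k)"
    by (simp add: binomial_ring)
  also have "\<dots> = (\<Sum>k\<le>n. Poly_Mapping.single (zw i k) (of_nat (n choose k) * s ^ k))"
    by (simp add: power_mult_distrib[of "Const s"] zw_power Const_power Const_times_single
        mult_single flip: single_of_nat)
  finally show ?thesis .
qed

lemma binomial_z_w:
  "(zvar i + Const s * wvar i) ^ n =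
     (\<Sum>k\<le>n. Poly_Mapping.single (Poly_Mapping.single (Inl i) k + Poly_Mapping.single (Inr i) (n - k))
       (of_nat (n choose k) * s ^ (n - k)))"
  unfolding binomial_ring
  by (intro sum.cong refl) (simp add: power_mult_distrib zvar_def wvar_def Var_power Const_power
      Const_times_single mult_single flip: single_of_nat)

lemma subst_poly_zw:
  fixes i :: 'n
  assumes "degree f \<le> n"
  shows "subst_poly f (zvar i * wvar i) = (\<Sum>k\<le>n. Poly_Mapping.single (zw i k) (coeff f k))"
proof -
  have "Const 0 = (0 :: ('n + 'n, real) mvpoly)" by (simp add: Const_def)
  then have c: "coeff (map_poly Const f) k = (Const (coeff f k) :: ('n + 'n, real) mvpoly)" for k
    by (simp add: coeff_map_poly)
  have "degree (map_poly Const f :: ('n + 'n, real) mvpoly poly) \<le> n"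
    by (rule order_trans[OF map_poly_degree_leq assms])
  then have "subst_poly f (zvar i * wvar i) = (\<Sum>k\<le>n. Const (coeff f k) * (zvar i * wvar i) ^ k)"
    unfolding subst_poly_def poly_altdef c[symmetric]
    by (intro sum.mono_neutral_left) (auto simp: coeff_eq_0)
  then show ?thesis by (simp add: zw_power Const_times_single)
qed

lemma lookup_sum_zw: "Poly_Mapping.lookup (\<Sum>i\<in>UNIV. zw i (\<alpha> i)) (Inl j) = \<alpha> (j :: 'n::finite)"
  by (simp add: lookup_sum zw_def lookup_add lookup_single when_def)

lemma inj_sum_zw: "(\<Sum>i\<in>UNIV. zw i (\<alpha> i)) = (\<Sum>i\<in>UNIV. zw i (\<beta> i)) \<longleftrightarrow> \<alpha> = (\<beta> :: 'n::finite \<Rightarrow> nat)"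
  by (metis lookup_sum_zw ext)

lemma mult_op_z_binomial_zw:
  "mult_op_z l (\<Prod>i\<in>UNIV. (1 + Const s * (zvar i * wvar i)) ^ \<kappa> i) =
   (\<Sum>\<alpha>\<in>exps \<kappa>. Poly_Mapping.single (\<Sum>i\<in>UNIV. zw i (\<alpha> i)) ((\<Prod>i\<in>UNIV. s ^ \<alpha> i) * symb \<kappa> l \<alpha>))"
  unfolding binomial_zw prod_sum_single
  by (subst mult_op_z_sum_single) (simp_all add: lookup_sum_zw symb_def prod.distrib mult_ac)

lemma mult_op_z_binomial_z_w:
  fixes \<kappa> :: "'n::finite \<Rightarrow> nat"
  shows "mult_op_z l (\<Prod>i\<in>UNIV. (zvar i + Const s * wvar i) ^ \<kappa> i) =
   (\<Sum>\<alpha>\<in>exps \<kappa>. Poly_Mapping.single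
      (\<Sum>i\<in>UNIV. Poly_Mapping.single (Inl i) (\<alpha> i) + Poly_Mapping.single (Inr i) (\<kappa> i - \<alpha> i))
      ((\<Prod>i\<in>UNIV. s ^ (\<kappa> i - \<alpha> i)) * symb \<kappa> l \<alpha>))"
  unfolding binomial_z_w prod_sum_single
  by (subst mult_op_z_sum_single)
    (simp_all add: lookup_sum lookup_add lookup_single when_def symb_def prod.distrib mult_ac)

text \<open>The product of the univariate polynomials \<open>f i\<close> has the coefficients \<open>b\<close>. The equation ranges over
all exponents, also those outside the box; this bounds the degrees of the factors.\<close>

definition real_zero_factors :: "('n::finite \<Rightarrow> real poly) \<Rightarrow> ('n \<Rightarrow> nat) \<Rightarrow> (('n \<Rightarrow> nat) \<Rightarrow> real) \<Rightarrow> bool"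
  where "real_zero_factors f \<kappa> b \<longleftrightarrow> (\<forall>i. real_zeros_only (f i)) \<and> zeros_same_sign f \<and>
     (\<forall>\<alpha>. (\<Prod>i\<in>UNIV. coeff (f i) (\<alpha> i)) = (if \<alpha> \<in> exps \<kappa> then b \<alpha> else 0))"

text \<open>The monomials \<open>z\<^sup>\<alpha>w\<^sup>\<alpha>\<close> are distinct for distinct \<open>\<alpha>\<close>, so polynomials in the products
\<open>z\<^sub>i w\<^sub>i\<close> may be compared coefficient by coefficient.\<close>

lemma splits_iff_real_zero_factors:
  fixes \<kappa> :: "'n::finite \<Rightarrow> nat"
  shows "splits_real_same_sign (\<Sum>\<alpha>\<in>exps \<kappa>. Poly_Mapping.single (\<Sum>i\<in>UNIV. zw i (\<alpha> i)) (b \<alpha>)) \<longleftrightarrow>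
    (\<exists>f. real_zero_factors f \<kappa> b)"
proof -
  have "(\<Sum>\<alpha>\<in>exps \<kappa>. Poly_Mapping.single (\<Sum>i\<in>UNIV. zw i (\<alpha> i)) (b \<alpha>)) =
      (\<Prod>i\<in>UNIV. subst_poly (f i) (zvar i * wvar i)) \<longleftrightarrow>
     (\<forall>\<alpha>. (\<Prod>i\<in>UNIV. coeff (f i) (\<alpha> i)) = (if \<alpha> \<in> exps \<kappa> then b \<alpha> else 0))"
    (is "?p = ?q \<longleftrightarrow> _") for f :: "'n \<Rightarrow> real poly"
  proof -
    define d where "d i = degree (f i)" for i
    have q: "?q = (\<Sum>\<alpha>\<in>exps d. Poly_Mapping.single (\<Sum>i\<in>UNIV. zw i (\<alpha> i)) (\<Prod>i\<in>UNIV. coeff (f i) (\<alpha> i)))"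
      using subst_poly_zw[of "f i" "d i" i for i] prod_sum_single[of "\<lambda>i. zw i" "\<lambda>i. coeff (f i)" d] by (simp add: d_def)
    have lk: "Poly_Mapping.lookup (\<Sum>\<alpha>\<in>exps k. Poly_Mapping.single (\<Sum>i\<in>UNIV. zw i (\<alpha> i)) (c \<alpha>)) (\<Sum>i\<in>UNIV. zw i (\<alpha> i))
       = (if \<alpha> \<in> exps k then c \<alpha> else 0)" for k and c :: "('n \<Rightarrow> nat) \<Rightarrow> real" and \<alpha>
      by (simp add: lookup_sum lookup_single when_def inj_sum_zw)
    have out: "Poly_Mapping.lookup (\<Sum>\<alpha>\<in>exps k. Poly_Mapping.single (\<Sum>i\<in>UNIV. zw i (\<alpha> i)) (c \<alpha>)) m = 0"
      if "m \<notin> range (\<lambda>\<alpha>. \<Sum>i\<in>UNIV. zw i (\<alpha> i))" for k m and c :: "('n \<Rightarrow> nat) \<Rightarrow> real"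
      using that by (auto simp: lookup_sum lookup_single when_def intro!: sum.neutral)
    have "?p = ?q \<longleftrightarrow> (\<forall>\<alpha>. Poly_Mapping.lookup ?p (\<Sum>i\<in>UNIV. zw i (\<alpha> i)) = Poly_Mapping.lookup ?q (\<Sum>i\<in>UNIV. zw i (\<alpha> i)))"
    proof
      assume *: "\<forall>\<alpha>. Poly_Mapping.lookup ?p (\<Sum>i\<in>UNIV. zw i (\<alpha> i)) = Poly_Mapping.lookup ?q (\<Sum>i\<in>UNIV. zw i (\<alpha> i))"
      show "?p = ?q"
      proof (rule poly_mapping_eqI)
        fix m show "Poly_Mapping.lookup ?p m = Poly_Mapping.lookup ?q m"
          using * by (cases "m \<in> range (\<lambda>\<alpha>. \<Sum>i\<in>UNIV. zw i (\<alpha> i))") (auto simp: q out)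
      qed
    qed simp
    also have "\<dots> \<longleftrightarrow> (\<forall>\<alpha>. (\<Prod>i\<in>UNIV. coeff (f i) (\<alpha> i)) = (if \<alpha> \<in> exps \<kappa> then b \<alpha> else 0))"
    proof -
      have "(\<Prod>i\<in>UNIV. coeff (f i) (\<alpha> i)) = 0" if \<alpha>: "\<alpha> \<notin> exps d" for \<alpha>
      proof -
        obtain i where "degree (f i) < \<alpha> i" using \<alpha> by (auto simp: exps_iff d_def not_le)
        then show ?thesis by (intro prod_zero) (auto intro!: bexI[of _ i] coeff_eq_0)
      qed
      then have "(if \<alpha> \<in> exps d then \<Prod>i\<in>UNIV. coeff (f i) (\<alpha> i) else 0) = (\<Prod>i\<in>UNIV. coeff (f i) (\<alpha> i))" for \<alpha>
        by simp
      then show ?thesis unfolding q lk by (simp only: eq_commute)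
    qed
    finally show ?thesis .
  qed
  then show ?thesis by (simp add: splits_real_same_sign_def real_zero_factors_def)
qed

section \<open>Stable symbols and symbols that are products\<close>

lemma poly_map_poly_of_real:
  "poly (map_poly complex_of_real p) (of_real x) = of_real (poly p x)"
  by (induction p) (simp_all add: map_poly_pCons)

lemma real_zeros_only_nonzero: "real_zeros_only f \<Longrightarrow> f \<noteq> 0"
  by (auto simp: real_zeros_only_def complex_is_Real_iff dest: spec[of _ \<i>])

lemma real_zero_factors_degree:
  assumes "real_zero_factors f \<kappa> b"
  shows "degree (f i) \<le> \<kappa> i"
proof -
  have c: "\<forall>\<alpha>. (\<Prod>i\<in>UNIV. coeff (f i) (\<alpha> i)) = (if \<alpha> \<in> exps \<kappa> then b \<alpha> else 0)"
    using assms[unfolded real_zero_factors_def] by (elim conjE)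
  have "f i \<noteq> 0" for i
    using assms real_zeros_only_nonzero by (auto simp: real_zero_factors_def)
  then have "(\<Prod>i\<in>UNIV. coeff (f i) (degree (f i))) \<noteq> 0" by simp
  moreover have "(\<Prod>i\<in>UNIV. coeff (f i) (degree (f i))) =
      (if (\<lambda>i. degree (f i)) \<in> exps \<kappa> then b (\<lambda>i. degree (f i)) else 0)"
    by (rule spec[OF c, of "\<lambda>i. degree (f i)"])
  ultimately have "(\<lambda>i. degree (f i)) \<in> exps \<kappa>" by presburger
  then show ?thesis by (simp add: exps_iff)
qed

lemma rpeval_factors:
  assumes "\<And>\<alpha>. \<alpha> \<in> exps \<kappa> \<Longrightarrow> b \<alpha> = (\<Prod>i\<in>UNIV. coeff (f i) (\<alpha> i))" and "\<And>i. degree (f i) \<le> \<kappa> i"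
  shows "rpeval \<kappa> b x = (\<Prod>i\<in>UNIV. poly (map_poly of_real (f i)) (x i))"
proof -
  have "rpeval \<kappa> b x = rpeval \<kappa> (\<lambda>\<alpha>. \<Prod>i\<in>UNIV. coeff (f i) (\<alpha> i)) x"
    using assms(1) by (intro peval_cong) simp
  also have "\<dots> = (\<Prod>i\<in>UNIV. poly (map_poly of_real (f i)) (x i))"
    unfolding rpeval_prod[of \<kappa> "\<lambda>i. coeff (f i)" x] using assms(2) by (simp add: ueval_coeff)
  finally show ?thesis .
qed

text \<open>For \<open>s = 1\<close> the plane without the nonpositive reals, for \<open>s = -1\<close> the plane without the
nonnegative reals.\<close>

definition slit :: "real \<Rightarrow> complex set"
  where "slit s = {z. of_real s * z \<notin> \<real>\<^sub>\<le>\<^sub>0}"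

lemma nonreal_subset_slit: "s \<noteq> 0 \<Longrightarrow> - \<real> \<subseteq> slit s"
  by (auto simp: slit_def complex_nonpos_Reals_iff complex_is_Real_iff)

lemma zero_free_subset: "zero_free B \<kappa> c \<Longrightarrow> A \<subseteq> B \<Longrightarrow> zero_free A \<kappa> c"
  unfolding zero_free_def by blast

lemma factors_zero_free:
  assumes f: "real_zero_factors f \<kappa> b"
  shows "rzero_free (slit 1) \<kappa> b \<or> rzero_free (slit (-1)) \<kappa> b"
proof -
  have ev: "rpeval \<kappa> b x = (\<Prod>i\<in>UNIV. poly (map_poly of_real (f i)) (x i))" for x
    using f by (intro rpeval_factors real_zero_factors_degree[OF f]) (auto simp: real_zero_factors_def)
  have real: "\<exists>r. z = of_real r \<and> poly (f i) r = 0" if "poly (map_poly complex_of_real (f i)) z = 0" for i z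
  proof -
    have "z \<in> \<real>" using f that by (auto simp: real_zero_factors_def real_zeros_only_def)
    then obtain r where r: "z = of_real r" by (auto elim: Reals_cases)
    have "complex_of_real (poly (f i) r) = 0" using that r by (metis poly_map_poly_of_real)
    then show ?thesis using r by auto
  qed
  have zf: "rzero_free (slit s) \<kappa> b" if "\<And>i x. poly (f i) x = 0 \<Longrightarrow> s * x \<le> 0" for s
    unfolding zero_free_def ev
  proof (intro allI impI notI)
    fix x assume x: "\<forall>i. x i \<in> slit s" and "(\<Prod>i\<in>UNIV. poly (map_poly complex_of_real (f i)) (x i)) = 0"
    then obtain i where "poly (map_poly complex_of_real (f i)) (x i) = 0" by auto
    from real[OF this] obtain r where "x i = of_real r" "poly (f i) r = 0" by blast
    then show False using x that[of i r] by (auto simp: slit_def complex_nonpos_Reals_iff dest: spec[of _ i])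
  qed
  show ?thesis
    using f zf[of 1] zf[of "-1"] by (auto simp: real_zero_factors_def zeros_same_sign_def)
qed

lemma zero_free_imp_nonzero_coeff:
  assumes "zero_free A \<kappa> c" "A \<noteq> {}"
  shows "\<exists>\<alpha>\<in>exps \<kappa>. c \<alpha> \<noteq> 0"
proof (rule ccontr)
  assume "\<not> ?thesis"
  then have "peval \<kappa> c x = 0" for x by (auto simp: peval_def intro: sum.neutral)
  then show False using assms by (auto simp: zero_free_def)
qed

lemma rcoeffs_factor:
  assumes zf: "rzero_free (- \<real>) \<kappa> b" and \<alpha>0: "\<alpha>0 \<in> exps \<kappa>" "b \<alpha>0 \<noteq> 0" and \<alpha>: "\<alpha> \<in> exps \<kappa>"
  shows "b \<alpha> = b \<alpha>0 * (\<Prod>i\<in>UNIV. b (\<alpha>0(i := \<alpha> i)) / b \<alpha>0)"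
proof -
  have "complex_of_real (b \<alpha>) = of_real (b \<alpha>0 * (\<Prod>i\<in>UNIV. b (\<alpha>0(i := \<alpha> i)) / b \<alpha>0))"
    using coeffs_factor[OF zf \<alpha>0(1) _ \<alpha>] \<alpha>0(2) by simp
  then show ?thesis by (simp only: of_real_eq_iff)
qed

text \<open>The product exists because the slit plane contains all nonreal numbers. A zero of one factor would be
a zero of the whole polynomial whatever the other variables are, and these can be placed in the
slit plane; so the zeros of the factors lie on the slit. The constant \<open>b \<alpha>0\<close> is absorbed into one
arbitrarily chosen factor.\<close>

lemma zero_free_factors:
  fixes \<kappa> :: "'n::finite \<Rightarrow> nat"
  assumes zf: "rzero_free (slit s) \<kappa> b" and s: "s = 1 \<or> s = -1"
  shows "\<exists>f. real_zero_factors f \<kappa> b"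
proof -
  have s2: "of_real s * (of_real s * z) = z" for z :: complex using s by auto
  have s_slit: "of_real s \<in> slit s" using s by (auto simp: slit_def)
  have zfr: "rzero_free (- \<real>) \<kappa> b"
    using zero_free_subset[OF zf nonreal_subset_slit] s by auto
  obtain \<alpha>0 where \<alpha>0: "\<alpha>0 \<in> exps \<kappa>" "b \<alpha>0 \<noteq> 0"
    using zero_free_imp_nonzero_coeff[OF zf] s_slit by auto
  define j :: 'n where "j = undefined"
  define f where "f i = smult (if i = j then b \<alpha>0 else 1) (\<Sum>k\<le>\<kappa> i. monom (b (\<alpha>0(i := k)) / b \<alpha>0) k)" for i
  have cf: "coeff (f i) k = (if i = j then b \<alpha>0 else 1) * (if k \<le> \<kappa> i then b (\<alpha>0(i := k)) / b \<alpha>0 else 0)" for i k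
    by (simp add: f_def coeff_sum)
  have prod: "(\<Prod>i\<in>UNIV. coeff (f i) (\<alpha> i)) = (if \<alpha> \<in> exps \<kappa> then b \<alpha> else 0)" for \<alpha>
  proof (cases "\<alpha> \<in> exps \<kappa>")
    case True
    then have "(\<Prod>i\<in>UNIV. coeff (f i) (\<alpha> i)) = b \<alpha>0 * (\<Prod>i\<in>UNIV. b (\<alpha>0(i := \<alpha> i)) / b \<alpha>0)"
      unfolding cf prod.distrib by (simp add: prod.delta exps_iff)
    then show ?thesis using True rcoeffs_factor[OF zfr \<alpha>0 True] by (simp only: if_True)
  next
    case False
    then obtain i where "\<not> \<alpha> i \<le> \<kappa> i" by (auto simp: exps_iff)
    then have "coeff (f i) (\<alpha> i) = 0" by (simp add: cf)
    then show ?thesis using False by (auto intro!: prod_zero)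
  qed
  have deg: "degree (f i) \<le> \<kappa> i" for i by (rule degree_le) (simp add: cf)
  have ev: "rpeval \<kappa> b x = (\<Prod>i\<in>UNIV. poly (map_poly of_real (f i)) (x i))" for x
    using prod by (intro rpeval_factors deg) simp
  have zero: "of_real s * z \<in> \<real>\<^sub>\<le>\<^sub>0" if z: "poly (map_poly complex_of_real (f i)) z = 0" for i z
  proof (rule ccontr)
    assume "of_real s * z \<notin> \<real>\<^sub>\<le>\<^sub>0"
    then have "\<forall>k. ((\<lambda>_. of_real s)(i := z)) k \<in> slit s" using s_slit by (auto simp: slit_def)
    then have "rpeval \<kappa> b ((\<lambda>_. of_real s)(i := z)) \<noteq> 0" using zf by (auto simp: zero_free_def)
    moreover have "(\<Prod>k\<in>UNIV. poly (map_poly complex_of_real (f k)) (((\<lambda>_. of_real s)(i := z)) k)) = 0"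
      using z by (intro prod_zero) (auto intro!: bexI[of _ i])
    ultimately show False unfolding ev by simp
  qed
  have "real_zeros_only (f i)" for i
    unfolding real_zeros_only_def
  proof (intro allI impI)
    fix z assume "poly (map_poly complex_of_real (f i)) z = 0"
    from zero[OF this] show "z \<in> \<real>" using s by (auto simp: complex_nonpos_Reals_iff complex_is_Real_iff)
  qed
  moreover have "zeros_same_sign f"
  proof -
    have "s * x \<le> 0" if "poly (f i) x = 0" for i x
    proof -
      have "poly (map_poly complex_of_real (f i)) (of_real x) = 0" using that by (simp add: poly_map_poly_of_real)
      from zero[OF this] show ?thesis by (simp add: complex_nonpos_Reals_iff)
    qed
    then show ?thesis using s unfolding zeros_same_sign_def by fastforce
  qed
  ultimately have "real_zero_factors f \<kappa> b" using prod by (simp add: real_zero_factors_def)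
  then show ?thesis by blast
qed

lemma real_zero_factors_reflect:
  assumes "real_zero_factors f \<kappa> b"
  shows "real_zero_factors (\<lambda>i. pcompose (f i) [:0, -1:]) \<kappa> (\<lambda>\<alpha>. (\<Prod>i\<in>UNIV. (-1) ^ \<alpha> i) * b \<alpha>)"
proof -
  have p: "poly (pcompose g [:0, -1:]) x = poly g (- x)" for g :: "real poly" and x by (simp add: poly_pcompose)
  have cp: "poly (map_poly complex_of_real (pcompose g [:0, -1:])) z = poly (map_poly complex_of_real g) (- z)" for g z
  proof -
    have "map_poly complex_of_real (pcompose g [:0, -1:]) = pcompose (map_poly complex_of_real g) [:0, -1:]"
      by (rule poly_eqI) (simp add: coeff_map_poly coeff_pcompose_linear)
    then show ?thesis by (simp add: poly_pcompose)
  qed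
  have "real_zeros_only (pcompose (f i) [:0, -1:])" for i
    using assms unfolding real_zero_factors_def real_zeros_only_def cp by (metis Reals_minus_iff)
  moreover have "zeros_same_sign (\<lambda>i. pcompose (f i) [:0, -1:])"
    using assms unfolding real_zero_factors_def zeros_same_sign_def p by (metis neg_0_le_iff_le neg_le_0_iff_le)
  moreover have "(\<Prod>i\<in>UNIV. coeff (pcompose (f i) [:0, -1:]) (\<alpha> i)) =
      (if \<alpha> \<in> exps \<kappa> then (\<Prod>i\<in>UNIV. (-1) ^ \<alpha> i) * b \<alpha> else 0)" for \<alpha>
    using assms by (simp add: coeff_pcompose_linear prod.distrib real_zero_factors_def)
  ultimately show ?thesis by (simp add: real_zero_factors_def)
qed

text \<open>The two symbols differ by the substitution \<open>x \<mapsto> -x\<close>, which maps products of the required kind to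
products of the same kind; so either of them may be used.\<close>

lemma splits_iff_factors:
  fixes \<kappa> :: "'n::finite \<Rightarrow> nat"
  shows "(splits_real_same_sign (mult_op_z l (\<Prod>i\<in>UNIV. (1 + zvar i * wvar i) ^ \<kappa> i)) \<or>
    splits_real_same_sign (mult_op_z l (\<Prod>i\<in>UNIV. (1 - zvar i * wvar i) ^ \<kappa> i))) \<longleftrightarrow>
   (\<exists>f. real_zero_factors f \<kappa> (symb \<kappa> l))" (is "?p \<or> ?m \<longleftrightarrow> ?D")
proof -
  have C1: "Const 1 = 1" and Cm1: "Const (-1) = -1"
    by (simp_all add: Const_def single_uminus)
  have p: "?p \<longleftrightarrow> ?D"
    using splits_iff_real_zero_factors[where \<kappa>=\<kappa> and b="\<lambda>\<alpha>. (\<Prod>i\<in>UNIV. 1 ^ \<alpha> i) * symb \<kappa> l \<alpha>"]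
    unfolding mult_op_z_binomial_zw[symmetric] by (simp add: C1)
  have m: "?m \<longleftrightarrow> (\<exists>f. real_zero_factors f \<kappa> (\<lambda>\<alpha>. (\<Prod>i\<in>UNIV. (-1) ^ \<alpha> i) * symb \<kappa> l \<alpha>))"
    using splits_iff_real_zero_factors[where \<kappa>=\<kappa> and b="\<lambda>\<alpha>. (\<Prod>i\<in>UNIV. (-1) ^ \<alpha> i) * symb \<kappa> l \<alpha>"]
    unfolding mult_op_z_binomial_zw[symmetric] by (simp add: Cm1)
  have "?D" if "?m"
  proof -
    obtain f where f: "real_zero_factors f \<kappa> (\<lambda>\<alpha>. (\<Prod>i\<in>UNIV. (-1) ^ \<alpha> i) * symb \<kappa> l \<alpha>)"
      using \<open>?m\<close> m by blast
    have "(\<lambda>\<alpha>. (\<Prod>i\<in>UNIV. (-1) ^ \<alpha> i) * ((\<Prod>i\<in>UNIV. (-1) ^ \<alpha> i) * symb \<kappa> l \<alpha>)) = symb \<kappa> l"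
      by (rule ext) (simp add: mult.assoc[symmetric] prod.distrib[symmetric] power_mult_distrib[symmetric])
    with real_zero_factors_reflect[OF f] show ?D by auto
  qed
  with p show ?thesis by blast
qed

lemma mon_sum_type: "mon x (m :: 'n + 'n \<Rightarrow> nat) = mon (\<lambda>i. x (Inl i)) (\<lambda>i. m (Inl i)) * mon (\<lambda>i. x (Inr i)) (\<lambda>i::'n::finite. m (Inr i))"
  unfolding mon_def UNIV_Plus_UNIV[symmetric] by (subst prod.Plus) simp_all

lemma quotient_notin_nonpos:
  assumes "Im z > 0" "Im w > 0" shows "z / w \<notin> \<real>\<^sub>\<le>\<^sub>0"
proof
  assume "z / w \<in> \<real>\<^sub>\<le>\<^sub>0"
  then obtain r where r: "z / w = of_real r" "r \<le> 0" by (auto elim: nonpos_Reals_cases)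
  have "w \<noteq> 0" using assms by auto
  then have "z = of_real r * w" using r by (simp add: field_simps)
  then have "Im z = r * Im w" by simp
  then show False using assms r(2) mult_nonpos_nonneg[of r "Im w"] by simp
qed

text \<open>Take \<open>z = i q\<close> and \<open>w = i/q\<close> with the principal square root \<open>q\<close> of \<open>\<zeta>\<close>, which lies in the right
half-plane.\<close>

lemma ex_quotient_upper:
  assumes "\<zeta> \<notin> \<real>\<^sub>\<le>\<^sub>0"
  shows "\<exists>z w. Im z > 0 \<and> Im w > 0 \<and> z / w = \<zeta>"
proof (intro exI conjI)
  have nz: "\<zeta> \<noteq> 0" using assms by auto
  have inv_pos: "Re (inverse q) > 0" if "Re q > 0" for q
    using that by (simp add: divide_pos_pos sum_power2_gt_zero_iff)
  have re: "Re (csqrt \<zeta>) > 0"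
  proof (rule ccontr)
    assume "\<not> Re (csqrt \<zeta>) > 0"
    then have "Re (csqrt \<zeta>) = 0" using csqrt_principal[of \<zeta>] by linarith
    moreover have "(csqrt \<zeta>)\<^sup>2 = \<zeta>" by simp
    ultimately have "Re \<zeta> = - (Im (csqrt \<zeta>))\<^sup>2" "Im \<zeta> = 0"
      by (metis Re_power2 Im_power2 zero_power2 diff_0 mult_zero_right mult_zero_left)+
    moreover have "- (Im (csqrt \<zeta>))\<^sup>2 \<le> 0" by simp
    ultimately have "Re \<zeta> \<le> 0" "Im \<zeta> = 0" by (simp_all only:)
    then show False using assms by (simp add: complex_nonpos_Reals_iff)
  qed
  show "Im (\<i> * csqrt \<zeta>) > 0" using re by simp
  show "Im (\<i> * inverse (csqrt \<zeta>)) > 0" using inv_pos[OF re] by simp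
  have "(csqrt \<zeta>) * (csqrt \<zeta>) = \<zeta>" by (metis power2_csqrt power2_eq_square)
  moreover have "(\<i> * q) / (\<i> * inverse q) = q * q" for q :: complex
  proof -
    have "(\<i> * q) / (\<i> * inverse q) = q / inverse q" by simp
    then show ?thesis by (simp only: divide_inverse inverse_inverse_eq)
  qed
  ultimately show "(\<i> * csqrt \<zeta>) / (\<i> * inverse (csqrt \<zeta>)) = \<zeta>" by (simp only:)
qed

text \<open>The symbol is \<open>(s w)\<^sup>\<kappa> P(z / (s w))\<close>, and as \<open>z\<close> and \<open>w\<close> range over the upper half-plane the
quotients \<open>z / (s w)\<close> fill the slit plane.\<close>

lemma real_stable_z_w_iff:
  fixes \<kappa> :: "'n::finite \<Rightarrow> nat"
  assumes s: "s = 1 \<or> s = -1"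
  shows "real_stable (mult_op_z l (\<Prod>i\<in>UNIV. (zvar i + Const s * wvar i) ^ \<kappa> i)) \<longleftrightarrow>
     rzero_free (slit s) \<kappa> (symb \<kappa> l)"
proof -
  let ?p = "mult_op_z l (\<Prod>i\<in>UNIV. (zvar i + Const s * wvar i) ^ \<kappa> i)"
  have ev: "mv_eval (Poly_Mapping.map complex_of_real ?p) x =
     (\<Prod>i\<in>UNIV. (of_real s * x (Inr i)) ^ \<kappa> i) *
       rpeval \<kappa> (symb \<kappa> l) (\<lambda>i. x (Inl i) / (of_real s * x (Inr i)))"
    if x: "\<And>i. x (Inr i) \<noteq> 0" for x
  proof -
    have t: "of_real s ^ (k - a) * (w ^ (k - a) * z ^ a) = (of_real s * w) ^ k * (z / (of_real s * w)) ^ a"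
      if "a \<le> k" "w \<noteq> 0" for a k :: nat and z w :: complex
    proof -
      have "(of_real s * w) ^ k = (of_real s * w) ^ (k - a) * (of_real s * w) ^ a"
        using that by (simp flip: power_add)
      then show ?thesis using that s by (auto simp: power_divide power_mult_distrib)
    qed
    have term_eq: "of_real ((\<Prod>i\<in>UNIV. s ^ (\<kappa> i - \<alpha> i)) * symb \<kappa> l \<alpha>) *
         mon x (Poly_Mapping.lookup (\<Sum>i\<in>UNIV. Poly_Mapping.single (Inl i) (\<alpha> i) + Poly_Mapping.single (Inr i) (\<kappa> i - \<alpha> i))) =
       (\<Prod>i\<in>UNIV. (of_real s * x (Inr i)) ^ \<kappa> i) *
         (of_real (symb \<kappa> l \<alpha>) * mon (\<lambda>i. x (Inl i) / (of_real s * x (Inr i))) \<alpha>)"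
      (is "_ * mon x ?m = _") if \<alpha>: "\<alpha> \<in> exps \<kappa>" for \<alpha>
    proof -
      have m: "mon x ?m = (\<Prod>i\<in>UNIV. x (Inl i) ^ \<alpha> i) * (\<Prod>i\<in>UNIV. x (Inr i) ^ (\<kappa> i - \<alpha> i))"
        unfolding mon_sum_type by (simp add: mon_def lookup_sum lookup_add lookup_single when_def)
      have "(\<Prod>i\<in>UNIV. of_real s ^ (\<kappa> i - \<alpha> i)) * mon x ?m =
        (\<Prod>i\<in>UNIV. of_real s ^ (\<kappa> i - \<alpha> i) * (x (Inr i) ^ (\<kappa> i - \<alpha> i) * x (Inl i) ^ \<alpha> i))"
        unfolding m by (simp add: prod.distrib mult_ac)
      also have "\<dots> = (\<Prod>i\<in>UNIV. (of_real s * x (Inr i)) ^ \<kappa> i * (x (Inl i) / (of_real s * x (Inr i))) ^ \<alpha> i)"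
        using \<alpha> x by (intro prod.cong refl t) (auto simp: exps_iff)
      also have "\<dots> = (\<Prod>i\<in>UNIV. (of_real s * x (Inr i)) ^ \<kappa> i) * mon (\<lambda>i. x (Inl i) / (of_real s * x (Inr i))) \<alpha>"
        by (simp add: mon_def prod.distrib)
      finally show ?thesis by (simp add: of_real_prod mult_ac)
    qed
    show ?thesis
      unfolding mult_op_z_binomial_z_w peval_def sum_distrib_left mv_eval_sum_single[OF finite_exps]
      by (intro sum.cong refl term_eq)
  qed
  show ?thesis
  proof
    assume st: "real_stable ?p"
    show "rzero_free (slit s) \<kappa> (symb \<kappa> l)"
      unfolding zero_free_def
    proof (intro allI impI)
      fix x :: "'n \<Rightarrow> complex" assume x: "\<forall>i. x i \<in> slit s"
      then have "\<forall>i. \<exists>z w. Im z > 0 \<and> Im w > 0 \<and> z / w = of_real s * x i"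
        using ex_quotient_upper by (auto simp: slit_def)
      then obtain z w :: "'n \<Rightarrow> complex" where zw: "\<And>i. Im (z i) > 0" "\<And>i. Im (w i) > 0" "\<And>i. z i / w i = of_real s * x i"
        by metis
      define y where "y = (\<lambda>v. case v of Inl i \<Rightarrow> z i | Inr i \<Rightarrow> w i)"
      have "\<forall>v. Im (y v) > 0" using zw by (auto simp: y_def split: sum.splits)
      then have "mv_eval (Poly_Mapping.map complex_of_real ?p) y \<noteq> 0"
        using st by (simp add: real_stable_def stable_def)
      moreover have "y (Inr i) \<noteq> 0" for i using zw(2)[of i] by (auto simp: y_def)
      moreover have "(\<lambda>i. y (Inl i) / (of_real s * y (Inr i))) = x"
        using zw(3) s by (auto simp: y_def fun_eq_iff)
      ultimately show "rpeval \<kappa> (symb \<kappa> l) x \<noteq> 0" using ev[of y] by auto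
    qed
  next
    assume zf: "rzero_free (slit s) \<kappa> (symb \<kappa> l)"
    show "real_stable ?p"
      unfolding real_stable_def stable_def
    proof (intro allI impI)
      fix x :: "'n + 'n \<Rightarrow> complex" assume x: "\<forall>v. Im (x v) > 0"
      have nz: "x (Inr i) \<noteq> 0" for i using x[rule_format, of "Inr i"] by auto
      have "x (Inl i) / (of_real s * x (Inr i)) \<in> slit s" for i
        using quotient_notin_nonpos[of "x (Inl i)" "x (Inr i)"] x s by (auto simp: slit_def)
      then have "rpeval \<kappa> (symb \<kappa> l) (\<lambda>i. x (Inl i) / (of_real s * x (Inr i))) \<noteq> 0"
        using zf by (simp add: zero_free_def)
      then show "mv_eval (Poly_Mapping.map complex_of_real ?p) x \<noteq> 0"
        using ev[of x, OF nz] nz s by auto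
    qed
  qed
qed

lemma stable_iff_factors:
  fixes \<kappa> :: "'n::finite \<Rightarrow> nat"
  shows "(real_stable (mult_op_z l (\<Prod>i\<in>UNIV. (zvar i + wvar i) ^ \<kappa> i)) \<or>
    real_stable (mult_op_z l (\<Prod>i\<in>UNIV. (zvar i - wvar i) ^ \<kappa> i))) \<longleftrightarrow>
   (\<exists>f. real_zero_factors f \<kappa> (symb \<kappa> l))"
proof -
  have C1: "Const 1 = 1" and Cm1: "Const (-1) = -1"
    by (simp_all add: Const_def single_uminus)
  show ?thesis
    using real_stable_z_w_iff[of 1 l \<kappa>] real_stable_z_w_iff[of "-1" l \<kappa>]
      factors_zero_free[of _ \<kappa> "symb \<kappa> l"] zero_free_factors[of _ \<kappa> "symb \<kappa> l"]
    by (auto simp: C1 Cm1)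
qed

section \<open>Product symbols give multiplier sequences\<close>

lemma real_zeros_only_splits:
  assumes "real_zeros_only f"
  shows "\<exists>A. size A = degree f \<and> f = smult (lead_coeff f) (\<Prod>b\<in>#A. [:b, 1:]) \<and> (\<forall>b\<in>#A. poly f (- b) = 0)"
  using assms
proof (induction "degree f" arbitrary: f)
  case 0
  then obtain c where "f = [:c:]" by (metis degree_eq_zeroE)
  then show ?case by (intro exI[of _ "{#}"]) simp
next
  case (Suc n)
  have "degree (map_poly complex_of_real f) \<noteq> 0" using Suc.hyps by (simp add: degree_map_poly)
  then obtain z where z: "poly (map_poly complex_of_real f) z = 0"
    using alg_closed_imp_poly_has_root[of "map_poly complex_of_real f"] by auto
  then obtain r where r: "z = of_real r" using Suc.prems by (auto simp: real_zeros_only_def elim: Reals_cases)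
  have fr: "poly f r = 0" using z r poly_map_poly_of_real[of f r] by simp
  then obtain q where q: "f = [:- r, 1:] * q" by (metis dvdE poly_eq_0_iff_dvd)
  have f0: "f \<noteq> 0" using Suc.hyps by auto
  then have q0: "q \<noteq> 0" using q by auto
  have cq: "map_poly complex_of_real f = [:- of_real r, 1:] * map_poly complex_of_real q"
    unfolding q by (rule poly_eqI) (simp add: coeff_map_poly coeff_pCons split: nat.splits)
  have "real_zeros_only q"
    using Suc.prems unfolding real_zeros_only_def cq by simp
  moreover have dq: "n = degree q"
    using Suc.hyps q0 unfolding q by (subst (asm) degree_mult_eq) auto
  ultimately obtain A where A: "size A = degree q" "q = smult (lead_coeff q) (\<Prod>b\<in>#A. [:b, 1:])"
      "\<forall>b\<in>#A. poly q (- b) = 0"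
    using Suc.hyps(1) by blast
  have lc: "lead_coeff f = lead_coeff q" unfolding q lead_coeff_mult by simp
  show ?case
  proof (intro exI[of _ "add_mset (- r) A"] conjI ballI)
    show "size (add_mset (- r) A) = degree f" using A dq Suc.hyps by simp
    have "f = [:- r, 1:] * smult (lead_coeff q) (\<Prod>b\<in>#A. [:b, 1:])" using q A(2) by metis
    then show "f = smult (lead_coeff f) (\<Prod>b\<in>#add_mset (- r) A. [:b, 1:])"
      unfolding lc by (simp del: mult_pCons_left)
    show "poly f (- b) = 0" if "b \<in># add_mset (- r) A" for b
    proof (cases "b = - r")
      case False
      then have "poly q (- b) = 0" using A(3) that by auto
      then show ?thesis unfolding q by simp
    qed (use fr in simp)
  qed
qed

lemma coeff_mult_tendsto:
  fixes p q :: "nat \<Rightarrow> real poly"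
  assumes "\<And>k. (\<lambda>n. coeff (p n) k) \<longlonglongrightarrow> coeff p' k" "\<And>k. (\<lambda>n. coeff (q n) k) \<longlonglongrightarrow> coeff q' k"
  shows "(\<lambda>n. coeff (p n * q n) k) \<longlonglongrightarrow> coeff (p' * q') k"
  unfolding coeff_mult by (intro tendsto_intros assms)

text \<open>Each factor \<open>b + x\<close> with \<open>b \<ge> 0\<close> is moved to \<open>b + e + x\<close>, and the missing degree is supplied by
factors \<open>1 + e x\<close>, whose zero tends to infinity as \<open>e\<close> tends to 0.\<close>

lemma nonpos_zeros_approx:
  assumes f: "real_zeros_only f" and neg: "\<And>x. poly f x = 0 \<Longrightarrow> x \<le> 0" and m: "degree f \<le> m"
  obtains c B where "\<And>n::nat. c n \<noteq> 0" "\<And>n. size (B n) = m" "\<And>n b. b \<in># B n \<Longrightarrow> b > 0"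
    "\<And>k. (\<lambda>n. coeff (smult (c n) (\<Prod>b\<in>#B n. [:b, 1:])) k) \<longlonglongrightarrow> coeff f k"
proof -
  obtain A where A: "size A = degree f" "f = smult (lead_coeff f) (\<Prod>b\<in>#A. [:b, 1:])" "\<forall>b\<in>#A. poly f (- b) = 0"
    using real_zeros_only_splits[OF f] by blast
  have lc: "lead_coeff f \<noteq> 0" using real_zeros_only_nonzero[OF f] by simp
  \<comment> \<open>The zero at \<open>- 1 / e n\<close>, taken \<open>N\<close> times, fills the degree up to \<open>m\<close>.\<close>
  define N where "N = m - degree f"
  define e where "e n = 1 / real (Suc n)" for n
  have e: "e n > 0" for n by (simp add: e_def)
  have e0: "e \<longlonglongrightarrow> 0" unfolding e_def using LIMSEQ_inverse_real_of_nat by (simp add: inverse_eq_divide)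
  define B where "B n = image_mset (\<lambda>b. b + e n) A + replicate_mset N (1 / e n)" for n
  define c where "c n = lead_coeff f * e n ^ N" for n
  have shape: "smult (c n) (\<Prod>b\<in>#B n. [:b, 1:]) =
     smult (lead_coeff f) ((\<Prod>b\<in>#A. [:b + e n, 1:]) * [:1, e n:] ^ N)" for n
  proof -
    have "[:1, e n:] = smult (e n) [:1 / e n, 1:]" using e[of n] by simp
    then have "[:1, e n:] ^ N = smult (e n ^ N) ([:1 / e n, 1:] ^ N)" by (simp only: smult_power)
    then show ?thesis by (simp add: B_def c_def image_mset.compositionality comp_def mult_smult_right)
  qed
  show thesis
  proof (rule that[of c B])
    show "c n \<noteq> 0" for n using lc e[of n] by (simp add: c_def)
    show "size (B n) = m" for n using A m by (simp add: B_def N_def)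
    show "b > 0" if b: "b \<in># B n" for b n
    proof -
      have "b' \<ge> 0" if "b' \<in># A" for b' using A(3) neg[of "- b'"] that by auto
      then show ?thesis using b e[of n] by (auto simp: B_def add_nonneg_pos split: if_splits)
    qed
    have lin: "(\<lambda>n. coeff [:b + e n, 1:] k) \<longlonglongrightarrow> coeff [:b, 1:] k" for b k
      using tendsto_add[OF tendsto_const e0, of b] by (cases k) (auto simp: coeff_pCons split: nat.splits)
    have lin': "(\<lambda>n. coeff [:1, e n:] k) \<longlonglongrightarrow> coeff 1 k" for k
    proof (cases k)
      case (Suc j)
      then show ?thesis using e0 by (cases j) (auto simp: one_pCons)
    qed simp
    have 1: "(\<lambda>n. coeff (\<Prod>b\<in>#A. [:b + e n, 1:]) k) \<longlonglongrightarrow> coeff (\<Prod>b\<in>#A. [:b, 1:]) k" for k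
    proof (induction A arbitrary: k)
      case (add b A)
      show ?case
        using coeff_mult_tendsto[OF lin add.IH, of b k] by (simp del: mult_pCons_left)
    qed simp
    have 2: "(\<lambda>n. coeff ([:1, e n:] ^ N) k) \<longlonglongrightarrow> coeff 1 k" for k
    proof (induction N arbitrary: k)
      case (Suc N)
      show ?case
        using coeff_mult_tendsto[OF lin' Suc.IH, of k] by (simp only: power_Suc mult_1)
    qed simp
    show "(\<lambda>n. coeff (smult (c n) (\<Prod>b\<in>#B n. [:b, 1:])) k) \<longlonglongrightarrow> coeff f k" for k
    proof -
      have "(\<lambda>n. lead_coeff f * coeff ((\<Prod>b\<in>#A. [:b + e n, 1:]) * [:1, e n:] ^ N) k)
          \<longlonglongrightarrow> lead_coeff f * coeff ((\<Prod>b\<in>#A. [:b, 1:]) * 1) k"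
        by (intro tendsto_mult tendsto_const coeff_mult_tendsto 1 2)
      also have "lead_coeff f * coeff ((\<Prod>b\<in>#A. [:b, 1:]) * 1) k = coeff (smult (lead_coeff f) (\<Prod>b\<in>#A. [:b, 1:])) k" by simp
      also have "smult (lead_coeff f) (\<Prod>b\<in>#A. [:b, 1:]) = f" using A(2) by (rule sym)
      finally show ?thesis unfolding shape by simp
    qed
  qed
qed

lemma peval_scale: "peval \<kappa> (\<lambda>\<alpha>. u * c \<alpha>) x = u * peval \<kappa> c x"
  by (simp add: peval_def sum_distrib_left mult_ac)

lemma szego_one_variable:
  fixes \<kappa> :: "'n::finite \<Rightarrow> nat"
  assumes c: "zero_free upper \<kappa> c" and B: "size B = \<kappa> i" "\<And>b. b \<in># B \<Longrightarrow> b > 0" and u: "u \<noteq> 0"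
  shows "zero_free upper \<kappa> (\<lambda>\<alpha>. of_real (coeff (smult u (\<Prod>b\<in>#B. [:b, 1:])) (\<alpha> i) / real (\<kappa> i choose \<alpha> i)) * c \<alpha>)"
    (is "zero_free upper \<kappa> (\<lambda>\<alpha>. of_real (?h (\<alpha> i)) * c \<alpha>)")
  unfolding zero_free_def
proof (intro allI impI)
  fix x :: "'n \<Rightarrow> complex" assume x: "\<forall>i. x i \<in> upper"
  let ?p = "line_poly \<kappa> i c x"
  have "(\<Sum>k\<le>size B. coeff ?p k * of_real (coeff (\<Prod>b\<in>#B. [:b, 1:]) k) * (x i) ^ k / of_nat (size B choose k)) \<noteq> 0"
  proof (rule szego_composition)
    show "poly ?p w \<noteq> 0" if "Im w > 0" for w
      unfolding poly_line_poly using c x that by (simp add: zero_free_def)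
    show "degree ?p \<le> size B" using degree_line_poly B by simp
  qed (use B x in auto)
  then have "of_real u * (\<Sum>k\<le>\<kappa> i. coeff ?p k * of_real (coeff (\<Prod>b\<in>#B. [:b, 1:]) k) * (x i) ^ k / of_nat (\<kappa> i choose k)) \<noteq> 0"
    using u B by simp
  also have "of_real u * (\<Sum>k\<le>\<kappa> i. coeff ?p k * of_real (coeff (\<Prod>b\<in>#B. [:b, 1:]) k) * (x i) ^ k / of_nat (\<kappa> i choose k))
     = (\<Sum>k\<le>\<kappa> i. peval \<kappa> (slice i k (\<lambda>\<alpha>. of_real (?h (\<alpha> i)) * c \<alpha>)) x * x i ^ k)"
    unfolding sum_distrib_left
  proof (intro sum.cong refl)
    fix k assume k: "k \<in> {..\<kappa> i}"
    have "slice i k (\<lambda>\<alpha>. of_real (?h (\<alpha> i)) * c \<alpha>) = (\<lambda>\<alpha>. of_real (?h k) * slice i k c \<alpha>)"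
      by (auto simp: slice_def fun_eq_iff)
    then have "peval \<kappa> (slice i k (\<lambda>\<alpha>. of_real (?h (\<alpha> i)) * c \<alpha>)) x = of_real (?h k) * peval \<kappa> (slice i k c) x"
      by (simp only: peval_scale)
    then show "of_real u * (coeff ?p k * of_real (coeff (\<Prod>b\<in>#B. [:b, 1:]) k) * (x i) ^ k / of_nat (\<kappa> i choose k)) =
        peval \<kappa> (slice i k (\<lambda>\<alpha>. of_real (?h (\<alpha> i)) * c \<alpha>)) x * x i ^ k"
      using k by (simp add: coeff_line_poly)
  qed
  also have "\<dots> = peval \<kappa> (\<lambda>\<alpha>. of_real (?h (\<alpha> i)) * c \<alpha>) x"
    by (rule peval_slice[symmetric])
  finally show "peval \<kappa> (\<lambda>\<alpha>. of_real (?h (\<alpha> i)) * c \<alpha>) x \<noteq> 0" .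
qed

lemma szego_all_variables:
  fixes \<kappa> :: "'n::finite \<Rightarrow> nat"
  assumes c: "zero_free upper \<kappa> c" and B: "\<And>i. size (B i) = \<kappa> i" "\<And>i b. b \<in># B i \<Longrightarrow> b > 0" and u: "\<And>i. u i \<noteq> 0"
  shows "zero_free upper \<kappa>
    (\<lambda>\<alpha>. of_real (\<Prod>i\<in>UNIV. coeff (smult (u i) (\<Prod>b\<in>#B i. [:b, 1:])) (\<alpha> i) / real (\<kappa> i choose \<alpha> i)) * c \<alpha>)"
proof -
  let ?h = "\<lambda>i k. coeff (smult (u i) (\<Prod>b\<in>#B i. [:b, 1:])) k / real (\<kappa> i choose k)"
  have "zero_free upper \<kappa> (\<lambda>\<alpha>. of_real (\<Prod>i\<in>I. ?h i (\<alpha> i)) * c \<alpha>)" if "finite I" for I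
    using that
  proof induction
    case (insert i I)
    have "zero_free upper \<kappa> (\<lambda>\<alpha>. of_real (?h i (\<alpha> i)) * (of_real (\<Prod>i\<in>I. ?h i (\<alpha> i)) * c \<alpha>))"
      by (rule szego_one_variable[OF insert.IH B(1) B(2) u])
    then show ?case
      by (simp only: prod.insert[OF insert.hyps] of_real_mult mult.assoc)
  qed (use c in simp)
  then show ?thesis by simp
qed

lemma real_binomial_nonzero: "\<alpha> \<in> exps \<kappa> \<Longrightarrow> real (\<kappa> i choose \<alpha> i) \<noteq> 0"
  by (simp add: exps_iff not_less)

lemma symb_div_binomial:
  assumes "\<alpha> \<in> exps \<kappa>"
  shows "symb \<kappa> l \<alpha> / (\<Prod>i\<in>UNIV. real (\<kappa> i choose \<alpha> i)) = l \<alpha>"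
  using real_binomial_nonzero[OF assms] by (simp add: symb_def)

text \<open>For approximating factors of full degree with negative zeros, Szego's theorem in each variable
keeps the polynomial zero-free; Hurwitz's theorem passes to the limit. The alternative in Hurwitz's
theorem, that the limit vanishes identically, is the case in which the operator gives 0.\<close>

lemma nonpos_factors_imp_multiplier:
  fixes \<kappa> :: "'n::finite \<Rightarrow> nat"
  assumes f: "real_zero_factors f \<kappa> (symb \<kappa> l)" and neg: "\<And>i x. poly (f i) x = 0 \<Longrightarrow> x \<le> 0"
  shows "multiplier_seq \<kappa> l"
  unfolding multiplier_seq_iff
proof (intro allI impI)
  fix a assume a: "rzero_free upper \<kappa> a"
  define approx where "approx i c B \<longleftrightarrow> (\<forall>n::nat. c n \<noteq> (0::real)) \<and> (\<forall>n. size (B n) = \<kappa> i) \<and>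
     (\<forall>n. \<forall>b\<in>#B n. b > 0) \<and>
     (\<forall>k. (\<lambda>n. coeff (smult (c n) (\<Prod>b\<in>#B n. [:b, 1:])) k) \<longlonglongrightarrow> coeff (f i) k)" for i c B
  have "\<exists>c B. approx i c B" for i
  proof -
    have rz: "real_zeros_only (f i)" using f by (simp add: real_zero_factors_def)
    have neg_i: "x \<le> 0" if "poly (f i) x = 0" for x using neg that by blast
    obtain c B where "\<And>n::nat. c n \<noteq> 0" "\<And>n. size (B n) = \<kappa> i" "\<And>n b. b \<in># B n \<Longrightarrow> b > 0"
      "\<And>k. (\<lambda>n. coeff (smult (c n) (\<Prod>b\<in>#B n. [:b, 1:])) k) \<longlonglongrightarrow> coeff (f i) k"
      using nonpos_zeros_approx[OF rz neg_i real_zero_factors_degree[OF f, of i]] by blast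
    then have "approx i c B" by (simp add: approx_def)
    then show ?thesis by blast
  qed
  then obtain c B where "\<And>i. approx i (c i) (B i)" by metis
  then have cB: "\<And>i n. c i n \<noteq> (0::real)" "\<And>i n. size (B i n) = \<kappa> i" "\<And>i n b. b \<in># B i n \<Longrightarrow> b > 0"
     "\<And>i k. (\<lambda>n::nat. coeff (smult (c i n) (\<Prod>b\<in>#B i n. [:b, 1:])) k) \<longlonglongrightarrow> coeff (f i) k"
    unfolding approx_def by blast+
  let ?C = "\<lambda>n \<alpha>. of_real (\<Prod>i\<in>UNIV. coeff (smult (c i n) (\<Prod>b\<in>#B i n. [:b, 1:])) (\<alpha> i) / real (\<kappa> i choose \<alpha> i)) * complex_of_real (a \<alpha>)"
  have lim: "(\<lambda>n. ?C n \<alpha>) \<longlonglongrightarrow> of_real (l \<alpha> * a \<alpha>)" if \<alpha>: "\<alpha> \<in> exps \<kappa>" for \<alpha>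
  proof -
    have "(\<lambda>n. ?C n \<alpha>) \<longlonglongrightarrow> of_real (\<Prod>i\<in>UNIV. coeff (f i) (\<alpha> i) / real (\<kappa> i choose \<alpha> i)) * of_real (a \<alpha>)"
      by (intro tendsto_intros cB(4) real_binomial_nonzero[OF \<alpha>])
    moreover have "(\<Prod>i\<in>UNIV. coeff (f i) (\<alpha> i) / real (\<kappa> i choose \<alpha> i)) = l \<alpha>"
      using \<alpha> f symb_div_binomial[OF \<alpha>, of l] by (simp add: prod_dividef real_zero_factors_def)
    ultimately show ?thesis by simp
  qed
  show "rzero_free upper \<kappa> (\<lambda>\<alpha>. l \<alpha> * a \<alpha>) \<or> (\<forall>\<alpha>\<in>exps \<kappa>. l \<alpha> * a \<alpha> = 0)"
  proof (rule disjCI)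
    assume "\<not> (\<forall>\<alpha>\<in>exps \<kappa>. l \<alpha> * a \<alpha> = 0)"
    then have nz: "\<exists>\<alpha>\<in>exps \<kappa>. complex_of_real (l \<alpha> * a \<alpha>) \<noteq> 0" by auto
    show "rzero_free upper \<kappa> (\<lambda>\<alpha>. l \<alpha> * a \<alpha>)"
    proof (rule hurwitz_peval[OF lim _ nz])
      show "zero_free upper \<kappa> (?C n)" for n
        by (rule szego_all_variables[OF a cB(2) cB(3) cB(1)])
    qed
  qed
qed

text \<open>The sign of the monomial with exponent \<open>\<alpha>\<close> under \<open>x \<mapsto> -x\<close>.\<close>

definition altern :: "('n::finite \<Rightarrow> nat) \<Rightarrow> real"
  where "altern \<alpha> = (\<Prod>i\<in>UNIV. (-1) ^ \<alpha> i)"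

lemma altern_square [simp]: "altern \<alpha> * (altern \<alpha> * x) = x"
  by (simp add: altern_def mult.assoc[symmetric] prod.distrib[symmetric] power_mult_distrib[symmetric])

lemma mon_of_altern: "complex_of_real (altern \<alpha>) * mon x \<alpha> = mon (\<lambda>i. - x i) \<alpha>"
proof -
  have "mon (\<lambda>i. (-1) * x i) \<alpha> = mon (\<lambda>_. -1) \<alpha> * mon x \<alpha>" by (rule mon_mult)
  then show ?thesis by (simp add: altern_def mon_def)
qed

text \<open>Real coefficients make the zeros symmetric under conjugation, so a polynomial that is zero-free on
the upper half-plane is zero-free on the lower one.\<close>

lemma zero_free_upper_altern:
  fixes \<kappa> :: "'n::finite \<Rightarrow> nat"
  assumes "rzero_free upper \<kappa> a"
  shows "rzero_free upper \<kappa> (\<lambda>\<alpha>. altern \<alpha> * a \<alpha>)"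
  unfolding zero_free_def
proof (intro allI impI)
  fix x :: "'n \<Rightarrow> complex" assume x: "\<forall>i. x i \<in> upper"
  have "peval \<kappa> (\<lambda>\<alpha>. of_real (altern \<alpha> * a \<alpha>)) x = (\<Sum>\<alpha>\<in>exps \<kappa>. of_real (a \<alpha>) * mon (\<lambda>i. - x i) \<alpha>)"
    unfolding peval_def by (intro sum.cong refl) (simp add: mon_of_altern[symmetric])
  also have "\<dots> = cnj (rpeval \<kappa> a (\<lambda>i. - cnj (x i)))"
    by (simp add: peval_def mon_def)
  finally show "peval \<kappa> (\<lambda>\<alpha>. of_real (altern \<alpha> * a \<alpha>)) x \<noteq> 0"
    using assms x by (simp add: zero_free_def)
qed

lemma multiplier_seq_altern:
  assumes "multiplier_seq \<kappa> (\<lambda>\<alpha>. altern \<alpha> * l \<alpha>)"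
  shows "multiplier_seq \<kappa> l"
  unfolding multiplier_seq_iff
proof (intro allI impI)
  fix a assume a: "rzero_free upper \<kappa> a"
  have eq: "altern \<alpha> * l \<alpha> * (altern \<alpha> * a \<alpha>) = l \<alpha> * a \<alpha>" for \<alpha>
    using altern_square[of \<alpha> "l \<alpha> * a \<alpha>"] by (simp only: mult_ac)
  show "rzero_free upper \<kappa> (\<lambda>\<alpha>. l \<alpha> * a \<alpha>) \<or> (\<forall>\<alpha>\<in>exps \<kappa>. l \<alpha> * a \<alpha> = 0)"
    using assms[unfolded multiplier_seq_iff, rule_format, OF zero_free_upper_altern[OF a]]
    unfolding eq .
qed

lemma factors_imp_multiplier:
  fixes \<kappa> :: "'n::finite \<Rightarrow> nat"
  assumes f: "real_zero_factors f \<kappa> (symb \<kappa> l)"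
  shows "multiplier_seq \<kappa> l"
proof (cases "\<forall>i x. poly (f i) x = 0 \<longrightarrow> x \<le> 0")
  case True
  then show ?thesis using nonpos_factors_imp_multiplier[OF f] by blast
next
  case False
  then have pos: "\<And>i x. poly (f i) x = 0 \<Longrightarrow> x \<ge> 0"
    using f by (auto simp: real_zero_factors_def zeros_same_sign_def)
  have "(\<lambda>\<alpha>. (\<Prod>i\<in>UNIV. (-1) ^ \<alpha> i) * symb \<kappa> l \<alpha>) = symb \<kappa> (\<lambda>\<alpha>. altern \<alpha> * l \<alpha>)"
    by (simp add: symb_def altern_def fun_eq_iff mult_ac)
  then have "real_zero_factors (\<lambda>i. pcompose (f i) [:0, -1:]) \<kappa> (symb \<kappa> (\<lambda>\<alpha>. altern \<alpha> * l \<alpha>))"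
    using real_zero_factors_reflect[OF f] by simp
  then have "multiplier_seq \<kappa> (\<lambda>\<alpha>. altern \<alpha> * l \<alpha>)"
  proof (rule nonpos_factors_imp_multiplier)
    show "x \<le> 0" if "poly (pcompose (f i) [:0, -1:]) x = 0" for i x
      using pos[of i "- x"] that by (simp add: poly_pcompose)
  qed
  then show ?thesis by (rule multiplier_seq_altern)
qed

section \<open>What test polynomials reveal about a multiplier sequence\<close>

lemma ueval_binomial:
  "ueval k (\<lambda>j. of_nat (k choose j) * s ^ j) w = (1 + of_real s * w) ^ k"
proof -
  have "(1 + of_real s * w) ^ k = (of_real s * w + 1) ^ k" by (simp add: add.commute)
  also have "\<dots> = ueval k (\<lambda>j. of_nat (k choose j) * s ^ j) w"
    by (simp add: ueval_def binomial_ring power_mult_distrib mult_ac)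
  finally show ?thesis ..
qed

text \<open>Let \<open>s\<^sub>i\<close> be the sign of the imaginary part of \<open>x\<^sub>i\<close>. The polynomial
\<open>\<Prod>(1 + s\<^sub>i y\<^sub>i)\<^bsup>\<kappa>\<^sub>i\<^esup>\<close> is real stable, and its image under the operator, evaluated at
\<open>y\<^sub>i = s\<^sub>i x\<^sub>i\<close> in the upper half-plane, is the value at \<open>x\<close> in question.\<close>

lemma multiplier_symb_zero_free:
  fixes \<kappa> :: "'n::finite \<Rightarrow> nat"
  assumes ms: "multiplier_seq \<kappa> l" and nz: "\<exists>\<alpha>\<in>exps \<kappa>. l \<alpha> \<noteq> 0"
  shows "rzero_free (- \<real>) \<kappa> (symb \<kappa> l)"
  unfolding zero_free_def
proof (intro allI impI)
  fix x :: "'n \<Rightarrow> complex" assume x: "\<forall>i. x i \<in> - \<real>"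
  define s where "s i = sgn (Im (x i))" for i
  have s: "s i = 1 \<or> s i = -1" for i
    using x[rule_format, of i] by (auto simp: s_def complex_is_Real_iff sgn_if)
  define y where "y i = of_real (s i) * x i" for i
  have y: "y i \<in> upper" for i
    using x[rule_format, of i] by (auto simp: y_def s_def complex_is_Real_iff sgn_if)
  define a where "a \<alpha> = (\<Prod>i\<in>UNIV. of_nat (\<kappa> i choose \<alpha> i) * s i ^ \<alpha> i)" for \<alpha>
  have "rzero_free upper \<kappa> a"
    unfolding zero_free_def
  proof (intro allI impI)
    fix z :: "'n \<Rightarrow> complex" assume z: "\<forall>i. z i \<in> upper"
    have "1 + of_real (s i) * z i \<noteq> 0" for i
    proof
      assume "1 + of_real (s i) * z i = 0"
      then have "Im (1 + of_real (s i) * z i) = 0" by simp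
      then show False using z s[of i] by (auto dest: spec[of _ i])
    qed
    then show "rpeval \<kappa> a z \<noteq> 0"
      unfolding a_def rpeval_prod[of \<kappa> "\<lambda>i k. of_nat (\<kappa> i choose k) * s i ^ k"] ueval_binomial by simp
  qed
  then have "rzero_free upper \<kappa> (\<lambda>\<alpha>. l \<alpha> * a \<alpha>) \<or> (\<forall>\<alpha>\<in>exps \<kappa>. l \<alpha> * a \<alpha> = 0)"
    using ms by (simp only: multiplier_seq_iff)
  moreover have "a \<alpha> \<noteq> 0" if "\<alpha> \<in> exps \<kappa>" for \<alpha>
  proof -
    have "real (\<kappa> i choose \<alpha> i) * s i ^ \<alpha> i \<noteq> 0" for i
      using real_binomial_nonzero[OF that] s[of i] by auto
    then show ?thesis by (simp add: a_def)
  qed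
  ultimately have "rzero_free upper \<kappa> (\<lambda>\<alpha>. l \<alpha> * a \<alpha>)" using nz by auto
  then have "rpeval \<kappa> (\<lambda>\<alpha>. l \<alpha> * a \<alpha>) y \<noteq> 0" using y by (simp add: zero_free_def)
  also have "rpeval \<kappa> (\<lambda>\<alpha>. l \<alpha> * a \<alpha>) y = rpeval \<kappa> (symb \<kappa> l) x"
    unfolding peval_def
  proof (intro sum.cong refl)
    fix \<alpha>
    have "of_real (s i) * (of_real (s i) * z) = z" for i and z :: complex using s[of i] by auto
    then have "x = (\<lambda>i. of_real (s i) * y i)" by (simp add: y_def fun_eq_iff)
    then have "mon x \<alpha> = mon (\<lambda>i. of_real (s i)) \<alpha> * mon y \<alpha>" by (simp only: mon_mult)
    then show "of_real (l \<alpha> * a \<alpha>) * mon y \<alpha> = of_real (symb \<kappa> l \<alpha>) * mon x \<alpha>"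
      by (simp add: symb_def a_def mon_def of_real_prod prod.distrib mult_ac)
  qed
  finally show "rpeval \<kappa> (symb \<kappa> l) x \<noteq> 0" .
qed

text \<open>The polynomial \<open>x\<^sup>\<alpha>(1 - x\<^sub>i x\<^sub>j)\<close> is real stable. Its image is
\<open>x\<^sup>\<alpha>(l(\<alpha>) - l(\<beta>) x\<^sub>i x\<^sub>j)\<close>, which for values of opposite sign vanishes when all
variables equal a suitable positive multiple of the imaginary unit.\<close>

lemma multiplier_second_neighbour_sign:
  fixes \<kappa> :: "'n::finite \<Rightarrow> nat"
  assumes ms: "multiplier_seq \<kappa> l" and \<beta>: "\<beta> = (\<lambda>p. \<alpha> p + of_bool (p = i) + of_bool (p = j))" "\<beta> \<in> exps \<kappa>"
  shows "l \<alpha> * l \<beta> \<ge> 0"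
proof (rule ccontr)
  assume "\<not> l \<alpha> * l \<beta> \<ge> 0"
  then have neg: "l \<alpha> * l \<beta> < 0" by simp
  have \<alpha>: "\<alpha> \<in> exps \<kappa>"
    unfolding exps_iff
  proof
    fix p show "\<alpha> p \<le> \<kappa> p" using \<beta>(2)[unfolded exps_iff, rule_format, of p] by (simp add: \<beta>(1))
  qed
  have "\<beta> i \<noteq> \<alpha> i" by (simp add: \<beta>(1))
  then have ne: "\<alpha> \<noteq> \<beta>" by auto
  define a where "a \<gamma> = (if \<gamma> = \<alpha> then 1 else if \<gamma> = \<beta> then -1 else (0::real))" for \<gamma>
  have mon\<beta>: "mon x \<beta> = mon x \<alpha> * (x i * x j)" for x :: "'n \<Rightarrow> complex"
  proof -
    have "mon x \<beta> = (\<Prod>p\<in>UNIV. x p ^ \<alpha> p * ((if p = i then x p else 1) * (if p = j then x p else 1)))"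
      unfolding mon_def \<beta>(1) by (intro prod.cong refl) (auto simp: power_add)
    also have "\<dots> = mon x \<alpha> * (x i * x j)"
      by (simp add: mon_def prod.distrib prod.delta)
    finally show ?thesis .
  qed
  have ev: "rpeval \<kappa> (\<lambda>\<gamma>. m \<gamma> * a \<gamma>) x = mon x \<alpha> * (of_real (m \<alpha>) - of_real (m \<beta>) * (x i * x j))" for m x
  proof -
    have "rpeval \<kappa> (\<lambda>\<gamma>. m \<gamma> * a \<gamma>) x =
      (\<Sum>\<gamma>\<in>exps \<kappa>. (if \<gamma> = \<alpha> then of_real (m \<alpha>) * mon x \<alpha> else 0) + (if \<gamma> = \<beta> then - of_real (m \<beta>) * mon x \<beta> else 0))"
      unfolding peval_def using ne by (intro sum.cong refl) (auto simp: a_def)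
    also have "\<dots> = of_real (m \<alpha>) * mon x \<alpha> - of_real (m \<beta>) * mon x \<beta>"
      using \<alpha> \<beta>(2) by (simp add: sum.distrib sum.delta)
    finally show ?thesis by (simp add: mon\<beta> algebra_simps)
  qed
  have mon_nz: "mon x \<alpha> \<noteq> 0" if "\<forall>i. x i \<in> upper" for x :: "'n \<Rightarrow> complex"
  proof -
    have "x p \<noteq> 0" for p using that[rule_format, of p] by auto
    then show ?thesis by (simp add: mon_def)
  qed
  have "rzero_free upper \<kappa> a"
    unfolding zero_free_def
  proof (intro allI impI)
    fix x :: "'n \<Rightarrow> complex" assume x: "\<forall>i. x i \<in> upper"
    have "x i * x j \<noteq> 1"
    proof
      assume "x i * x j = 1"
      then have "x j = inverse (x i)" by (metis inverse_unique)
      moreover have "Im (inverse (x i)) \<le> 0"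
        using x[rule_format, of i] by (simp add: divide_nonpos_nonneg)
      ultimately show False using x[rule_format, of j] by simp
    qed
    then show "rpeval \<kappa> a x \<noteq> 0"
      using ev[of "\<lambda>_. 1" x] mon_nz[OF x] by simp
  qed
  then have "rzero_free upper \<kappa> (\<lambda>\<alpha>. l \<alpha> * a \<alpha>) \<or> (\<forall>\<alpha>\<in>exps \<kappa>. l \<alpha> * a \<alpha> = 0)"
    using ms by (simp only: multiplier_seq_iff)
  moreover have "l \<alpha> * a \<alpha> \<noteq> 0" using neg by (auto simp: a_def)
  ultimately have zf: "rzero_free upper \<kappa> (\<lambda>\<alpha>. l \<alpha> * a \<alpha>)" using \<alpha> by blast
  define r where "r = sqrt (- l \<alpha> / l \<beta>)"
  have "- l \<alpha> / l \<beta> > 0" using neg by (auto simp: mult_less_0_iff divide_less_0_iff zero_less_divide_iff)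
  then have r: "r > 0" "r\<^sup>2 = - l \<alpha> / l \<beta>" by (auto simp: r_def)
  have "l \<beta> \<noteq> 0" using neg by auto
  then have "l \<alpha> + l \<beta> * r\<^sup>2 = 0" using r by simp
  moreover have "complex_of_real (l \<alpha>) - of_real (l \<beta>) * ((\<i> * of_real r) * (\<i> * of_real r)) = of_real (l \<alpha> + l \<beta> * r\<^sup>2)"
    by (simp add: power2_eq_square algebra_simps)
  ultimately have "complex_of_real (l \<alpha>) - of_real (l \<beta>) * ((\<i> * of_real r) * (\<i> * of_real r)) = 0"
    by (simp only: of_real_0)
  then have "rpeval \<kappa> (\<lambda>\<alpha>. l \<alpha> * a \<alpha>) (\<lambda>_. \<i> * of_real r) = 0" by (simp only: ev mult_zero_right)
  then show False using zf[unfolded zero_free_def, rule_format, of "\<lambda>_. \<i> * of_real r"] r(1) by simp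
qed

lemma ex_upper_root_of_negative:
  assumes "N \<ge> 2" "\<rho> > (0::real)"
  shows "\<exists>w. Im w > 0 \<and> w ^ N = - complex_of_real \<rho>"
proof (intro exI conjI)
  let ?w = "of_real (root N \<rho>) * cis (pi / N)"
  have "pi / N < pi" "pi / N > 0" using assms by (auto simp: divide_less_eq)
  then have "sin (pi / N) > 0" by (simp add: sin_gt_zero)
  then show "Im ?w > 0" using assms by (simp add: mult_pos_pos)
  have "cis (pi / N) ^ N = -1" using assms by (simp add: Complex.DeMoivre)
  moreover have "complex_of_real (root N \<rho>) ^ N = of_real \<rho>"
    using assms by (simp flip: of_real_power)
  ultimately show "?w ^ N = - complex_of_real \<rho>" by (simp add: power_mult_distrib)
qed

text \<open>Otherwise only the two outer terms of \<open>x\<^sup>p(1 + x)\<^bsup>N-1\<^esup>(1 + \<sigma> x)\<close> survive the operator. The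
sign \<open>\<sigma>\<close> is chosen such that the image is, up to a factor, \<open>x\<^sup>p(\<rho> + x\<^sup>N)\<close> with \<open>\<rho> > 0\<close>;
for \<open>N \<ge> 2\<close> this has a zero in the upper half-plane.\<close>

lemma multiplier_seq1_ex_between:
  assumes ms: "multiplier_seq1 k M" and pq: "p + 2 \<le> q" "q \<le> k" and nz: "M p \<noteq> 0" "M q \<noteq> 0"
  shows "\<exists>c. p < c \<and> c < q \<and> M c \<noteq> 0"
proof (rule ccontr)
  assume no: "\<not> ?thesis"
  define N where "N = q - p"
  have N: "N \<ge> 2" "q = p + N" using pq by (auto simp: N_def)
  define \<sigma> where "\<sigma> = sgn (M p * M q)"
  have \<sigma>: "\<sigma> = 1 \<or> \<sigma> = -1" using nz by (auto simp: \<sigma>_def sgn_if)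
  define H where "H = [:1, 1:] ^ (N - 1) * [:1, \<sigma>:]"
  define G where "G = monom 1 p * H"
  have "degree H = N"
    using \<sigma> N by (auto simp: H_def degree_mult_eq degree_power_eq simp del: mult_pCons_right)
  moreover have "lead_coeff H = \<sigma>"
    unfolding H_def lead_coeff_mult lead_coeff_power using \<sigma> by auto
  ultimately have H: "degree H = N" "coeff H N = \<sigma>" by auto
  have H0: "coeff H 0 = 1" unfolding H_def poly_0_coeff_0[symmetric] by (simp del: mult_pCons_right)
  have cG: "coeff G j = (if j < p then 0 else coeff H (j - p))" for j
    by (simp add: G_def coeff_monom_mult)
  have dG: "degree G \<le> k"
    using H pq N unfolding G_def by (intro order_trans[OF degree_mult_le]) (simp add: degree_monom_eq)
  have "ueval k (coeff G) w \<noteq> 0" if w: "Im w > 0" for w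
  proof -
    have "map_poly complex_of_real G = monom 1 p * ([:1, 1:] ^ (N - 1) * [:1, of_real \<sigma>:])"
    proof -
      have c: "map_poly complex_of_real (u * v) = map_poly of_real u * map_poly of_real v" for u v
        by (rule poly_eqI) (simp add: coeff_map_poly coeff_mult)
      have "map_poly complex_of_real (u ^ n) = map_poly of_real u ^ n" for u n
        by (induction n) (simp_all add: c)
      then show ?thesis by (simp add: G_def H_def c map_poly_monom map_poly_pCons del: mult_pCons_right)
    qed
    then have "ueval k (coeff G) w = w ^ p * ((1 + w) ^ (N - 1) * (1 + of_real \<sigma> * w))"
      by (simp add: ueval_coeff[OF dG] poly_monom poly_power algebra_simps)
    moreover have "w \<noteq> 0" "1 + w \<noteq> 0" "1 + of_real \<sigma> * w \<noteq> 0"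
      using w \<sigma> by (auto simp: complex_eq_iff)
    ultimately show ?thesis by simp
  qed
  then have "(\<forall>w. Im w > 0 \<longrightarrow> ueval k (\<lambda>j. M j * coeff G j) w \<noteq> 0) \<or> (\<forall>j\<le>k. M j * coeff G j = 0)"
    using ms by (simp add: multiplier_seq1_iff)
  moreover have "M p * coeff G p \<noteq> 0" "p \<le> k" using nz pq by (auto simp: cG H0)
  ultimately have nv: "\<And>w. Im w > 0 \<Longrightarrow> ueval k (\<lambda>j. M j * coeff G j) w \<noteq> 0" by blast
  have ev: "ueval k (\<lambda>j. M j * coeff G j) w = w ^ p * (of_real (M p) + of_real (\<sigma> * M q) * w ^ N)" for w
  proof -
    have "ueval k (\<lambda>j. M j * coeff G j) w = (\<Sum>j\<in>{p, q}. of_real (M j * coeff G j) * w ^ j)"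
      unfolding ueval_def
    proof (rule sum.mono_neutral_right)
      show "\<forall>j\<in>{..k} - {p, q}. complex_of_real (M j * coeff G j) * w ^ j = 0"
      proof
        fix j assume "j \<in> {..k} - {p, q}"
        then consider "j < p" | "p < j" "j < q" | "j > q" by fastforce
        then show "complex_of_real (M j * coeff G j) * w ^ j = 0"
        proof cases
          case 3
          then show ?thesis using N H by (simp add: cG coeff_eq_0)
        qed (use no in \<open>auto simp: cG\<close>)
      qed
    qed (use pq in auto)
    also have "\<dots> = of_real (M p) * w ^ p + of_real (\<sigma> * M q) * w ^ q"
      using N H by (simp add: cG H0 mult.commute)
    finally show ?thesis using N by (simp add: power_add algebra_simps)
  qed
  have pos: "M p / (\<sigma> * M q) > 0"
    using nz by (auto simp: \<sigma>_def sgn_if zero_less_divide_iff mult_less_0_iff zero_less_mult_iff)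
  obtain w where w: "Im w > 0" "w ^ N = - complex_of_real (M p / (\<sigma> * M q))"
    using ex_upper_root_of_negative[OF N(1) pos] by blast
  have "complex_of_real (M p) + of_real (\<sigma> * M q) * w ^ N = 0"
    unfolding w(2) using nz \<sigma> by auto
  then show False using nv[OF w(1)] ev[of w] by simp
qed

definition no_gaps :: "nat \<Rightarrow> (nat \<Rightarrow> real) \<Rightarrow> bool"
  where "no_gaps k M \<longleftrightarrow> (\<forall>p c q. p \<le> c \<longrightarrow> c \<le> q \<longrightarrow> q \<le> k \<longrightarrow> M p \<noteq> 0 \<longrightarrow> M q \<noteq> 0 \<longrightarrow> M c \<noteq> 0)"

lemma multiplier_seq1_no_gaps:
  assumes ms: "multiplier_seq1 k M"
  shows "no_gaps k M"
proof -
  have "M c \<noteq> 0" if "p \<le> c" "c \<le> q" "q \<le> k" "M p \<noteq> 0" "M q \<noteq> 0" for p c q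
    using that
  proof (induction "q - p" arbitrary: p q rule: less_induct)
    case less
    show ?case
    proof (cases "c = p \<or> c = q")
      case False
      then have "p + 2 \<le> q" using less.prems by linarith
      then obtain d where d: "p < d" "d < q" "M d \<noteq> 0"
        using multiplier_seq1_ex_between[OF ms] less.prems by blast
      show ?thesis
      proof (cases "c \<le> d")
        case True
        then show ?thesis using less.hyps[of d p] less.prems d by auto
      next
        case False
        then show ?thesis using less.hyps[of q d] less.prems d by auto
      qed
    qed (use less.prems in auto)
  qed
  then show ?thesis unfolding no_gaps_def by blast
qed

text \<open>Signs propagate from \<open>k0\<close> in both directions, since a nonzero term is joined to \<open>M k0\<close> by nonzero
terms.\<close>

lemma nonneg_if_no_gaps:
  assumes ng: "no_gaps k M" and adj: "\<And>j. j < k \<Longrightarrow> M j * M (Suc j) \<ge> 0"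
    and k0: "k0 \<le> k" "M k0 > 0" and j: "j \<le> k"
  shows "M j \<ge> 0"
proof (cases "k0 \<le> j")
  case True
  then show ?thesis using j
  proof (induction j rule: dec_induct)
    case (step n)
    show ?case
    proof (cases "M (Suc n) = 0")
      case False
      then have "M n \<noteq> 0" using ng step k0 unfolding no_gaps_def by (metis le_SucI less_imp_neq order_refl less_imp_le)
      then have "M n > 0" using step by simp
      moreover have "M n * M (Suc n) \<ge> 0" using adj step by simp
      ultimately show ?thesis by (simp add: zero_le_mult_iff)
    qed simp
  qed (use k0 in simp)
next
  case False
  then have "j \<le> k0" by simp
  then show ?thesis
  proof (induction rule: inc_induct)
    case (step n)
    show ?case
    proof (cases "M n = 0")
      case False
      then have "M (Suc n) \<noteq> 0" using ng step k0 unfolding no_gaps_def by (metis Suc_leI le_SucI less_imp_neq order_refl)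
      then have "M (Suc n) > 0" using step by simp
      moreover have "M n * M (Suc n) \<ge> 0" using adj step k0 by simp
      ultimately show ?thesis by (simp add: zero_le_mult_iff)
    qed simp
  qed (use k0 in simp)
qed

lemma ueval_delta: "c \<le> k \<Longrightarrow> ueval k (\<lambda>m. of_bool (m = c)) w = w ^ c"
  by (simp add: ueval_def of_bool_def if_distrib[of complex_of_real] if_distrib[of "\<lambda>u. u * _"] sum.delta cong: if_cong)

text \<open>A univariate test polynomial in \<open>x\<^sub>i\<close> is multiplied by the monomial with exponents \<open>\<alpha>0\<close> in the other
variables.\<close>

lemma multiplier_seq_restrict:
  fixes \<kappa> :: "'n::finite \<Rightarrow> nat"
  assumes ms: "multiplier_seq \<kappa> l" and \<alpha>0: "\<alpha>0 \<in> exps \<kappa>"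
  shows "multiplier_seq1 (\<kappa> i) (\<lambda>k. l (\<alpha>0(i := k)))"
  unfolding multiplier_seq1_iff
proof (intro allI impI)
  fix a :: "nat \<Rightarrow> real"
  assume a: "\<forall>w. Im w > 0 \<longrightarrow> ueval (\<kappa> i) a w \<noteq> 0"
  define E where "E b \<alpha> = (\<Prod>j\<in>UNIV. (if j = i then b else (\<lambda>m. of_bool (m = \<alpha>0 j))) (\<alpha> j))" for b :: "nat \<Rightarrow> real" and \<alpha>
  have E_eval: "E b (\<alpha>0(i := k)) = b k" for b k
  proof -
    have "E b (\<alpha>0(i := k)) = (\<Prod>j\<in>UNIV. if j = i then b k else 1)"
      unfolding E_def by (intro prod.cong) auto
    then show ?thesis by simp
  qed
  have E_0: "E b \<alpha> = 0" if ne: "\<alpha> \<noteq> \<alpha>0(i := \<alpha> i)" for b \<alpha>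
  proof -
    obtain j where "j \<noteq> i" "\<alpha> j \<noteq> \<alpha>0 j" using ne by (auto simp: fun_eq_iff split: if_splits)
    then show ?thesis unfolding E_def by (intro prod_zero) (auto intro!: bexI[of _ j])
  qed
  have lE: "l \<alpha> * E a \<alpha> = E (\<lambda>k. l (\<alpha>0(i := k)) * a k) \<alpha>" for \<alpha>
  proof (cases "\<alpha> = \<alpha>0(i := \<alpha> i)")
    case True
    then show ?thesis using E_eval by metis
  qed (simp add: E_0)
  have ev: "rpeval \<kappa> (E b) x = ueval (\<kappa> i) b (x i) * (\<Prod>j\<in>UNIV - {i}. x j ^ \<alpha>0 j)" for b x
  proof -
    have "rpeval \<kappa> (E b) x = (\<Prod>j\<in>UNIV. ueval (\<kappa> j) (if j = i then b else (\<lambda>m. of_bool (m = \<alpha>0 j))) (x j))"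
      unfolding E_def by (rule rpeval_prod)
    also have "\<dots> = ueval (\<kappa> i) b (x i) * (\<Prod>j\<in>UNIV - {i}. ueval (\<kappa> j) (if j = i then b else (\<lambda>m. of_bool (m = \<alpha>0 j))) (x j))"
      by (subst prod.remove[of _ i]) auto
    also have "(\<Prod>j\<in>UNIV - {i}. ueval (\<kappa> j) (if j = i then b else (\<lambda>m. of_bool (m = \<alpha>0 j))) (x j)) = (\<Prod>j\<in>UNIV - {i}. x j ^ \<alpha>0 j)"
      using \<alpha>0 by (intro prod.cong) (auto simp: ueval_delta exps_iff)
    finally show ?thesis .
  qed
  have "rzero_free upper \<kappa> (E a)"
    unfolding zero_free_def
  proof (intro allI impI)
    fix x :: "'n \<Rightarrow> complex" assume x: "\<forall>i. x i \<in> upper"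
    have "x p \<noteq> 0" for p using x[rule_format, of p] by auto
    then show "rpeval \<kappa> (E a) x \<noteq> 0" using a x by (simp add: ev)
  qed
  then have "rzero_free upper \<kappa> (\<lambda>\<alpha>. l \<alpha> * E a \<alpha>) \<or> (\<forall>\<alpha>\<in>exps \<kappa>. l \<alpha> * E a \<alpha> = 0)"
    using ms by (simp only: multiplier_seq_iff)
  then show "(\<forall>w. Im w > 0 \<longrightarrow> ueval (\<kappa> i) (\<lambda>k. l (\<alpha>0(i := k)) * a k) w \<noteq> 0) \<or> (\<forall>k\<le>\<kappa> i. l (\<alpha>0(i := k)) * a k = 0)"
  proof
    assume zf: "rzero_free upper \<kappa> (\<lambda>\<alpha>. l \<alpha> * E a \<alpha>)"
    have "ueval (\<kappa> i) (\<lambda>k. l (\<alpha>0(i := k)) * a k) w \<noteq> 0" if "Im w > 0" for w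
      using zf[unfolded zero_free_def, rule_format, of "\<lambda>_. w"] that unfolding lE ev by auto
    then show ?thesis by blast
  next
    assume *: "\<forall>\<alpha>\<in>exps \<kappa>. l \<alpha> * E a \<alpha> = 0"
    have "l (\<alpha>0(i := k)) * a k = 0" if "k \<le> \<kappa> i" for k
    proof -
      have "\<alpha>0(i := k) \<in> exps \<kappa>" using \<alpha>0 that by (auto simp: exps_iff)
      with * have "l (\<alpha>0(i := k)) * E a (\<alpha>0(i := k)) = 0" by blast
      then show ?thesis unfolding E_eval .
    qed
    then show ?thesis by blast
  qed
qed

lemma multiplier_seq1_scale:
  assumes "multiplier_seq1 k L" "c \<noteq> 0"
  shows "multiplier_seq1 k (\<lambda>j. c * L j)"
proof -
  have "ueval k (\<lambda>j. c * L j * a j) w = of_real c * ueval k (\<lambda>j. L j * a j) w" for a w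
    by (simp add: ueval_def sum_distrib_left mult_ac)
  then show ?thesis using assms by (simp add: multiplier_seq1_iff)
qed

text \<open>The factorization of \<open>P\<close> and the product form of the binomial coefficients make \<open>l\<close> itself a
product; the factors are then normalized to 1 at \<open>\<alpha>0\<close>.\<close>

lemma multiplier_normal_form:
  fixes \<kappa> :: "'n::finite \<Rightarrow> nat"
  assumes ms: "multiplier_seq \<kappa> l" and \<alpha>0: "\<alpha>0 \<in> exps \<kappa>" "l \<alpha>0 \<noteq> 0" and \<alpha>: "\<alpha> \<in> exps \<kappa>"
  shows "l \<alpha> = l \<alpha>0 * (\<Prod>i\<in>UNIV. l (\<alpha>0(i := \<alpha> i)) / l \<alpha>0)"
proof -
  have zf: "rzero_free (- \<real>) \<kappa> (symb \<kappa> l)"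
    using multiplier_symb_zero_free[OF ms] \<alpha>0 by blast
  have bin: "real (\<kappa> i choose \<gamma> i) \<noteq> 0" if "\<gamma> \<in> exps \<kappa>" for \<gamma> i
    by (rule real_binomial_nonzero[OF that])
  define c where "c = symb \<kappa> l \<alpha>0"
  have c: "c \<noteq> 0" using bin[OF \<alpha>0(1)] \<alpha>0(2) by (simp add: c_def symb_def)
  \<comment> \<open>The normalization at \<open>\<alpha>0\<close> cancels in the ratios below, so any product form of \<open>l\<close> will do.\<close>
  define h where "h i k = symb \<kappa> l (\<alpha>0(i := k)) / c / real (\<kappa> i choose k)" for i k
  have lh: "l \<gamma> = c * (\<Prod>i\<in>UNIV. h i (\<gamma> i))" if \<gamma>: "\<gamma> \<in> exps \<kappa>" for \<gamma>
  proof -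
    have "l \<gamma> = symb \<kappa> l \<gamma> / (\<Prod>i\<in>UNIV. real (\<kappa> i choose \<gamma> i))"
      by (rule symb_div_binomial[OF \<gamma>, symmetric])
    also have "symb \<kappa> l \<gamma> = c * (\<Prod>i\<in>UNIV. symb \<kappa> l (\<alpha>0(i := \<gamma> i)) / c)"
      unfolding c_def by (rule rcoeffs_factor[OF zf \<alpha>0(1) _ \<gamma>]) (use c in \<open>simp add: c_def\<close>)
    also have "\<dots> / (\<Prod>i\<in>UNIV. real (\<kappa> i choose \<gamma> i)) = c * (\<Prod>i\<in>UNIV. h i (\<gamma> i))"
      unfolding h_def by (simp only: prod_dividef times_divide_eq_right)
    finally show ?thesis .
  qed
  have h0: "h i (\<alpha>0 i) \<noteq> 0" for i using \<alpha>0(2) lh[OF \<alpha>0(1)] by auto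
  have "l (\<alpha>0(i := \<alpha> i)) / l \<alpha>0 = h i (\<alpha> i) / h i (\<alpha>0 i)" for i
  proof -
    have m: "\<alpha>0(i := \<alpha> i) \<in> exps \<kappa>" using \<alpha>0 \<alpha> by (auto simp: exps_iff)
    have "l (\<alpha>0(i := \<alpha> i)) = c * (h i (\<alpha> i) * (\<Prod>j\<in>UNIV - {i}. h j (\<alpha>0 j)))"
      unfolding lh[OF m] by (subst prod.remove[of _ i]) (auto intro!: prod.cong)
    moreover have "l \<alpha>0 = c * (h i (\<alpha>0 i) * (\<Prod>j\<in>UNIV - {i}. h j (\<alpha>0 j)))"
      unfolding lh[OF \<alpha>0(1)] by (subst prod.remove[of _ i]) auto
    ultimately show ?thesis using c h0 by simp
  qed
  then have "l \<alpha>0 * (\<Prod>i\<in>UNIV. l (\<alpha>0(i := \<alpha> i)) / l \<alpha>0) = l \<alpha>0 * ((\<Prod>i\<in>UNIV. h i (\<alpha> i)) / (\<Prod>i\<in>UNIV. h i (\<alpha>0 i)))"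
    by (simp add: prod_dividef)
  also have "\<dots> = l \<alpha>" using h0 unfolding lh[OF \<alpha>0(1)] lh[OF \<alpha>] by simp
  finally show ?thesis ..
qed

section \<open>The equivalence\<close>

text \<open>By \<open>diff\<close>, and by \<open>same\<close> within one sequence, the products of neighbouring terms never have opposite
signs, neither within a sequence nor across sequences. If one of them is positive, no sequence
changes sign; otherwise all sequences alternate. The normalization at \<open>\<beta>\<close> fixes the sign.\<close>

lemma nonneg_or_altern:
  fixes M :: "'n \<Rightarrow> nat \<Rightarrow> real"
  assumes ng: "\<And>i. no_gaps (\<kappa> i) (M i)" and base: "\<And>i. \<beta> i \<le> \<kappa> i" "\<And>i. M i (\<beta> i) = 1"
    and same: "\<And>i k. k + 2 \<le> \<kappa> i \<Longrightarrow> M i k * M i (k + 2) \<ge> 0"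
    and diff: "\<And>i j k m. i \<noteq> j \<Longrightarrow> k < \<kappa> i \<Longrightarrow> m < \<kappa> j \<Longrightarrow>
       (M i k * M i (Suc k)) * (M j m * M j (Suc m)) \<ge> 0"
  shows "(\<forall>i. \<forall>k\<le>\<kappa> i. M i k \<ge> 0) \<or> (\<forall>i. alternating_upto (\<kappa> i) (M i))"
proof (cases "\<exists>i k. k < \<kappa> i \<and> M i k * M i (Suc k) > 0")
  case True
  then obtain i k where ik: "k < \<kappa> i" "M i k * M i (Suc k) > 0" by blast
  have D: "M j m * M j (Suc m) \<ge> 0" if m: "m < \<kappa> j" for j m
  proof (cases "j = i")
    case False
    then have "(M i k * M i (Suc k)) * (M j m * M j (Suc m)) \<ge> 0" using False ik(1) m by (intro diff) auto
    then show ?thesis using ik(2) by (simp add: zero_le_mult_iff)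
  next
    case True
    let ?D = "\<lambda>m. M i m * M i (Suc m)"
    \<comment> \<open>The products of neighbours form again a sequence without gaps whose neighbours agree in sign,
      so the propagation lemma applies to them.\<close>
    have ngD: "no_gaps (\<kappa> i - 1) ?D"
      unfolding no_gaps_def
    proof (intro allI impI)
      fix p c q assume h: "p \<le> c" "c \<le> q" "q \<le> \<kappa> i - 1" "?D p \<noteq> 0" "?D q \<noteq> 0"
      have q: "Suc q \<le> \<kappa> i" using h(3) ik(1) by linarith
      have nz: "M i p \<noteq> 0" "M i (Suc q) \<noteq> 0" using h by auto
      have "M i d \<noteq> 0" if d: "p \<le> d" "d \<le> Suc q" for d
        using ng[of i] d q nz unfolding no_gaps_def by blast
      then show "?D c \<noteq> 0" using h(1,2) by simp
    qed
    have adj: "?D d * ?D (Suc d) \<ge> 0" if d: "d < \<kappa> i - 1" for d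
    proof -
      have "?D d * ?D (Suc d) = (M i d * M i (d + 2)) * (M i (Suc d))\<^sup>2"
        by (simp add: power2_eq_square)
      moreover have "M i d * M i (d + 2) \<ge> 0" by (rule same) (use d in simp)
      ultimately show ?thesis by (simp only: mult_nonneg_nonneg zero_le_power2)
    qed
    have "?D m \<ge> 0"
      by (rule nonneg_if_no_gaps[OF ngD adj, of k m]) (use ik m True in auto)
    then show ?thesis using True by simp
  qed
  have "M i k \<ge> 0" if "k \<le> \<kappa> i" for i k
    using nonneg_if_no_gaps[OF ng D base(1) _ that] base(2)[of i] by simp
  then show ?thesis by blast
next
  case False
  have "alternating_upto (\<kappa> i) (M i)" for i
  proof -
    \<comment> \<open>Normalized to be positive at \<open>\<beta> i\<close>.\<close>
    let ?A = "\<lambda>k. (-1) ^ (k + \<beta> i) * M i k"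
    have ngA: "no_gaps (\<kappa> i) ?A" using ng[of i] by (simp add: no_gaps_def)
    have adj: "?A j * ?A (Suc j) \<ge> 0" if j: "j < \<kappa> i" for j
    proof -
      have "(-1::real) ^ (j + \<beta> i) * (-1) ^ (Suc j + \<beta> i) = -1"
        by (simp flip: power_mult_distrib)
      then have "?A j * ?A (Suc j) = - (M i j * M i (Suc j))"
        by (metis mult.assoc mult.left_commute mult_minus1)
      moreover have "M i j * M i (Suc j) \<le> 0" using False j by (meson not_le)
      ultimately show ?thesis by (metis neg_0_le_iff_le)
    qed
    have "?A (\<beta> i) > 0" using base(2)[of i] by (simp flip: mult_2)
    then have pos: "?A k \<ge> 0" if k: "k \<le> \<kappa> i" for k
      by (intro nonneg_if_no_gaps[OF ngA adj base(1) _ k])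
    show ?thesis
    proof (cases "even (\<beta> i)")
      case True
      then show ?thesis using pos by (auto simp: alternating_upto_def power_add)
    next
      case False
      then show ?thesis using pos by (auto simp: alternating_upto_def power_add)
    qed
  qed
  then show ?thesis by blast
qed

text \<open>The sequences are the restrictions of \<open>l\<close> to coordinate lines through a point \<open>\<alpha>0\<close> with
\<open>l \<alpha>0 \<noteq> 0\<close>, divided by \<open>l \<alpha>0\<close>. The modulus of \<open>l \<alpha>0\<close> is given to one arbitrarily chosen
sequence and its sign becomes the sign in front of \<open>l\<close>.\<close>

lemma multiplier_imp_product:
  fixes \<kappa> :: "'n::finite \<Rightarrow> nat"
  assumes ms: "multiplier_seq \<kappa> l" and nz: "\<exists>\<alpha>\<in>exps \<kappa>. l \<alpha> \<noteq> 0"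
  shows "\<exists>s\<in>{1, -1}. \<exists>L :: 'n \<Rightarrow> nat \<Rightarrow> real.
             (\<forall>\<alpha>\<le>\<kappa>. s * l \<alpha> = (\<Prod>i\<in>UNIV. L i (\<alpha> i))) \<and>
             (\<forall>i. multiplier_seq1 (\<kappa> i) (L i)) \<and>
             ((\<forall>i. \<forall>k\<le>\<kappa> i. L i k \<ge> 0) \<or> (\<forall>i. alternating_upto (\<kappa> i) (L i)))"
proof -
  obtain \<alpha>0 where \<alpha>0: "\<alpha>0 \<in> exps \<kappa>" "l \<alpha>0 \<noteq> 0" using nz by blast
  define M where "M i k = l (\<alpha>0(i := k)) / l \<alpha>0" for i k
  have lM: "l \<alpha> = l \<alpha>0 * (\<Prod>i\<in>UNIV. M i (\<alpha> i))" if "\<alpha> \<in> exps \<kappa>" for \<alpha>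
    unfolding M_def by (rule multiplier_normal_form[OF ms \<alpha>0 that])
  have M0: "M i (\<alpha>0 i) = 1" for i using \<alpha>0 by (simp add: M_def)
  have M1: "multiplier_seq1 (\<kappa> i) (M i)" for i
    using multiplier_seq1_scale[OF multiplier_seq_restrict[OF ms \<alpha>0(1), of i], of "1 / l \<alpha>0"] \<alpha>0(2)
    by (simp add: M_def[abs_def])
  have signs: "(\<forall>i. \<forall>k\<le>\<kappa> i. M i k \<ge> 0) \<or> (\<forall>i. alternating_upto (\<kappa> i) (M i))"
  proof (rule nonneg_or_altern[where \<beta>=\<alpha>0])
    show "no_gaps (\<kappa> i) (M i)" for i by (rule multiplier_seq1_no_gaps[OF M1])
    show "\<alpha>0 i \<le> \<kappa> i" for i using \<alpha>0 by (simp add: exps_iff)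
    show "M i (\<alpha>0 i) = 1" for i by (rule M0)
    show "M i k * M i (k + 2) \<ge> 0" if k: "k + 2 \<le> \<kappa> i" for i k
    proof -
      have "\<alpha>0(i := k + 2) \<in> exps \<kappa>" using \<alpha>0 k by (auto simp: exps_iff)
      then have "l (\<alpha>0(i := k)) * l (\<alpha>0(i := k + 2)) \<ge> 0"
        by (intro multiplier_second_neighbour_sign[OF ms, of _ _ i i]) auto
      then have "l (\<alpha>0(i := k)) * l (\<alpha>0(i := k + 2)) / (l \<alpha>0 * l \<alpha>0) \<ge> 0"
        by (rule divide_nonneg_nonneg) simp
      then show ?thesis by (simp add: M_def)
    qed
    show "(M i k * M i (Suc k)) * (M j m * M j (Suc m)) \<ge> 0"
      if ij: "i \<noteq> j" and k: "k < \<kappa> i" and m: "m < \<kappa> j" for i j k m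
    proof -
      have val: "l (\<alpha>0(i := k', j := m')) = l \<alpha>0 * (M i k' * M j m')" if "k' \<le> \<kappa> i" "m' \<le> \<kappa> j" for k' m'
      proof -
        have e: "\<alpha>0(i := k', j := m') \<in> exps \<kappa>" using \<alpha>0 that by (auto simp: exps_iff)
        have "(\<Prod>p\<in>UNIV. M p ((\<alpha>0(i := k', j := m')) p)) =
            (\<Prod>p\<in>UNIV. (if p = i then M i k' else 1) * (if p = j then M j m' else 1))"
          using ij by (intro prod.cong) (auto simp: M0)
        also have "\<dots> = M i k' * M j m'" by (simp add: prod.distrib prod.delta)
        finally show ?thesis unfolding lM[OF e] by simp
      qed
      have e: "\<alpha>0(i := Suc k, j := Suc m) \<in> exps \<kappa>" using \<alpha>0 k m by (auto simp: exps_iff)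
      have "l (\<alpha>0(i := k, j := m)) * l (\<alpha>0(i := Suc k, j := Suc m)) \<ge> 0"
        using e ij by (intro multiplier_second_neighbour_sign[OF ms, of _ _ i j]) auto
      then have "(l \<alpha>0 * l \<alpha>0) * ((M i k * M i (Suc k)) * (M j m * M j (Suc m))) \<ge> 0"
        using val[of k m] val[of "Suc k" "Suc m"] k m by (simp add: mult_ac)
      moreover have "l \<alpha>0 * l \<alpha>0 > 0" using \<alpha>0(2) by (auto simp: zero_less_mult_iff)
      ultimately show ?thesis using mult_le_cancel_left_pos[of "l \<alpha>0 * l \<alpha>0" 0] by (metis mult_zero_right)
    qed
  qed
  define j :: 'n where "j = undefined"
  define c where "c i = (if i = j then \<bar>l \<alpha>0\<bar> else 1)" for i
  define L where "L i k = c i * M i k" for i k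
  have c: "c i > 0" for i using \<alpha>0(2) by (simp add: c_def)
  have "sgn (l \<alpha>0) * l \<alpha> = (\<Prod>i\<in>UNIV. L i (\<alpha> i))" if "\<alpha> \<le> \<kappa>" for \<alpha>
  proof -
    have "\<alpha> \<in> exps \<kappa>" using that by (simp add: exps_def)
    have "(\<Prod>i\<in>UNIV. L i (\<alpha> i)) = \<bar>l \<alpha>0\<bar> * (\<Prod>i\<in>UNIV. M i (\<alpha> i))"
      by (simp add: L_def c_def prod.distrib prod.delta)
    also have "\<dots> = sgn (l \<alpha>0) * l \<alpha>"
      unfolding lM[OF \<open>\<alpha> \<in> exps \<kappa>\<close>] by (simp add: abs_sgn mult_ac)
    finally show ?thesis ..
  qed
  moreover have "multiplier_seq1 (\<kappa> i) (L i)" for i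
    unfolding L_def by (rule multiplier_seq1_scale[OF M1]) (use c[of i] in simp)
  moreover have "(\<forall>i. \<forall>k\<le>\<kappa> i. L i k \<ge> 0) \<or> (\<forall>i. alternating_upto (\<kappa> i) (L i))"
  proof -
    have "alternating_upto (\<kappa> i) (L i)" if "alternating_upto (\<kappa> i) (M i)" for i
    proof -
      have "(-1) ^ k * L i k = c i * ((-1) ^ k * M i k)" for k by (simp add: L_def)
      then show ?thesis
        using that c[of i] by (simp add: alternating_upto_def zero_le_mult_iff mult_le_0_iff)
    qed
    moreover have "L i k \<ge> 0" if "M i k \<ge> 0" for i k
      using that c[of i] by (simp add: L_def)
    ultimately show ?thesis using signs by blast
  qed
  moreover have "sgn (l \<alpha>0) \<in> {1, -1}" using \<alpha>0(2) by (auto simp: sgn_if)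
  ultimately show ?thesis by blast
qed

lemma poly_pos_if_nonneg_coeffs:
  fixes q :: "real poly"
  assumes "\<And>k. coeff q k \<ge> 0" "q \<noteq> 0" "x > 0"
  shows "poly q x > 0"
proof -
  have "poly q x = (\<Sum>k\<le>degree q. coeff q k * x ^ k)" by (simp add: poly_altdef)
  also have "\<dots> > 0"
  proof (rule sum_pos2[of _ "degree q"])
    have "lead_coeff q > 0" using assms by (metis leading_coeff_0_iff less_eq_real_def)
    then show "coeff q (degree q) * x ^ degree q > 0" using assms by simp
  qed (use assms in auto)
  finally show ?thesis .
qed

text \<open>The factors are the images of \<open>(1 + x)\<^bsup>\<kappa>\<^sub>i\<^esup>\<close> under the one-dimensional operators, which are stable
and hence have real zeros. Their coefficients have constant or alternating sign, so no zero is
positive, or no zero is negative.\<close>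

lemma product_imp_factors:
  fixes \<kappa> :: "'n::finite \<Rightarrow> nat"
  assumes s: "s = 1 \<or> s = -1" and nz: "\<exists>\<alpha>\<in>exps \<kappa>. l \<alpha> \<noteq> 0"
    and L: "\<And>\<alpha>. \<alpha> \<in> exps \<kappa> \<Longrightarrow> s * l \<alpha> = (\<Prod>i\<in>UNIV. L i (\<alpha> i))"
    and ms: "\<And>i. multiplier_seq1 (\<kappa> i) (L i)"
    and signs: "(\<forall>i. \<forall>k\<le>\<kappa> i. L i k \<ge> 0) \<or> (\<forall>i. alternating_upto (\<kappa> i) (L i))"
  shows "\<exists>f. real_zero_factors f \<kappa> (symb \<kappa> l)"
proof -
  define g where "g i = (\<Sum>k\<le>\<kappa> i. monom (real (\<kappa> i choose k) * L i k) k)" for i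
  have cg: "coeff (g i) k = real (\<kappa> i choose k) * L i k" for i k
    by (simp add: g_def coeff_sum)
  have dg: "degree (g i) \<le> \<kappa> i" for i
    by (rule degree_le) (simp add: cg)
  have ev: "poly (map_poly of_real (g i)) w = ueval (\<kappa> i) (\<lambda>k. L i k * real (\<kappa> i choose k)) w" for i w
    unfolding ueval_coeff[OF dg, symmetric] by (simp add: ueval_def cg mult.commute)
  have zf: "poly (map_poly complex_of_real (g i)) w \<noteq> 0" if w: "Im w > 0" for i w
  proof -
    have b: "ueval (\<kappa> i) (\<lambda>k. real (\<kappa> i choose k)) z = (1 + z) ^ \<kappa> i" for z
      using ueval_binomial[of "\<kappa> i" 1 z] by simp
    have "1 + z \<noteq> 0" if "Im z > 0" for z using that by (auto simp: complex_eq_iff)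
    then have "\<forall>z. Im z > 0 \<longrightarrow> ueval (\<kappa> i) (\<lambda>k. real (\<kappa> i choose k)) z \<noteq> 0" by (simp add: b)
    then have "(\<forall>z. Im z > 0 \<longrightarrow> ueval (\<kappa> i) (\<lambda>k. L i k * real (\<kappa> i choose k)) z \<noteq> 0) \<or>
       (\<forall>k\<le>\<kappa> i. L i k * real (\<kappa> i choose k) = 0)"
      using ms[of i] unfolding multiplier_seq1_iff by blast
    moreover have "\<not> (\<forall>k\<le>\<kappa> i. L i k * real (\<kappa> i choose k) = 0)"
    proof
      assume *: "\<forall>k\<le>\<kappa> i. L i k * real (\<kappa> i choose k) = 0"
      obtain \<alpha> where \<alpha>: "\<alpha> \<in> exps \<kappa>" "l \<alpha> \<noteq> 0" using nz by blast
      have "L i (\<alpha> i) = 0"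
        using * \<alpha>(1) real_binomial_nonzero[OF \<alpha>(1), of i] by (auto simp: exps_iff)
      then have "(\<Prod>i\<in>UNIV. L i (\<alpha> i)) = 0" by (intro prod_zero) auto
      then have "s * l \<alpha> = 0" by (simp only: L[OF \<alpha>(1)])
      then show False using \<alpha>(2) s by auto
    qed
    ultimately show ?thesis unfolding ev using w by blast
  qed
  have rz: "real_zeros_only (g i)" for i
    unfolding real_zeros_only_def
  proof (intro allI impI)
    fix z assume z: "poly (map_poly complex_of_real (g i)) z = 0"
    have "poly (map_poly complex_of_real (g i)) (cnj z) = cnj (poly (map_poly complex_of_real (g i)) z)"
      unfolding ev by (simp add: ueval_def)
    then have "poly (map_poly complex_of_real (g i)) (cnj z) = 0" using z by simp
    then have "\<not> Im z > 0" "\<not> Im (cnj z) > 0" using zf z by blast+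
    then show "z \<in> \<real>" by (simp add: complex_is_Real_iff)
  qed
  have g0: "g i \<noteq> 0" for i by (rule real_zeros_only_nonzero[OF rz])
  have same: "zeros_same_sign g"
  proof -
    have "x \<le> 0" if nn: "\<forall>i. \<forall>k\<le>\<kappa> i. L i k \<ge> 0" and x: "poly (g i) x = 0" for i x
    proof (rule ccontr)
      assume "\<not> x \<le> 0"
      moreover have "coeff (g i) k \<ge> 0" for k
        using nn by (cases "k \<le> \<kappa> i") (auto simp: cg binomial_eq_0)
      ultimately show False using poly_pos_if_nonneg_coeffs[of "g i" x] g0 x by simp
    qed
    moreover have "x \<ge> 0" if alt: "\<forall>i. alternating_upto (\<kappa> i) (L i)" and x: "poly (g i) x = 0" for i x
    proof (rule ccontr)
      assume "\<not> x \<ge> 0"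
      then have pos: "- x > 0" by simp
      obtain t where t: "t = 1 \<or> t = (-1::real)" "\<forall>k\<le>\<kappa> i. t * ((-1) ^ k * L i k) \<ge> 0"
      proof (cases "\<forall>k\<le>\<kappa> i. (-1) ^ k * L i k \<ge> 0")
        case True
        then show ?thesis using that[of 1] by simp
      next
        case False
        then have "\<forall>k\<le>\<kappa> i. (-1) ^ k * L i k \<le> 0" using alt unfolding alternating_upto_def by blast
        then show ?thesis using that[of "-1"] by simp
      qed
      define q where "q = smult t (pcompose (g i) [:0, -1:])"
      have "coeff q k \<ge> 0" for k
      proof (cases "k \<le> \<kappa> i")
        case True
        have "coeff q k = real (\<kappa> i choose k) * (t * ((-1) ^ k * L i k))"
          by (simp add: q_def coeff_pcompose_linear cg)
        then show ?thesis using t(2) True by simp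
      qed (simp add: q_def coeff_pcompose_linear cg binomial_eq_0)
      moreover have "q \<noteq> 0" using t(1) g0[of i] by (auto simp: q_def pcompose_eq_0_iff)
      ultimately have "poly q (- x) > 0" using pos by (rule poly_pos_if_nonneg_coeffs)
      then show False using x by (simp add: q_def poly_pcompose)
    qed
    ultimately show ?thesis using signs unfolding zeros_same_sign_def by blast
  qed
  define j :: 'n where "j = undefined"
  define f where "f i = smult (if i = j then s else 1) (g i)" for i
  have pf: "poly (f i) x = 0 \<longleftrightarrow> poly (g i) x = 0" for i x
    using s by (auto simp: f_def)
  have cf: "poly (map_poly complex_of_real (f i)) x = 0 \<longleftrightarrow> poly (map_poly complex_of_real (g i)) x = 0" for i x
  proof -
    have "map_poly complex_of_real (f i) = smult (of_real (if i = j then s else 1)) (map_poly of_real (g i))"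
      unfolding f_def by (rule poly_eqI) (simp add: coeff_map_poly)
    then show ?thesis using s by auto
  qed
  have "(\<Prod>i\<in>UNIV. coeff (f i) (\<alpha> i)) = (if \<alpha> \<in> exps \<kappa> then symb \<kappa> l \<alpha> else 0)" for \<alpha>
  proof (cases "\<alpha> \<in> exps \<kappa>")
    case True
    have "(\<Prod>i\<in>UNIV. coeff (f i) (\<alpha> i)) = s * ((\<Prod>i\<in>UNIV. real (\<kappa> i choose \<alpha> i)) * (\<Prod>i\<in>UNIV. L i (\<alpha> i)))"
      by (simp add: f_def cg prod.distrib prod.delta)
    also have "\<dots> = symb \<kappa> l \<alpha>"
      using s by (auto simp: symb_def L[OF True, symmetric])
    finally show ?thesis using True by simp
  next
    case False
    then obtain i where "\<not> \<alpha> i \<le> \<kappa> i" by (auto simp: exps_iff)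
    then have "coeff (f i) (\<alpha> i) = 0" by (simp add: f_def cg)
    then show ?thesis using False by (auto intro!: prod_zero)
  qed
  then have "real_zero_factors f \<kappa> (symb \<kappa> l)"
    using rz same by (simp add: real_zero_factors_def real_zeros_only_def zeros_same_sign_def pf cf)
  then show ?thesis by blast
qed

lemma zero_multiplier:
  assumes "\<And>\<alpha>. \<alpha> \<in> exps \<kappa> \<Longrightarrow> l \<alpha> = 0"
  shows "multiplier_seq \<kappa> l"
  using assms by (simp add: multiplier_seq_iff)

theorem theorem4p5:
  fixes \<kappa> :: "'n::finite \<Rightarrow> nat" and l :: "('n \<Rightarrow> nat) \<Rightarrow> real"
  shows "let
      a = multiplier_seq \<kappa> l;
      b = (\<exists>s\<in>{1, -1}. \<exists>L :: 'n \<Rightarrow> nat \<Rightarrow> real.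
             (\<forall>\<alpha>\<le>\<kappa>. s * l \<alpha> = (\<Prod>i\<in>UNIV. L i (\<alpha> i))) \<and>
             (\<forall>i. multiplier_seq1 (\<kappa> i) (L i)) \<and>
             ((\<forall>i. \<forall>k\<le>\<kappa> i. L i k \<ge> 0) \<or> (\<forall>i. alternating_upto (\<kappa> i) (L i))));
      c = (real_stable (mult_op_z l (\<Prod>i\<in>UNIV. (zvar i + wvar i) ^ \<kappa> i)) \<or>
           real_stable (mult_op_z l (\<Prod>i\<in>UNIV. (zvar i - wvar i) ^ \<kappa> i)));
      d = (splits_real_same_sign (mult_op_z l (\<Prod>i\<in>UNIV. (1 + zvar i * wvar i) ^ \<kappa> i)) \<or>
           splits_real_same_sign (mult_op_z l (\<Prod>i\<in>UNIV. (1 - zvar i * wvar i) ^ \<kappa> i)))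
    in (a \<longleftrightarrow> b) \<and> (c \<longleftrightarrow> d) \<and> ((\<exists>\<alpha>\<le>\<kappa>. l \<alpha> \<noteq> 0) \<longrightarrow> (a \<longleftrightarrow> c))"
proof -
  let ?a = "multiplier_seq \<kappa> l"
  let ?b = "\<exists>s\<in>{1, -1}. \<exists>L :: 'n \<Rightarrow> nat \<Rightarrow> real.
             (\<forall>\<alpha>\<le>\<kappa>. s * l \<alpha> = (\<Prod>i\<in>UNIV. L i (\<alpha> i))) \<and>
             (\<forall>i. multiplier_seq1 (\<kappa> i) (L i)) \<and>
             ((\<forall>i. \<forall>k\<le>\<kappa> i. L i k \<ge> 0) \<or> (\<forall>i. alternating_upto (\<kappa> i) (L i)))"
  let ?D = "\<exists>f. real_zero_factors f \<kappa> (symb \<kappa> l)"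
  have nz: "(\<exists>\<alpha>\<in>exps \<kappa>. l \<alpha> \<noteq> 0) \<longleftrightarrow> (\<exists>\<alpha>\<le>\<kappa>. l \<alpha> \<noteq> 0)" by (simp add: exps_def Bex_def)
  have Da: "?D \<Longrightarrow> ?a" using factors_imp_multiplier by blast
  have "(?a \<longleftrightarrow> ?b) \<and> ((\<exists>\<alpha>\<le>\<kappa>. l \<alpha> \<noteq> 0) \<longrightarrow> (?a \<longleftrightarrow> ?D))"
  proof (cases "\<exists>\<alpha>\<le>\<kappa>. l \<alpha> \<noteq> 0")
    case True
    have ab: "?b" if "?a" by (rule multiplier_imp_product[OF that]) (use True nz in blast)
    have bD: "?D" if b: "?b"
    proof -
      obtain s L where *: "s \<in> {1, -1}" "\<forall>\<alpha>\<le>\<kappa>. s * l \<alpha> = (\<Prod>i\<in>UNIV. L i (\<alpha> i))"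
        "\<forall>i. multiplier_seq1 (\<kappa> i) (L i)"
        "(\<forall>i. \<forall>k\<le>\<kappa> i. L i k \<ge> 0) \<or> (\<forall>i. alternating_upto (\<kappa> i) (L i))"
        using b by blast
      show ?D
        by (rule product_imp_factors[of s \<kappa> l L]) (use * True nz in \<open>auto simp: exps_def\<close>)
    qed
    show ?thesis using ab bD Da by blast
  next
    case False
    have a: ?a by (rule zero_multiplier) (use False in \<open>auto simp: exps_def\<close>)
    have "multiplier_seq1 k (\<lambda>_. 0)" for k by (simp add: multiplier_seq1_iff)
    then have ?b using False by (intro bexI[of _ 1] exI[of _ "\<lambda>_ _. 0"]) auto
    with a show ?thesis using False by blast
  qed
  then show ?thesis unfolding Let_def stable_iff_factors splits_iff_factors by blast
qed

end
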